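(* Let $\partial\Omega$ be a surface and $\Psi=(\Psi^{\partial\Omega},\tilde\Psi^{\partial\Omega})$ a wavelet basis on it as described in the context. For $\gamma\in\mathbb R$ let $(\alpha+\gamma,p_0,q_0)$ and $(\alpha,p_1,q_1)$ be admissible parameter tuples. If $\gamma>2\cdot\max\left\{0,\frac1{p_0}-\frac1{p_1}\right\}$, then $$\sigma_n\left(B^{\alpha+\gamma}_{\Psi,q_0}(L_{p_0}(\partial\Omega));\Psi^{\partial\Omega},B^\alpha_{\Psi,q_1}(L_{p_1}(\partial\Omega))\right)\sim n^{-\gamma/2}.$$ Moreover, if $\gamma=2\cdot\max\left\{0,\frac1{p_0}-\frac1{p_1}\right\}$ and $q_0\le q_1$, then $$\sigma_n\left(B^{\alpha+\gamma}_{\Psi,q_0}(L_{p_0}(\partial\Omega));\Psi^{\partial\Omega},B^\alpha_{\Psi,q_1}(L_{p_1}(\partial\Omega))\right)\sim n^{-\min\{\gamma/2,\,1/q_0-1/q_1\}}.$$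
   Context: Notation: $a\lesssim b$ means $a\le c\,b$ with a constant $c>0$ independent of the context-dependent parameters (here: of $n\in\mathbb N$); $a\sim b$ means $a\lesssim b$ and $b\lesssim a$. $\mathrm{dist}$ is the shortest distance along $\partial\Omega$. Surface. $\Omega\subset\mathbb R^3$ is a bounded, simply connected, closed polyhedron with finitely many flat quadrilateral sides and straight edges, and $\partial\Omega$ is Lipschitz. Write $\partial\Omega=\bigcup_{i=1}^I\overline{F_i}$, where each open patch $F_i$ is a subset of an affine plane, bounded by a closed polygonal chain connecting exactly four vertices of $\Omega$ (not necessarily convex); $\overline{F_i}\cap\overline{F_\ell}$, $i\ne\ell$, is empty, a common edge, or a common vertex. There are sufficiently smooth diffeomorphic parametrizations $\kappa_i:[0,1]^2\to\overline{F_i}$. Wavelet basis. $\langle u,v\rangle:=\sum_{i=1}^I\langle u\circ\kappa_i,v\circ\kappa_i\rangle_\square$, with $\langle\cdot,\cdot\rangle_\square$ the $L_2([0,1]^2)$ inner product; the induced norm is equivalent to that of $L_2(\partial\Omega)$. $\Psi=(\Psi^{\partial\Omega},\tilde\Psi^{\partial\Omega})$ is a fixed pair of $\langle\cdot,\cdot\rangle$-biorthogonal Riesz bases of $L_2(\partial\Omega)$, consisting of finitely many generators on the coarsest level $j^*-1$ and of wavelets $\psi^{\partial\Omega}_{j,\xi}$ resp. $\tilde\psi^{\partial\Omega}_{j,\xi}$, $j\ge j^*$, $\xi\in\nabla_j^{\partial\Omega}$; every $u\in L_2(\partial\Omega)$ has the unique expansion $u=P_{j^*-1}(u)+\sum_{j\ge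 j^*}\sum_{\xi\in\nabla_j^{\partial\Omega}}\langle u,\tilde\psi_{j,\xi}^{\partial\Omega}\rangle\psi_{j,\xi}^{\partial\Omega}$, where $P_{j^*-1}$ is the biorthogonal projector onto the span of the primal generators, and $\|u\mid L_2(\partial\Omega)\|\sim\|P_{j^*-1}(u)\mid L_2(\partial\Omega)\|+(\sum_{j,\xi}|\langle u,\tilde\psi_{j,\xi}^{\partial\Omega}\rangle|^2)^{1/2}$. Assumed are: (I) the index sets consist of grid points on $\partial\Omega$, $\nabla_j^{\partial\Omega}=\bigcup_{i=1}^I\nabla_j^{F_i}$ with $\#\nabla_j^{F_i}\sim2^{2j}$ (grid points belonging to $\overline{F_i}$); (II) $\|\tilde\psi_{j,\xi}^{\partial\Omega}\mid L_2(\partial\Omega)\|\sim1$; (III) $\tilde\psi_{j,\xi}^{\partial\Omega}$ has compact support containing $\xi$ with $|\mathrm{supp}\,\tilde\psi_{j,\xi}^{\partial\Omega}|\sim2^{-2j}$; (IV) vanishing moments of order $\tilde d\in\mathbb N$: $\langle\mathcal P,\tilde\psi_{j,\xi}^{\partial\Omega}\circ\kappa_i\rangle_\square=0$ for all polynomials $\mathcal P$ on $[0,1]^2$ of total degree $<\tilde d$ whenever $\tilde\psi_{j,\xi}^{\partial\Omega}$ is completely supported in the interior of a patch $F_i$; (V) $\#\{\xi\in\nabla_j^{\partial\Omega}:0<\mathrm{dist}(\mathrm{supp}\,\tilde\psi_{j,\xi}^{\partial\Omega},\bigcup_i\partial F_i)\lesssim2^{-j}\}\sim2^j$ and $\#\{\xi\in\nabla_j^{\partial\Omega}:\mathrm{supp}\,\tilde\psi_{j,\xi}^{\partial\Omega}\cap\bigcup_i\partial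 F_i\ne\emptyset\}\lesssim2^j$; (VI) $\#\{\xi\in\nabla_j^{\partial\Omega}:x\in\mathrm{supp}\,\tilde\psi_{j,\xi}^{\partial\Omega}\}\lesssim1$ for all $j\ge j^*$, $x\in\partial\Omega$; (VII) for $-\frac12<s<\min\{\frac32,s_{\partial\Omega}\}$, where $s_{\partial\Omega}\ge1$ depends only on the angles between patches, $\|u\mid H^s(\partial\Omega)\|\sim\|P_{j^*-1}(u)\mid L_2(\partial\Omega)\|+(\sum_{j\ge j^*}\sum_{\xi\in\nabla_j^{\partial\Omega}}2^{2sj}|\langle u,\tilde\psi_{j,\xi}^{\partial\Omega}\rangle|^2)^{1/2}$ ($H^s$ for negative $s$ defined by duality). Besov-type spaces. A tuple of real parameters $(\alpha,p,q)$ is admissible if $\frac12\le\frac1p\le\frac\alpha2+\frac12$ and $0<q\le2$ if $1/p=\alpha/2+1/2$, $0<q\le\infty$ otherwise. For admissible $(\alpha,p,q)$, $B^\alpha_{\Psi,q}(L_p(\partial\Omega))$ is the set of $u\in L_2(\partial\Omega)$ with $$\|u\mid B^\alpha_{\Psi,q}(L_p(\partial\Omega))\|:=\|P_{j^*-1}(u)\mid L_p(\partial\Omega)\|+\left(\sum_{j\ge j^*}2^{j(\alpha+2[\frac12-\frac1p])q}\left[\sum_{\xi\in\nabla_j^{\partial\Omega}}|\langle u,\tilde\psi_{j,\xi}^{\partial\Omega}\rangle|^p\right]^{q/p}\right)^{1/q}<\infty$$ (supremum over $j$ if $q=\infty$). Best $n$-term approximation. For a (quasi-)normed space $G$, a countable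 subset $\mathcal B=\{f_1,f_2,\dots\}\subset G$ and $f\in G$, $\sigma_n(f;\mathcal B,G):=\inf_{i_1,\dots,i_n\in\mathbb N}\inf_{c_1,\dots,c_n\in\mathbb C}\|f-\sum_{m=1}^nc_mf_{i_m}\mid G\|$. For a (quasi-)normed space $F$ embedded into $G$, $\sigma_n(F;\mathcal B,G):=\sup_{f\in F,\ \|f\mid F\|\le1}\sigma_n(f;\mathcal B,G)$. As dictionary, $\Psi^{\partial\Omega}$ denotes the system of all primal generators and primal wavelets. *)

theory Defs
  imports "HOL-Analysis.Analysis"
begin

section \<open>Estimates up to constants\<close>

definition lesssim_on :: "'i set \<Rightarrow> ('i \<Rightarrow> ennreal) \<Rightarrow> ('i \<Rightarrow> ennreal) \<Rightarrow> bool" where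
  "lesssim_on X f g \<longleftrightarrow> (\<exists>C::real. C > 0 \<and> (\<forall>x\<in>X. f x \<le> ennreal C * g x))"

definition sim_on :: "'i set \<Rightarrow> ('i \<Rightarrow> ennreal) \<Rightarrow> ('i \<Rightarrow> ennreal) \<Rightarrow> bool" where
  "sim_on X f g \<longleftrightarrow> lesssim_on X f g \<and> lesssim_on X g f"


section \<open>Patchwise flat surfaces\<close>

text \<open>
  The polyhedron is \<open>body\<close>; its boundary is made of the open patches \<open>patch i\<close>, \<open>i < npatch\<close>,
  each with the four vertices \<open>corner i 0, \<dots>, corner i 3\<close> in cyclic order and parametrized by
  \<open>kappa i\<close> over the unit square \<open>cbox 0 1\<close>.
\<close>

record surface =
  body :: "(real^3) set"
  npatch :: nat
  patch :: "nat \<Rightarrow> (real^3) set"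
  corner :: "nat \<Rightarrow> nat \<Rightarrow> real^3"
  kappa :: "nat \<Rightarrow> real^2 \<Rightarrow> real^3"

definition edge :: "surface \<Rightarrow> nat \<Rightarrow> nat \<Rightarrow> (real^3) set" where
  "edge S i k = closed_segment (corner S i k) (corner S i ((k + 1) mod 4))"

definition skeleton :: "surface \<Rightarrow> (real^3) set" where
  "skeleton S = (\<Union>i<npatch S. rel_frontier (patch S i))"

text \<open>Near each boundary point, the set is the subgraph, in some direction \<open>e\<close>, of a Lipschitz
  function of the component orthogonal to \<open>e\<close>.\<close>

definition lipschitz_domain :: "'a::euclidean_space set \<Rightarrow> bool" where
  "lipschitz_domain D \<longleftrightarrow>
     (\<forall>x\<in>frontier D. \<exists>U e f L. open U \<and> x \<in> U \<and> norm e = 1 \<and> lipschitz_on L UNIV (f :: 'a \<Rightarrow> real) \<and>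
        (\<forall>y\<in>U. y \<in> D \<longleftrightarrow> (y - x) \<bullet> e \<le> f (y - ((y - x) \<bullet> e) *\<^sub>R e)))"

abbreviation kappa_deriv :: "surface \<Rightarrow> nat \<Rightarrow> real^2 \<Rightarrow> real^2 \<Rightarrow> real^3" where
  "kappa_deriv S i x \<equiv> frechet_derivative (kappa S i) (at x)"

text \<open>
  On smoothness: a parametrization that is continuously differentiable with invertible derivative
  up to the corners of the square cannot have a nonconvex quadrilateral as its image.  As nonconvex
  patches are allowed, \<open>kappa i\<close> is a homeomorphism of the closed square and a \<open>C\<^sup>1\<close>-diffeomorphism
  of the open square whose derivative and inverse derivative are bounded.  Every diffeomorphism of
  the closed square has these properties.
\<close>

locale polyhedral_surface =
  fixes S :: surface
  assumes compact_body: "compact (body S)"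
    and body_nonempty: "body S \<noteq> {}"
    and simply_connected_body: "simply_connected (body S)"
    and lipschitz_body: "lipschitz_domain (body S)"
    and boundary_eq: "frontier (body S) = (\<Union>i<npatch S. closure (patch S i))"
    and patch_planar: "\<And>i. i < npatch S \<Longrightarrow> aff_dim (patch S i) = 2"
    and patch_open: "\<And>i. i < npatch S \<Longrightarrow> openin (top_of_set (affine hull patch S i)) (patch S i)"
    and patch_bounded: "\<And>i. i < npatch S \<Longrightarrow> bounded (patch S i)"
    and patch_polygon: "\<And>i. i < npatch S \<Longrightarrow>
          simple_path (linepath (corner S i 0) (corner S i 1) +++ linepath (corner S i 1) (corner S i 2) +++
                       linepath (corner S i 2) (corner S i 3) +++ linepath (corner S i 3) (corner S i 0))"
    and patch_boundary: "\<And>i. i < npatch S \<Longrightarrow> rel_frontier (patch S i) = (\<Union>k<4. edge S i k)"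
    and patch_intersection: "\<And>i l. i < npatch S \<Longrightarrow> l < npatch S \<Longrightarrow> i \<noteq> l \<Longrightarrow>
          closure (patch S i) \<inter> closure (patch S l) = {} \<or>
          (\<exists>k<4. \<exists>m<4. closure (patch S i) \<inter> closure (patch S l) = edge S i k \<and> edge S i k = edge S l m) \<or>
          (\<exists>k<4. \<exists>m<4. closure (patch S i) \<inter> closure (patch S l) = {corner S i k} \<and>
                       corner S i k = corner S l m)"
    and kappa_homeomorphism: "\<And>i. i < npatch S \<Longrightarrow>
          \<exists>g. homeomorphism (cbox 0 1) (closure (patch S i)) (kappa S i) g"
    and kappa_interior: "\<And>i. i < npatch S \<Longrightarrow> kappa S i ` box 0 1 = patch S i"
    and kappa_differentiable: "\<And>i x. i < npatch S \<Longrightarrow> x \<in> box 0 1 \<Longrightarrow> kappa S i differentiable (at x)"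
    and kappa_C1: "\<And>i h. i < npatch S \<Longrightarrow> continuous_on (box 0 1) (\<lambda>x. kappa_deriv S i x h)"
    and kappa_nondegenerate: "\<And>i. i < npatch S \<Longrightarrow>
          \<exists>c C. 0 < c \<and> 0 < C \<and>
            (\<forall>x\<in>box 0 1. \<forall>h. c * norm h \<le> norm (kappa_deriv S i x h) \<and>
                             norm (kappa_deriv S i x h) \<le> C * norm h)"

definition area_jacobian :: "surface \<Rightarrow> nat \<Rightarrow> real^2 \<Rightarrow> real" where
  "area_jacobian S i x = norm (cross3 (kappa_deriv S i x (axis 1 1)) (kappa_deriv S i x (axis 2 1)))"

text \<open>Surface area on the boundary, as a Borel measure on the ambient space: the sum over all \<open>i\<close> of
  the images under \<open>kappa i\<close> of the Jacobian times Lebesgue measure.  Here and below integrals are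
  taken over the open square, since the boundary of the square is a null set.\<close>

definition area :: "surface \<Rightarrow> (real^3) measure" where
  "area S = distr (density (count_space {..<npatch S} \<Otimes>\<^sub>M restrict_space lborel (box 0 1))
                     (\<lambda>(i, x). ennreal (area_jacobian S i x)))
                  borel (\<lambda>(i, x). kappa S i x)"

definition L2 :: "surface \<Rightarrow> (real^3 \<Rightarrow> complex) set" where
  "L2 S = {u \<in> borel_measurable borel. integrable (area S) (\<lambda>x. (norm (u x))\<^sup>2)}"

definition lp_norm :: "surface \<Rightarrow> real \<Rightarrow> (real^3 \<Rightarrow> complex) \<Rightarrow> real" where
  "lp_norm S p u = (\<integral>x. norm (u x) powr p \<partial>area S) powr (1 / p)"

definition pairing :: "surface \<Rightarrow> (real^3 \<Rightarrow> complex) \<Rightarrow> (real^3 \<Rightarrow> complex) \<Rightarrow> complex" where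
  "pairing S u v = (\<Sum>i<npatch S. LINT x:box 0 1|lborel. u (kappa S i x) * cnj (v (kappa S i x)))"

text \<open>The support of a function as an element of \<open>L2\<close>, insensitive to changes on null sets.\<close>

definition support :: "surface \<Rightarrow> (real^3 \<Rightarrow> complex) \<Rightarrow> (real^3) set" where
  "support S u = {x \<in> frontier (body S).
     \<forall>U. open U \<and> x \<in> U \<longrightarrow> emeasure (area S) {y \<in> U. u y \<noteq> 0} > 0}"

definition path_length :: "(real \<Rightarrow> 'a::metric_space) \<Rightarrow> ennreal" where
  "path_length g = (SUP (n, t) \<in> {(n, t). (\<forall>k\<le>n. t k \<in> {0..1}) \<and> (\<forall>k<n. t k \<le> t (Suc k))}.
     \<Sum>k<n. ennreal (dist (g (t k)) (g (t (Suc k)))))"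

definition surface_dist :: "surface \<Rightarrow> real^3 \<Rightarrow> real^3 \<Rightarrow> ennreal" where
  "surface_dist S x y = (INF g \<in> {g. path g \<and> path_image g \<subseteq> frontier (body S) \<and>
                                    pathstart g = x \<and> pathfinish g = y}. path_length g)"

definition surface_setdist :: "surface \<Rightarrow> (real^3) set \<Rightarrow> (real^3) set \<Rightarrow> ennreal" where
  "surface_setdist S A B = (INF x\<in>A. INF y\<in>B. surface_dist S x y)"


section \<open>Sobolev spaces on the surface\<close>

text \<open>The outward unit normal, i.e. near \<open>x\<close> the polyhedron is the half space below the plane through
  \<open>x\<close> with normal \<open>outer_normal S x\<close>.  It is meaningful in the interior of the patches only.\<close>

definition outer_normal :: "surface \<Rightarrow> real^3 \<Rightarrow> real^3" where
  "outer_normal S x = (THE \<nu>. norm \<nu> = 1 \<and>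
     (\<exists>r>0. \<forall>y\<in>ball x r. y \<in> body S \<longleftrightarrow> (y - x) \<bullet> \<nu> \<le> 0))"

text \<open>\<open>w\<close> is the weak surface curl \<open>\<nu> \<times> \<nabla>u\<close>.  By Stokes' theorem
  \<open>\<integral> \<nu> \<times> \<nabla>(u \<phi>) = 0\<close> over the boundary, so for smooth \<open>u\<close> the identity below is integration by
  parts, including across the edges.  Pointwise \<open>\<nu> \<times> \<nabla>u\<close> is the tangential gradient rotated by a
  right angle.\<close>

definition has_weak_curl :: "surface \<Rightarrow> (real^3 \<Rightarrow> complex) \<Rightarrow> (real^3 \<Rightarrow> complex^3) \<Rightarrow> bool" where
  "has_weak_curl S u w \<longleftrightarrow>
     w \<in> borel_measurable borel \<and> integrable (area S) (\<lambda>x. (norm (w x))\<^sup>2) \<and>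
     (\<forall>\<phi> D. (\<forall>x. GDERIV \<phi> x :> D x) \<and> continuous_on UNIV D \<longrightarrow>
        (\<forall>k. (\<integral>x. u x * complex_of_real (cross3 (outer_normal S x) (D x) $ k) \<partial>area S) =
             - (\<integral>x. w x $ k * complex_of_real (\<phi> x) \<partial>area S)))"

definition L2_energy :: "surface \<Rightarrow> (real^3 \<Rightarrow> 'b::real_normed_vector) \<Rightarrow> ennreal" where
  "L2_energy S u = (\<integral>\<^sup>+x. ennreal ((norm (u x))\<^sup>2) \<partial>area S)"

definition slobodeckij_energy :: "surface \<Rightarrow> real \<Rightarrow> (real^3 \<Rightarrow> 'b::real_normed_vector) \<Rightarrow> ennreal" where
  "slobodeckij_energy S s u =
     (\<integral>\<^sup>+x. (\<integral>\<^sup>+y. ennreal ((norm (u x - u y))\<^sup>2 / norm (x - y) powr (2 + 2 * s)) \<partial>area S) \<partial>area S)"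

text \<open>The squared norm in \<open>H\<^sup>s\<close> for \<open>0 \<le> s < 2\<close>, with value \<open>\<infinity>\<close> off the space.  The weak curl is
  unique almost everywhere, so the infima run over at most one value.\<close>

definition hs_energy :: "surface \<Rightarrow> real \<Rightarrow> (real^3 \<Rightarrow> complex) \<Rightarrow> ennreal" where
  "hs_energy S s u =
     (if s = 0 then L2_energy S u
      else if s < 1 then L2_energy S u + slobodeckij_energy S s u
      else if s = 1 then L2_energy S u + (INF w \<in> {w. has_weak_curl S u w}. L2_energy S w)
      else L2_energy S u +
           (INF w \<in> {w. has_weak_curl S u w}. L2_energy S w + slobodeckij_energy S (s - 1) w))"

text \<open>For \<open>s < 0\<close>, \<open>H\<^sup>s\<close> is the dual of \<open>H\<^bsup>-s\<^esup>\<close> with pivot space \<open>L2\<close>, i.e. the completion of \<open>L2\<close> in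
  the dual norm.  Norm equivalences are stated on the dense subspace \<open>L2\<close>, from which they extend
  by continuity.\<close>

definition hs_space :: "surface \<Rightarrow> real \<Rightarrow> (real^3 \<Rightarrow> complex) set" where
  "hs_space S s = (if s < 0 then L2 S else {u \<in> L2 S. hs_energy S s u < \<infinity>})"

definition hs_norm :: "surface \<Rightarrow> real \<Rightarrow> (real^3 \<Rightarrow> complex) \<Rightarrow> real" where
  "hs_norm S s u =
     (if s < 0 then (SUP v \<in> {v \<in> L2 S. hs_energy S (- s) v \<le> 1}. norm (\<integral>x. u x * cnj (v x) \<partial>area S))
      else sqrt (enn2real (hs_energy S s u)))"


section \<open>Biorthogonal wavelet bases\<close>

text \<open>\<open>gen k\<close> and \<open>dgen k\<close>, \<open>k < ngen\<close>, are the primal and dual generators on level \<open>jstar - 1\<close>;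
  \<open>wav j \<xi>\<close> and \<open>dwav j \<xi>\<close>, \<open>j \<ge> jstar\<close>, \<open>\<xi> \<in> nabla j\<close>, are the primal and dual wavelets.\<close>

record wavelets =
  jstar :: nat
  ngen :: nat
  gen :: "nat \<Rightarrow> real^3 \<Rightarrow> complex"
  dgen :: "nat \<Rightarrow> real^3 \<Rightarrow> complex"
  nabla :: "nat \<Rightarrow> (real^3) set"
  wav :: "nat \<Rightarrow> real^3 \<Rightarrow> real^3 \<Rightarrow> complex"
  dwav :: "nat \<Rightarrow> real^3 \<Rightarrow> real^3 \<Rightarrow> complex"

definition wav_index :: "wavelets \<Rightarrow> (nat \<times> (real^3)) set" where
  "wav_index W = (SIGMA j:{jstar W..}. nabla W j)"

definition basis_index :: "wavelets \<Rightarrow> (nat + nat \<times> (real^3)) set" where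
  "basis_index W = {..<ngen W} <+> wav_index W"

definition primal :: "wavelets \<Rightarrow> nat + nat \<times> (real^3) \<Rightarrow> real^3 \<Rightarrow> complex" where
  "primal W = case_sum (gen W) (\<lambda>(j, \<xi>). wav W j \<xi>)"

definition dual :: "wavelets \<Rightarrow> nat + nat \<times> (real^3) \<Rightarrow> real^3 \<Rightarrow> complex" where
  "dual W = case_sum (dgen W) (\<lambda>(j, \<xi>). dwav W j \<xi>)"

definition dictionary :: "wavelets \<Rightarrow> (real^3 \<Rightarrow> complex) set" where
  "dictionary W = primal W ` basis_index W"

definition riesz_basis :: "surface \<Rightarrow> 'i set \<Rightarrow> ('i \<Rightarrow> real^3 \<Rightarrow> complex) \<Rightarrow> bool" where
  "riesz_basis S I f \<longleftrightarrow>
     (\<forall>i\<in>I. f i \<in> L2 S) \<and>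
     (\<forall>u\<in>L2 S. \<forall>\<epsilon>>0. \<exists>T c. finite T \<and> T \<subseteq> I \<and> lp_norm S 2 (\<lambda>x. u x - (\<Sum>i\<in>T. c i * f i x)) < \<epsilon>) \<and>
     (\<exists>A B. 0 < A \<and> 0 < B \<and>
        (\<forall>T c. finite T \<and> T \<subseteq> I \<longrightarrow>
           A * (\<Sum>i\<in>T. (norm (c i))\<^sup>2) \<le> (lp_norm S 2 (\<lambda>x. \<Sum>i\<in>T. c i * f i x))\<^sup>2 \<and>
           (lp_norm S 2 (\<lambda>x. \<Sum>i\<in>T. c i * f i x))\<^sup>2 \<le> B * (\<Sum>i\<in>T. (norm (c i))\<^sup>2)))"

definition gen_proj :: "surface \<Rightarrow> wavelets \<Rightarrow> (real^3 \<Rightarrow> complex) \<Rightarrow> real^3 \<Rightarrow> complex" where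
  "gen_proj S W u x = (\<Sum>k<ngen W. pairing S u (dgen W k) * gen W k x)"

definition level_sum :: "surface \<Rightarrow> wavelets \<Rightarrow> real \<Rightarrow> (real^3 \<Rightarrow> complex) \<Rightarrow> nat \<Rightarrow> real" where
  "level_sum S W p u j = (\<Sum>\<xi>\<in>nabla W j. norm (pairing S u (dwav W j \<xi>)) powr p)"

text \<open>\<open>(\<Sum>\<^sub>j 2\<^bsup>j\<beta>q\<^esup> [\<Sum>\<^sub>\<xi> \<bar>c\<bar>\<^sup>p]\<^bsup>q/p\<^esup>)\<^bsup>1/q\<^esup>\<close>, with the supremum over \<open>j\<close> if \<open>q = \<infinity>\<close>, where \<open>c\<close> are the
  wavelet coefficients.\<close>

definition coeff_norm ::
    "surface \<Rightarrow> wavelets \<Rightarrow> real \<Rightarrow> real \<Rightarrow> ereal \<Rightarrow> (real^3 \<Rightarrow> complex) \<Rightarrow> ennreal" where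
  "coeff_norm S W \<beta> p q u =
     (if q = \<infinity> then SUP j\<in>{jstar W..}. ennreal (2 powr (real j * \<beta>) * level_sum S W p u j powr (1 / p))
      else let r = real_of_ereal q; a = (\<lambda>j. 2 powr (real j * \<beta> * r) * level_sum S W p u j powr (r / p)) in
        if a summable_on {jstar W..} then ennreal ((\<Sum>\<^sub>\<infinity>j\<in>{jstar W..}. a j) powr (1 / r)) else \<infinity>)"

locale wavelet_basis = polyhedral_surface S
  for S :: surface +
  fixes W :: wavelets
    and dt :: nat       \<comment> \<open>order of the vanishing moments\<close>
    and s_max :: real   \<comment> \<open>the bound on the smoothness determined by the angles between patches\<close>
  assumes riesz_primal: "riesz_basis S (basis_index W) (primal W)"
    and riesz_dual: "riesz_basis S (basis_index W) (dual W)"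
    and biorthogonal: "\<And>k l. k \<in> basis_index W \<Longrightarrow> l \<in> basis_index W \<Longrightarrow>
          pairing S (primal W k) (dual W l) = (if k = l then 1 else 0)"
    and expansion: "\<And>u. u \<in> L2 S \<Longrightarrow>
          (\<lambda>J. lp_norm S 2 (\<lambda>x. u x - (gen_proj S W u x +
             (\<Sum>j\<in>{jstar W..<J}. \<Sum>\<xi>\<in>nabla W j. pairing S u (dwav W j \<xi>) * wav W j \<xi> x)))) \<longlonglongrightarrow> 0"
    and L2_equivalence: "sim_on (L2 S) (\<lambda>u. ennreal (lp_norm S 2 u))
          (\<lambda>u. ennreal (lp_norm S 2 (gen_proj S W u)) + coeff_norm S W 0 2 2 u)"
    and nabla_grid: "\<And>j. j \<ge> jstar W \<Longrightarrow> finite (nabla W j) \<and> nabla W j \<subseteq> frontier (body S)"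
    and nabla_card: "sim_on ({jstar W..} \<times> {..<npatch S})
          (\<lambda>(j, i). of_nat (card (nabla W j \<inter> closure (patch S i)))) (\<lambda>(j, i). 2 ^ (2 * j))"
    and dwav_normalized: "sim_on (wav_index W) (\<lambda>(j, \<xi>). ennreal (lp_norm S 2 (dwav W j \<xi>))) (\<lambda>_. 1)"
    and dwav_support: "\<And>j \<xi>. (j, \<xi>) \<in> wav_index W \<Longrightarrow>
          compact (support S (dwav W j \<xi>)) \<and> \<xi> \<in> support S (dwav W j \<xi>)"
    and dwav_support_area: "sim_on (wav_index W)
          (\<lambda>(j, \<xi>). emeasure (area S) (support S (dwav W j \<xi>))) (\<lambda>(j, \<xi>). ennreal (2 powr (- 2 * real j)))"
    and dt_pos: "dt \<ge> 1"
    and vanishing_moments: "\<And>j \<xi> i a. (j, \<xi>) \<in> wav_index W \<Longrightarrow> i < npatch S \<Longrightarrow>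
          support S (dwav W j \<xi>) \<subseteq> patch S i \<Longrightarrow>
          (LINT x:box 0 1|lborel.
             (\<Sum>(m, n)\<in>{(m, n). m + n < dt}. a m n * complex_of_real ((x $ 1) ^ m * (x $ 2) ^ n)) *
             cnj (dwav W j \<xi> (kappa S i x))) = 0"
    and near_skeleton: "\<exists>C>0. sim_on {jstar W..}
          (\<lambda>j. of_nat (card {\<xi> \<in> nabla W j.
             0 < surface_setdist S (support S (dwav W j \<xi>)) (skeleton S) \<and>
             surface_setdist S (support S (dwav W j \<xi>)) (skeleton S) \<le> ennreal (C * 2 powr (- real j))}))
          (\<lambda>j. 2 ^ j)"
    and on_skeleton: "lesssim_on {jstar W..}
          (\<lambda>j. of_nat (card {\<xi> \<in> nabla W j. support S (dwav W j \<xi>) \<inter> skeleton S \<noteq> {}})) (\<lambda>j. 2 ^ j)"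
    and locally_finite: "lesssim_on ({jstar W..} \<times> frontier (body S))
          (\<lambda>(j, x). of_nat (card {\<xi> \<in> nabla W j. x \<in> support S (dwav W j \<xi>)})) (\<lambda>_. 1)"
    and s_max_ge_1: "s_max \<ge> 1"
    and sobolev_equivalence: "\<And>s. - 1 / 2 < s \<Longrightarrow> s < min (3 / 2) s_max \<Longrightarrow>
          sim_on (hs_space S s) (\<lambda>u. ennreal (hs_norm S s u))
            (\<lambda>u. ennreal (lp_norm S 2 (gen_proj S W u)) + coeff_norm S W s 2 2 u)"


section \<open>Besov-type spaces\<close>

definition admissible :: "real \<Rightarrow> real \<Rightarrow> ereal \<Rightarrow> bool" where
  "admissible \<alpha> p q \<longleftrightarrow> 1 / 2 \<le> 1 / p \<and> 1 / p \<le> \<alpha> / 2 + 1 / 2 \<and> 0 < q \<and>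
     (1 / p = \<alpha> / 2 + 1 / 2 \<longrightarrow> q \<le> 2)"

definition besov_norm ::
    "surface \<Rightarrow> wavelets \<Rightarrow> real \<Rightarrow> real \<Rightarrow> ereal \<Rightarrow> (real^3 \<Rightarrow> complex) \<Rightarrow> ennreal" where
  "besov_norm S W \<alpha> p q u =
     ennreal (lp_norm S p (gen_proj S W u)) + coeff_norm S W (\<alpha> + 2 * (1 / 2 - 1 / p)) p q u"

definition besov_space ::
    "surface \<Rightarrow> wavelets \<Rightarrow> real \<Rightarrow> real \<Rightarrow> ereal \<Rightarrow> (real^3 \<Rightarrow> complex) set" where
  "besov_space S W \<alpha> p q = {u \<in> L2 S. besov_norm S W \<alpha> p q u < \<infinity>}"


section \<open>Best \<open>n\<close>-term approximation\<close>

text \<open>A quasi-normed function space is given by its carrier and its quasi-norm; the quasi-norm of the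
  target space takes the value \<open>\<infinity>\<close> off that space.\<close>

definition best_approx ::
    "nat \<Rightarrow> ('a \<Rightarrow> complex) \<Rightarrow> ('a \<Rightarrow> complex) set \<Rightarrow> (('a \<Rightarrow> complex) \<Rightarrow> ennreal) \<Rightarrow> ennreal" where
  "best_approx n f D normG =
     (INF (b, c) \<in> {(b :: nat \<Rightarrow> 'a \<Rightarrow> complex, c :: nat \<Rightarrow> complex). \<forall>m<n. b m \<in> D}.
        normG (\<lambda>x. f x - (\<Sum>m<n. c m * b m x)))"

definition best_approx_class ::
    "nat \<Rightarrow> ('a \<Rightarrow> complex) set \<Rightarrow> (('a \<Rightarrow> complex) \<Rightarrow> ennreal) \<Rightarrow> ('a \<Rightarrow> complex) set \<Rightarrow>
     (('a \<Rightarrow> complex) \<Rightarrow> ennreal) \<Rightarrow> ennreal" where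
  "best_approx_class n F normF D normG = (SUP f \<in> {f \<in> F. normF f \<le> 1}. best_approx n f D normG)"

definition besov_sigma ::
    "surface \<Rightarrow> wavelets \<Rightarrow> real \<times> real \<times> ereal \<Rightarrow> real \<times> real \<times> ereal \<Rightarrow> nat \<Rightarrow> ennreal" where
  "besov_sigma S W = (\<lambda>(\<alpha>\<^sub>0, p\<^sub>0, q\<^sub>0) (\<alpha>\<^sub>1, p\<^sub>1, q\<^sub>1) n.
     best_approx_class n (besov_space S W \<alpha>\<^sub>0 p\<^sub>0 q\<^sub>0) (besov_norm S W \<alpha>\<^sub>0 p\<^sub>0 q\<^sub>0)
       (dictionary W) (besov_norm S W \<alpha>\<^sub>1 p\<^sub>1 q\<^sub>1))"

end

(*
  By the biorthogonality relations the quasi-norms depend only on the wavelet coefficients and on the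
  generator part, so the problem concerns best n-term approximation from b_{q_0}(l_{p_0}) to
  b_{q_1}(l_{p_1}) with about 4^j indices on level j.  On one level, thresholding with budget x
  reduces the error by the factor min(1, x^(-theta)), theta = max(0, 1/p_0 - 1/p_1).  If gamma > 2 theta,
  take all coefficients up to level J, 4^J ~ n, and geometrically decreasing budgets above.  If
  gamma = 2 theta, divide the budget n among the levels in proportion to the q_0-th powers of the
  level norms.  The finitely many generators are put into the approximant, and for small n the
  equivalence of the L_p quasi-norms on their span suffices.  The lower bounds come from 2n equal
  coefficients on one level with about n wavelets, and from one coefficient on each of 2n levels.
*)

theory Submission
  imports Defs
begin

section \<open>Finite \<open>p\<close>-sums\<close>

text \<open>The rate can be read off from one level. A budget of order 4^J at the level with 4^J ~ n
  leaves the factor 2^(-J \<eta>) (4^J)^(-\<theta>), where \<eta> = \<gamma> - 2 \<theta>, and this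
  is n^(-\<gamma>/2) up to a constant. If \<eta> > 0, the errors above that level still decrease
  geometrically, which is harmless in every l_q. If \<eta> = 0, all levels weigh the same. Let R_j
  be the source norm on level j, with the R_j^(q_0) summing to at most one. The budget n R_j^(q_0)
  leaves the error n^(-\<mu>) R_j^(1 - q_0 \<mu>) for each \<mu> up to \<theta>. These errors are
  bounded in l_(q_1) as soon as (1 - q_0 \<mu>) q_1 >= q_0, that is, \<mu> <= 1/q_0 - 1/q_1; hence
  the minimum in the limiting rate. What shapes the statements is uniformity: every constant has to
  be fixed before n and the function, and q_0, q_1 may be infinite. The lower bounds use 2n
  coefficients because an n-term approximant alters at most n of them, whatever its own coefficients
  are.\<close>

definition lp_sum :: "real \<Rightarrow> 'a set \<Rightarrow> ('a \<Rightarrow> real) \<Rightarrow> real" where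
  "lp_sum p A c = (\<Sum>x\<in>A. c x powr p) powr (1 / p)"

lemma lp_sum_nonneg: "0 \<le> lp_sum p A c"
  by (simp add: lp_sum_def)

lemma lp_sum_powr: "p > 0 \<Longrightarrow> lp_sum p A c powr p = (\<Sum>x\<in>A. c x powr p)"
  by (simp add: lp_sum_def powr_powr sum_nonneg)

lemma lp_sum_empty [simp]: "lp_sum p {} c = 0"
  by (simp add: lp_sum_def)

lemma lp_sum_mono:
  assumes "p > 0" "finite B" "A \<subseteq> B" "\<And>x. x \<in> A \<Longrightarrow> 0 \<le> c x \<and> c x \<le> d x"
  shows "lp_sum p A c \<le> lp_sum p B d"
proof -
  have "(\<Sum>x\<in>A. c x powr p) \<le> (\<Sum>x\<in>A. d x powr p)"
    using assms by (intro sum_mono powr_mono2) auto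
  also have "\<dots> \<le> (\<Sum>x\<in>B. d x powr p)"
    using assms by (intro sum_mono2) auto
  finally show ?thesis
    unfolding lp_sum_def using assms by (intro powr_mono2) (auto intro: sum_nonneg)
qed

lemma lp_sum_scale:
  assumes "p > 0" "k \<ge> 0" "\<And>x. x \<in> A \<Longrightarrow> 0 \<le> c x"
  shows "lp_sum p A (\<lambda>x. k * c x) = k * lp_sum p A c"
proof -
  have "(\<Sum>x\<in>A. (k * c x) powr p) = k powr p * (\<Sum>x\<in>A. c x powr p)"
    unfolding sum_distrib_left using assms by (intro sum.cong) (auto simp: powr_mult)
  thus ?thesis
    using assms by (simp add: lp_sum_def powr_mult powr_powr sum_nonneg)
qed

lemma lp_sum_const:
  assumes "p > 0" "t \<ge> 0"
  shows "lp_sum p A (\<lambda>_. t) = real (card A) powr (1 / p) * t"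
  using assms by (simp add: lp_sum_def powr_mult powr_powr)

lemma lp_sum_le_iff:
  assumes "p > 0" "B \<ge> 0"
  shows "lp_sum p A c \<le> B \<longleftrightarrow> (\<Sum>x\<in>A. c x powr p) \<le> B powr p"
proof
  assume "lp_sum p A c \<le> B"
  hence "lp_sum p A c powr p \<le> B powr p"
    using assms by (intro powr_mono2) (auto simp: lp_sum_nonneg)
  thus "(\<Sum>x\<in>A. c x powr p) \<le> B powr p" using assms by (simp add: lp_sum_powr)
next
  assume "(\<Sum>x\<in>A. c x powr p) \<le> B powr p"
  hence "lp_sum p A c \<le> (B powr p) powr (1 / p)"
    unfolding lp_sum_def using assms by (intro powr_mono2) (auto intro: sum_nonneg)
  thus "lp_sum p A c \<le> B" using assms by (simp add: powr_powr)
qed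

lemma le_lp_sum:
  assumes "p > 0" "finite A" "x \<in> A" "0 \<le> c x"
  shows "c x \<le> lp_sum p A c"
proof -
  have "c x powr p \<le> (\<Sum>x\<in>A. c x powr p)"
    using assms by (intro member_le_sum) auto
  hence "(c x powr p) powr (1 / p) \<le> lp_sum p A c"
    unfolding lp_sum_def using assms by (intro powr_mono2) auto
  thus ?thesis using assms by (simp add: powr_powr)
qed

text \<open>Termwise, \<open>c x powr q\<close> is at most \<open>m powr (q - p)\<close> times
  \<open>c x powr p\<close>. With \<open>m\<close> the \<open>p\<close>-sum itself this yields the
  embedding into larger exponents; with \<open>m\<close> a threshold it bounds what thresholding
  leaves behind.\<close>

lemma lp_sum_interpolate:
  assumes "0 < p" "p \<le> q" "\<And>x. x \<in> A \<Longrightarrow> 0 \<le> c x" "\<And>x. x \<in> A \<Longrightarrow> c x \<le> m" "m > 0"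
  shows "lp_sum q A c \<le> m powr (1 - p / q) * lp_sum p A c powr (p / q)"
proof -
  have "c x powr q \<le> m powr (q - p) * c x powr p" if "x \<in> A" for x
  proof (cases "c x = 0")
    case False
    hence "c x powr q = c x powr (q - p) * c x powr p"
      by (simp add: powr_add [symmetric])
    also have "\<dots> \<le> m powr (q - p) * c x powr p"
      using assms that by (intro mult_right_mono powr_mono2) auto
    finally show ?thesis .
  qed simp
  hence "(\<Sum>x\<in>A. c x powr q) \<le> m powr (q - p) * (\<Sum>x\<in>A. c x powr p)"
    by (simp add: sum_distrib_left sum_mono)
  hence "lp_sum q A c \<le> (m powr (q - p) * (\<Sum>x\<in>A. c x powr p)) powr (1 / q)"
    unfolding lp_sum_def using assms by (intro powr_mono2) (auto intro: sum_nonneg)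
  also have "\<dots> = m powr ((q - p) / q) * (\<Sum>x\<in>A. c x powr p) powr (1 / q)"
    by (simp add: powr_mult powr_powr sum_nonneg)
  also have "(q - p) / q = 1 - p / q" using assms by (simp add: field_simps)
  also have "(\<Sum>x\<in>A. c x powr p) powr (1 / q) = lp_sum p A c powr (p / q)"
    using assms by (simp add: lp_sum_def powr_powr)
  finally show ?thesis .
qed

lemma lp_sum_antimono:
  assumes "finite A" "0 < p" "p \<le> q" "\<And>x. x \<in> A \<Longrightarrow> 0 \<le> c x"
  shows "lp_sum q A c \<le> lp_sum p A c"
proof (cases "lp_sum p A c = 0")
  case True
  hence "c x = 0" if "x \<in> A" for x
    using le_lp_sum[of p A x c] assms that by force
  thus ?thesis using assms by (simp add: lp_sum_def)
next
  case False
  hence pos: "lp_sum p A c > 0" using lp_sum_nonneg[of p A c] by linarith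
  have "lp_sum q A c \<le> lp_sum p A c powr (1 - p / q) * lp_sum p A c powr (p / q)"
    using assms pos by (intro lp_sum_interpolate le_lp_sum) auto
  also have "\<dots> = lp_sum p A c"
    using pos by (simp add: powr_add [symmetric])
  finally show ?thesis .
qed

text \<open>Holder's inequality with exponent \<open>q / p\<close>, obtained from Young's inequality
  in each term. \<open>M\<close> only dominates the cardinality, since the size of a level is known
  up to a factor.\<close>

lemma lp_sum_power_mean:
  assumes "finite A" "real (card A) \<le> M" "M > 0" "0 < p" "p \<le> q" "\<And>x. x \<in> A \<Longrightarrow> 0 \<le> c x"
  shows "lp_sum p A c \<le> M powr (1 / p - 1 / q) * lp_sum q A c"
proof (cases "lp_sum q A c = 0")
  case True
  hence "c x = 0" if "x \<in> A" for x
    using le_lp_sum[of q A x c] assms that by force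
  thus ?thesis using assms by (simp add: lp_sum_def)
next
  case False
  define s where "s = p / q"
  define N where "N = (\<Sum>x\<in>A. c x powr q)"
  have N: "N > 0"
    using False sum_nonneg[of A "\<lambda>x. c x powr q"] unfolding N_def lp_sum_def
    by (cases "(\<Sum>x\<in>A. c x powr q) = 0") auto
  have s: "0 < s" "s \<le> 1" using assms by (auto simp: s_def)
  \<comment> \<open>Each term is weighed against the mean \<open>N / M\<close>, so that the
    right-hand sides sum to at most \<open>s * N + (1 - s) * N = N\<close>.\<close>
  have young: "c x powr p * (N / M) powr (1 - s) \<le> s * c x powr q + (1 - s) * (N / M)" if "x \<in> A" for x
  proof (cases "c x = 0")
    case True
    thus ?thesis using N s assms by simp
  next
    case False
    have "(c x powr q) powr s * (N / M) powr (1 - s) \<le> s * c x powr q + (1 - s) * (N / M)"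
      using False assms s N that by (intro Youngs_inequality_0) auto
    thus ?thesis using assms by (simp add: powr_powr s_def)
  qed
  have "(\<Sum>x\<in>A. c x powr p) * (N / M) powr (1 - s) \<le> (\<Sum>x\<in>A. s * c x powr q + (1 - s) * (N / M))"
    unfolding sum_distrib_right by (intro sum_mono young)
  also have "\<dots> = s * N + real (card A) * ((1 - s) * (N / M))"
    by (simp add: sum.distrib N_def sum_distrib_left)
  also have "\<dots> \<le> s * N + M * ((1 - s) * (N / M))"
    using assms s N by (intro add_left_mono mult_right_mono) auto
  also have "\<dots> = N" using assms by (simp add: field_simps)
  finally have "(\<Sum>x\<in>A. c x powr p) \<le> N / (N / M) powr (1 - s)"
    using N assms by (simp add: field_simps)
  also have "\<dots> = N powr s * M powr (1 - s)"
  proof -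
    have "N = N powr s * N powr (1 - s)" using N by (simp add: powr_add [symmetric])
    thus ?thesis using N assms by (simp add: powr_divide field_simps)
  qed
  finally have "lp_sum p A c \<le> (N powr s * M powr (1 - s)) powr (1 / p)"
    unfolding lp_sum_def using assms by (intro powr_mono2) (auto intro: sum_nonneg)
  also have "\<dots> = N powr (s / p) * M powr ((1 - s) / p)"
    by (simp add: powr_mult powr_powr)
  also have "s / p = 1 / q" using assms by (simp add: s_def)
  also have "(1 - s) / p = 1 / p - 1 / q" using assms by (simp add: s_def field_simps)
  finally show ?thesis by (simp add: lp_sum_def N_def mult.commute)
qed

text \<open>Chebyshev's inequality counts the terms above a threshold, and interpolation bounds the
  others. The budget \<open>x\<close> is real and may lie below one; then \<open>T\<close> is empty
  and the factor is at least one.\<close>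

lemma lp_sum_threshold:
  assumes "finite A" "0 < p" "p \<le> q" "\<And>a. a \<in> A \<Longrightarrow> 0 \<le> c a" "x > 0"
  shows "\<exists>T\<subseteq>A. real (card T) \<le> x \<and>
           lp_sum q (A - T) c \<le> x powr (- (1 / p - 1 / q)) * lp_sum p A c"
proof (cases "lp_sum p A c = 0")
  case True
  thus ?thesis using assms lp_sum_antimono[of A p q c] by (intro exI[of _ "{}"]) auto
next
  case False
  define P where "P = lp_sum p A c"
  have P: "P > 0" using False lp_sum_nonneg[of p A c] by (simp add: P_def)
  \<comment> \<open>The solution of \<open>x * m powr p = P powr p\<close>, so that at most
    \<open>x\<close> terms exceed it.\<close>
  define m where "m = P * x powr (- (1 / p))"
  have m: "m > 0" using P assms by (simp add: m_def)
  define T where "T = {a\<in>A. c a > m}"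
  have "real (card T) * m powr p = (\<Sum>a\<in>T. m powr p)" by simp
  also have "\<dots> \<le> (\<Sum>a\<in>T. c a powr p)"
    using m assms by (intro sum_mono powr_mono2) (auto simp: T_def)
  also have "\<dots> \<le> (\<Sum>a\<in>A. c a powr p)"
    using assms by (intro sum_mono2) (auto simp: T_def)
  also have "\<dots> = P powr p" using assms by (simp add: P_def lp_sum_powr)
  finally have "real (card T) * (P powr p * x powr (- 1)) \<le> P powr p"
    using P assms by (simp add: m_def powr_mult powr_powr)
  hence "P powr p * real (card T) \<le> P powr p * x"
    using assms by (simp add: powr_minus field_simps)
  hence card: "real (card T) \<le> x" using P by simp
  have "lp_sum q (A - T) c \<le> m powr (1 - p / q) * lp_sum p (A - T) c powr (p / q)"
    using assms m by (intro lp_sum_interpolate) (auto simp: T_def)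
  also have "\<dots> \<le> m powr (1 - p / q) * P powr (p / q)"
    unfolding P_def using assms by (intro mult_left_mono powr_mono2 lp_sum_mono) (auto simp: lp_sum_nonneg)
  also have "\<dots> = P powr (1 - p / q) * P powr (p / q) * x powr (- (1 / p) * (1 - p / q))"
    using P by (simp add: m_def powr_mult powr_powr mult_ac)
  also have "P powr (1 - p / q) * P powr (p / q) = P" using P by (simp add: powr_add [symmetric])
  also have "- (1 / p) * (1 - p / q) = - (1 / p - 1 / q)" using assms by (simp add: field_simps)
  finally show ?thesis using card by (intro exI[of _ T]) (auto simp: T_def P_def mult.commute)
qed


section \<open>Bounds in \<open>\<ell>\<^sub>q\<close>\<close>

text \<open>An upper bound on all finite sets of levels takes the place of a norm. Summability then
  enters only in the comparison with \<open>coeff_norm\<close>, and \<open>q = \<infinity>\<close>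
  becomes a statement of the same kind.\<close>

definition lq_le :: "ereal \<Rightarrow> nat set \<Rightarrow> (nat \<Rightarrow> real) \<Rightarrow> real \<Rightarrow> bool" where
  "lq_le q I E B \<longleftrightarrow>
     (if q = \<infinity> then \<forall>j\<in>I. E j \<le> B
      else \<forall>F. finite F \<and> F \<subseteq> I \<longrightarrow> lp_sum (real_of_ereal q) F E \<le> B)"

lemma lq_le_imp_le:
  assumes "lq_le q I E B" "q > 0" "j \<in> I" "0 \<le> E j"
  shows "E j \<le> B"
proof (cases q)
  case (real r)
  hence "lp_sum r {j} E \<le> B" using assms by (auto simp: lq_le_def)
  thus ?thesis using le_lp_sum[of r "{j}" j E] assms real by auto
qed (use assms in \<open>auto simp: lq_le_def\<close>)

lemma lq_le_mono:
  assumes "lq_le q I E B" "q > 0" "\<And>j. j \<in> I \<Longrightarrow> 0 \<le> D j \<and> D j \<le> k * E j" "k \<ge> 0"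
    "\<And>j. j \<in> I \<Longrightarrow> 0 \<le> E j" "k * B \<le> C"
  shows "lq_le q I D C"
proof (cases q)
  case (real r)
  show ?thesis unfolding lq_le_def
  proof (simp add: real, safe)
    fix F assume F: "finite F" "F \<subseteq> I"
    have "lp_sum r F D \<le> lp_sum r F (\<lambda>j. k * E j)"
      using F assms real by (intro lp_sum_mono) auto
    also have "\<dots> = k * lp_sum r F E" using F assms real by (intro lp_sum_scale) auto
    also have "\<dots> \<le> k * B" using assms F real by (intro mult_left_mono) (auto simp: lq_le_def)
    finally show "lp_sum r F D \<le> C" using assms by simp
  qed
next
  case PInf
  have "D j \<le> C" if "j \<in> I" for j
  proof -
    have "D j \<le> k * E j" using assms that by auto
    also have "\<dots> \<le> k * B" using assms PInf that by (intro mult_left_mono) (auto simp: lq_le_def)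
    finally show ?thesis using assms by simp
  qed
  thus ?thesis using PInf by (simp add: lq_le_def)
qed (use assms in auto)

lemma lq_le_antimono:
  assumes "lq_le q I E B" "0 < q" "q \<le> q'" "\<And>j. j \<in> I \<Longrightarrow> 0 \<le> E j"
  shows "lq_le q' I E B"
proof (cases q')
  case (real r')
  then obtain r where r: "q = ereal r" using assms by (cases q) auto
  show ?thesis unfolding lq_le_def
  proof (simp add: real, safe)
    fix F assume F: "finite F" "F \<subseteq> I"
    have "lp_sum r' F E \<le> lp_sum r F E"
      using F assms r real by (intro lp_sum_antimono) auto
    also have "\<dots> \<le> B" using assms F r by (auto simp: lq_le_def)
    finally show "lp_sum r' F E \<le> B" .
  qed
next
  case PInf
  thus ?thesis using lq_le_imp_le[OF assms(1,2)] assms(4) by (auto simp: lq_le_def)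
qed (use assms in auto)

text \<open>The bound depends neither on \<open>J\<close> nor on \<open>F\<close>; constants derived
  from it are therefore uniform in the number of terms.\<close>

lemma sum_geometric_tail_le:
  assumes "\<rho> > 0" "finite F"
  shows "(\<Sum>j\<in>F. if j < J then 0 else 2 powr (- (real j - real J) * \<rho>)) \<le> 1 / (1 - 2 powr (- \<rho>))"
proof -
  define b where "b = (2::real) powr (- \<rho>)"
  have b: "0 < b" "b < 1" using assms by (auto simp: b_def powr_less_one)
  have "(\<Sum>j\<in>F. if j < J then 0 else 2 powr (- (real j - real J) * \<rho>)) =
        (\<Sum>j\<in>F. if j < J then 0 else b ^ (j - J))"
    using b by (intro sum.cong refl) (auto simp: b_def powr_realpow [symmetric] powr_powr of_nat_diff algebra_simps)
  also have "\<dots> = (\<Sum>j\<in>F - {..<J}. b ^ (j - J))"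
    using assms by (intro sum.mono_neutral_cong_right) auto
  also have "\<dots> = (\<Sum>i\<in>(\<lambda>j. j - J) ` (F - {..<J}). b ^ i)"
    by (subst sum.reindex) (auto simp: inj_on_def)
  also have "\<dots> \<le> (\<Sum>i. b ^ i)"
    using b assms by (intro sum_le_suminf summable_geometric) auto
  also have "\<dots> = 1 / (1 - b)" using b by (simp add: suminf_geometric)
  finally show ?thesis by (simp add: b_def)
qed

text \<open>Raising to the power \<open>r\<close> changes the rate \<rho> to
  \<open>\<rho> * r\<close> and leaves a geometric series. \<open>C\<close> is quantified before
  \<open>J\<close> and \<open>Z\<close>, which later depend on the number of terms.\<close>

lemma lq_le_geometric:
  assumes "\<rho> > 0" "q > 0"
  shows "\<exists>C>0. \<forall>E I J Z. Z \<ge> 0 \<longrightarrow>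
           (\<forall>j\<in>I. 0 \<le> E j \<and> (j < J \<longrightarrow> E j = 0) \<and> (J \<le> j \<longrightarrow> E j \<le> Z * 2 powr (- (real j - real J) * \<rho>))) \<longrightarrow>
           lq_le q I E (C * Z)"
proof (cases q)
  case (real r)
  hence r: "r > 0" using assms by simp
  define C where "C = (1 / (1 - 2 powr (- \<rho> * r))) powr (1 / r)"
  have lt: "(2::real) powr (- \<rho> * r) < 1" using r assms by (simp add: powr_less_one)
  have C: "C > 0" using lt r assms by (simp add: C_def)
  have "lq_le q I E (C * Z)"
    if Z: "Z \<ge> 0" and E: "\<forall>j\<in>I. 0 \<le> E j \<and> (j < J \<longrightarrow> E j = 0) \<and> (J \<le> j \<longrightarrow> E j \<le> Z * 2 powr (- (real j - real J) * \<rho>))"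
    for E I J Z
    unfolding lq_le_def
  proof (simp add: real, safe)
    fix F assume F: "finite F" "F \<subseteq> I"
    have "(\<Sum>j\<in>F. E j powr r) \<le> (\<Sum>j\<in>F. Z powr r * (if j < J then 0 else 2 powr (- (real j - real J) * (\<rho> * r))))"
    proof (intro sum_mono)
      fix j assume "j \<in> F"
      hence j: "j \<in> I" using F by auto
      show "E j powr r \<le> Z powr r * (if j < J then 0 else 2 powr (- (real j - real J) * (\<rho> * r)))"
      proof (cases "j < J")
        case False
        hence "E j powr r \<le> (Z * 2 powr (- (real j - real J) * \<rho>)) powr r"
          using E j r by (intro powr_mono2) auto
        thus ?thesis using False Z by (simp add: powr_mult powr_powr mult.assoc)
      qed (use E j in auto)
    qed
    also have "\<dots> \<le> Z powr r * (1 / (1 - 2 powr (- (\<rho> * r))))"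
      unfolding sum_distrib_left [symmetric] using F assms r
      by (intro mult_left_mono sum_geometric_tail_le) auto
    also have "\<dots> = (C * Z) powr r"
      using Z r lt assms by (simp add: C_def powr_mult powr_powr)
    finally show "lp_sum r F E \<le> C * Z"
      using C Z r by (subst lp_sum_le_iff) auto
  qed
  thus ?thesis using C by blast
next
  case PInf
  have "E j \<le> 1 * Z"
    if Z: "Z \<ge> 0" and E: "\<forall>j\<in>I. 0 \<le> E j \<and> (j < J \<longrightarrow> E j = 0) \<and> (J \<le> j \<longrightarrow> E j \<le> Z * 2 powr (- (real j - real J) * \<rho>))"
      and j: "j \<in> I" for E I J Z j
  proof (cases "j < J")
    case False
    hence "2 powr (- (real j - real J) * \<rho>) \<le> 2 powr 0"
      using assms by (intro powr_mono) (auto simp: mult_nonneg_nonneg algebra_simps)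
    hence "Z * 2 powr (- (real j - real J) * \<rho>) \<le> Z * 1" using Z by (intro mult_left_mono) auto
    thus ?thesis using E j False by fastforce
  qed (use E j Z in auto)
  thus ?thesis using PInf unfolding lq_le_def by (intro exI[of _ 1]) auto
qed (use assms in auto)


text \<open>The exponent \<open>real_of_ereal (1 / q)\<close> is zero for
  \<open>q = \<infinity>\<close>. The factor is then one, provided that \<open>J\<close> is
  nonempty, because \<open>0 powr 0\<close> is zero.\<close>

lemma lq_le_constI:
  assumes "0 < q" "0 \<le> t" "finite J" "\<And>j. j \<in> I \<Longrightarrow> E j = (if j \<in> J then t else 0)"
    "real (card J) powr real_of_ereal (1 / q) * t \<le> B" "J \<noteq> {}"
  shows "lq_le q I E B"
proof (cases q)
  case (real r)
  hence r: "r > 0" "real_of_ereal (1 / q) = 1 / r" using assms by (auto simp: one_ereal_def)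
  have "lp_sum r F E \<le> B" if F: "finite F" "F \<subseteq> I" for F
  proof -
    have E: "E j = (if j \<in> J then t else 0)" if "j \<in> F" for j using that F assms(4) by auto
    have "lp_sum r F E = lp_sum r (F \<inter> J) (\<lambda>_. t)"
      unfolding lp_sum_def using F
      by (intro arg_cong2[where f = "(powr)"] sum.mono_neutral_cong_right) (auto simp: E split: if_splits)
    also have "\<dots> \<le> lp_sum r J (\<lambda>_. t)" using assms r by (intro lp_sum_mono) auto
    also have "\<dots> \<le> B" using assms r by (simp add: lp_sum_const)
    finally show ?thesis .
  qed
  thus ?thesis using real by (simp add: lq_le_def)
next
  case PInf
  hence "t \<le> B" "0 \<le> B" using assms by (auto simp: card_gt_0_iff)
  thus ?thesis using PInf assms(4) by (simp add: lq_le_def)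
qed (use assms in auto)

lemma lq_le_constD:
  assumes "lq_le q I E B" "0 < q" "0 \<le> t" "finite J" "J \<subseteq> I" "J \<noteq> {}" "\<And>j. j \<in> J \<Longrightarrow> t \<le> E j"
  shows "real (card J) powr real_of_ereal (1 / q) * t \<le> B"
proof (cases q)
  case (real r)
  hence r: "r > 0" "real_of_ereal (1 / q) = 1 / r" using assms by (auto simp: one_ereal_def)
  have "real (card J) powr (1 / r) * t = lp_sum r J (\<lambda>_. t)" using r assms by (simp add: lp_sum_const)
  also have "\<dots> \<le> lp_sum r J E" using r assms by (intro lp_sum_mono) auto
  also have "\<dots> \<le> B" using assms real by (auto simp: lq_le_def)
  finally show ?thesis using r by simp
next
  case PInf
  obtain j where "j \<in> J" using assms by auto
  hence "t \<le> B" using assms PInf by (fastforce simp: lq_le_def)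
  thus ?thesis using PInf assms by (auto simp: card_gt_0_iff)
qed (use assms in auto)


section \<open>Nonlinear approximation of level sequences\<close>

text \<open>Infinitely many levels contribute, so finiteness of the union is itself a claim. It
  holds because a finite subset meets finitely many levels, and a set whose finite subsets have
  bounded cardinality is finite.\<close>

lemma finite_Sigma_card_le:
  assumes "\<And>j. j \<in> I \<Longrightarrow> finite (T j)"
    and "\<And>F. finite F \<Longrightarrow> F \<subseteq> I \<Longrightarrow> (\<Sum>j\<in>F. real (card (T j))) \<le> X"
  shows "finite (Sigma I T) \<and> real (card (Sigma I T)) \<le> X"
proof -
  have X: "X \<ge> 0" using assms(2)[of "{}"] by simp
  have "card G \<le> nat \<lfloor>X\<rfloor>" if G: "G \<subseteq> Sigma I T" "finite G" for G
  proof -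
    have sub: "fst ` G \<subseteq> I" "finite (fst ` G)" using G by auto
    have "card G \<le> card (Sigma (fst ` G) T)"
      using G sub assms(1) by (intro card_mono finite_SigmaI) force+
    also have "\<dots> = (\<Sum>j\<in>fst ` G. card (T j))"
      using sub assms(1) by (intro card_SigmaI) auto
    finally have "real (card G) \<le> (\<Sum>j\<in>fst ` G. real (card (T j)))"
      by (simp flip: of_nat_sum)
    also have "\<dots> \<le> X" using assms(2) sub by blast
    finally show ?thesis by linarith
  qed
  hence "finite (Sigma I T) \<and> card (Sigma I T) \<le> nat \<lfloor>X\<rfloor>"
    by (rule finite_if_finite_subsets_card_bdd)
  thus ?thesis using X by linarith
qed

lemma sum_power4_le: "finite F \<Longrightarrow> (\<Sum>j\<in>F. if j < J then 4 ^ j else 0) \<le> (4::real) ^ J"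
proof -
  assume "finite F"
  have "(\<Sum>j\<in>F. if j < J then 4 ^ j else 0) = (\<Sum>j\<in>F \<inter> {..<J}. (4::real) ^ j)"
    using \<open>finite F\<close> by (simp add: sum.inter_restrict)
  also have "\<dots> \<le> (\<Sum>j<J. 4 ^ j)" by (intro sum_mono2) auto
  also have "\<dots> = (4 ^ J - 1) / 3" by (simp add: geometric_sum)
  also have "\<dots> \<le> 4 ^ J" by (simp add: field_simps add_nonneg_nonneg)
  finally show ?thesis .
qed

lemma power4_eq_powr: "(4::real) ^ k = 2 powr (2 * real k)"
  using powr_realpow[of "2::real" "2 * k"] by (simp add: power_mult)

lemma ex_power4_bracket: "n \<ge> 1 \<Longrightarrow> \<exists>k. 4 ^ k \<le> n \<and> n < 4 ^ Suc k" for n :: nat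
proof (induction n rule: less_induct)
  case (less n)
  show ?case
  proof (cases "n < 4")
    case True
    thus ?thesis using less.prems by (intro exI[of _ 0]) auto
  next
    case False
    hence "n div 4 < n" "1 \<le> n div 4" by auto
    then obtain k where "4 ^ k \<le> n div 4" "n div 4 < 4 ^ Suc k"
      using less.IH by blast
    thus ?thesis by (intro exI[of _ "Suc k"]) auto
  qed
qed

text \<open>The index sets are an argument of their own: the error after keeping some coefficients
  is the same expression over smaller sets, with \<open>c\<close> unchanged.\<close>

definition level_norm :: "real \<Rightarrow> real \<Rightarrow> (nat \<Rightarrow> 'a set) \<Rightarrow> (nat \<Rightarrow> 'a \<Rightarrow> real) \<Rightarrow> nat \<Rightarrow> real" where
  "level_norm \<beta> p A c j = 2 powr (real j * \<beta>) * lp_sum p (A j) (c j)"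

lemma level_norm_nonneg: "0 \<le> level_norm \<beta> p A c j"
  by (simp add: level_norm_def lp_sum_nonneg)

text \<open>The target weight \<open>2\<^bsup>j\<beta>\<^sub>1\<^esup>\<close> and the source weight \<open>2\<^bsup>j\<beta>\<^sub>0\<^esup>\<close> carry the normalization of \<open>\<ell>\<^sub>p\<close> on
  about \<open>4\<^sup>j\<close> indices.  The surplus \<open>\<eta>\<close> is what remains of the smoothness gap \<open>\<gamma>\<close> after the embedding.\<close>

locale level_gap =
  fixes j0 :: nat and A :: "nat \<Rightarrow> 'a set" and B p\<^sub>0 p\<^sub>1 \<beta>\<^sub>0 \<beta>\<^sub>1 \<gamma> :: real
  assumes finite_A: "\<And>j. j0 \<le> j \<Longrightarrow> finite (A j)"
    and card_A: "\<And>j. j0 \<le> j \<Longrightarrow> real (card (A j)) \<le> B * 4 ^ j"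
    and B_pos: "B > 0" and p0_pos: "p\<^sub>0 > 0" and p1_pos: "p\<^sub>1 > 0"
    and gap: "\<beta>\<^sub>0 - \<beta>\<^sub>1 = \<gamma> - 2 * (1 / p\<^sub>0 - 1 / p\<^sub>1)"
begin

definition "\<theta> = max 0 (1 / p\<^sub>0 - 1 / p\<^sub>1)"
definition "\<eta> = \<gamma> - 2 * \<theta>"
text \<open>The part of the embedding constant on a level that does not depend on \<open>j\<close>;
  it equals one if \<open>p\<^sub>0 \<le> p\<^sub>1\<close>.\<close>

definition "K = B powr max 0 (1 / p\<^sub>1 - 1 / p\<^sub>0)"

abbreviation "R \<equiv> level_norm \<beta>\<^sub>0 p\<^sub>0 A"
abbreviation "E \<equiv> level_norm \<beta>\<^sub>1 p\<^sub>1"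

lemma theta_nonneg: "\<theta> \<ge> 0" by (simp add: \<theta>_def)
lemma K_pos: "K > 0" using B_pos by (simp add: K_def)

text \<open>For \<open>p\<^sub>0 \<le> p\<^sub>1\<close> the passage between the exponents is free;
  otherwise the power mean inequality costs a power of the cardinality. The two maxima with zero
  express both cases at once. The subset \<open>A'\<close> admits remainders on the left.\<close>

lemma level_embedding:
  assumes "j0 \<le> j" "\<And>x. 0 \<le> c j x" "A' j \<subseteq> A j"
  shows "E A' c j \<le> K * 2 powr (- real j * \<eta>) * R c j"
proof -
  have split: "2 powr (real j * (- \<eta> + \<beta>\<^sub>0)) = 2 powr (- real j * \<eta>) * 2 powr (real j * \<beta>\<^sub>0)"
    by (simp add: algebra_simps flip: powr_add)
  have "lp_sum p\<^sub>1 (A' j) (c j) \<le> lp_sum p\<^sub>1 (A j) (c j)"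
    using finite_A p1_pos assms by (intro lp_sum_mono) auto
  also have "\<dots> \<le> (B * 4 ^ j) powr max 0 (1 / p\<^sub>1 - 1 / p\<^sub>0) * lp_sum p\<^sub>0 (A j) (c j)"
  proof (cases "p\<^sub>0 \<le> p\<^sub>1")
    case True
    hence "1 / p\<^sub>1 - 1 / p\<^sub>0 \<le> 0" using p0_pos p1_pos by (simp add: field_simps)
    moreover have "lp_sum p\<^sub>1 (A j) (c j) \<le> lp_sum p\<^sub>0 (A j) (c j)"
      using True assms finite_A p0_pos by (intro lp_sum_antimono) auto
    ultimately show ?thesis using B_pos by (simp add: max_def)
  next
    case False
    hence "1 / p\<^sub>1 - 1 / p\<^sub>0 \<ge> 0" using p0_pos p1_pos by (simp add: field_simps)
    thus ?thesis using lp_sum_power_mean[of "A j" "B * 4 ^ j" p\<^sub>1 p\<^sub>0 "c j"] False assms finite_A card_A B_pos p1_pos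
      by (simp add: max_absorb2)
  qed
  also have "(B * 4 ^ j) powr max 0 (1 / p\<^sub>1 - 1 / p\<^sub>0) = K * 2 powr (real j * (2 * max 0 (1 / p\<^sub>1 - 1 / p\<^sub>0)))"
    using B_pos by (simp add: K_def power4_eq_powr powr_mult powr_powr mult_ac)
  finally have "E A' c j \<le> 2 powr (real j * \<beta>\<^sub>1) *
      (K * 2 powr (real j * (2 * max 0 (1 / p\<^sub>1 - 1 / p\<^sub>0))) * lp_sum p\<^sub>0 (A j) (c j))"
    unfolding level_norm_def by (intro mult_left_mono) auto
  also have "\<dots> = K * 2 powr (real j * (\<beta>\<^sub>1 + 2 * max 0 (1 / p\<^sub>1 - 1 / p\<^sub>0))) * lp_sum p\<^sub>0 (A j) (c j)"
    by (simp add: powr_add algebra_simps)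
  \<comment> \<open>This is \<open>max 0 x - max 0 (- x) = x\<close> for the difference
    \<open>x\<close> of the reciprocal exponents.\<close>
  also have "\<beta>\<^sub>1 + 2 * max 0 (1 / p\<^sub>1 - 1 / p\<^sub>0) = - \<eta> + \<beta>\<^sub>0"
    using gap by (auto simp: \<eta>_def \<theta>_def max_def algebra_simps)
  finally show ?thesis unfolding split by (simp add: level_norm_def mult_ac)
qed

text \<open>For \<open>p\<^sub>1 < p\<^sub>0\<close> nothing is gained by thresholding: \<theta>
  vanishes, and the empty set meets the bound by \<open>level_embedding\<close>.\<close>

lemma level_threshold:
  assumes "j0 \<le> j" "\<And>x. 0 \<le> c j x" "x > 0"
  shows "\<exists>T\<subseteq>A j. real (card T) \<le> x \<and>
           E (\<lambda>_. A j - T) c j \<le> K * 2 powr (- real j * \<eta>) * x powr (- \<theta>) * R c j"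
proof (cases "p\<^sub>0 \<le> p\<^sub>1")
  case True
  hence *: "\<theta> = 1 / p\<^sub>0 - 1 / p\<^sub>1" "K = 1" using p0_pos p1_pos B_pos by (auto simp: \<theta>_def K_def field_simps max_def)
  obtain T where T: "T \<subseteq> A j" "real (card T) \<le> x"
    "lp_sum p\<^sub>1 (A j - T) (c j) \<le> x powr (- (1 / p\<^sub>0 - 1 / p\<^sub>1)) * lp_sum p\<^sub>0 (A j) (c j)"
    using lp_sum_threshold[of "A j" p\<^sub>0 p\<^sub>1 "c j" x] True assms finite_A p0_pos by auto
  have "\<beta>\<^sub>1 = - \<eta> + \<beta>\<^sub>0" using gap * by (auto simp: \<eta>_def)
  have split: "2 powr (real j * (- \<eta> + \<beta>\<^sub>0)) = 2 powr (- real j * \<eta>) * 2 powr (real j * \<beta>\<^sub>0)"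
    by (simp add: algebra_simps flip: powr_add)
  have "E (\<lambda>_. A j - T) c j \<le> K * 2 powr (- real j * \<eta>) * x powr (- \<theta>) * R c j"
  proof -
    have "E (\<lambda>_. A j - T) c j \<le> 2 powr (real j * \<beta>\<^sub>1) * (x powr (- \<theta>) * lp_sum p\<^sub>0 (A j) (c j))"
      using T unfolding level_norm_def * by (intro mult_left_mono) auto
    also have "\<dots> = K * 2 powr (- real j * \<eta>) * x powr (- \<theta>) * R c j"
      using \<open>K = 1\<close> split by (simp add: level_norm_def mult_ac \<open>\<beta>\<^sub>1 = - \<eta> + \<beta>\<^sub>0\<close>)
    finally show ?thesis .
  qed
  thus ?thesis using T by blast
next
  case False
  hence "\<theta> = 0" using p0_pos p1_pos by (auto simp: \<theta>_def field_simps max_def)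
  hence "E (\<lambda>_. A j - {}) c j \<le> K * 2 powr (- real j * \<eta>) * x powr (- \<theta>) * R c j"
    using level_embedding[of j c "\<lambda>_. A j"] assms by simp
  thus ?thesis using assms by (intro exI[of _ "{}"]) auto
qed

text \<open>A surplus turns bounded level norms into geometrically decreasing ones, which lie in
  every sequence space; without it only the monotonicity of the sequence spaces in \<open>q\<close>
  remains. The bound is what is left when nothing is approximated.\<close>

lemma lq_embedding:
  assumes "0 < q\<^sub>0" "0 < q\<^sub>1" "\<eta> > 0 \<or> \<eta> = 0 \<and> q\<^sub>0 \<le> q\<^sub>1"
  shows "\<exists>C>0. \<forall>c. (\<forall>j x. 0 \<le> c j x) \<longrightarrow> lq_le q\<^sub>0 {j0..} (R c) 1 \<longrightarrow> lq_le q\<^sub>1 {j0..} (E A c) C"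
proof (cases "\<eta> > 0")
  case True
  then obtain C where C: "C > 0" and geo: "\<And>E I J Z. Z \<ge> 0 \<Longrightarrow>
      (\<forall>j\<in>I. 0 \<le> E j \<and> (j < J \<longrightarrow> E j = 0) \<and> (J \<le> j \<longrightarrow> E j \<le> Z * 2 powr (- (real j - real J) * \<eta>))) \<Longrightarrow>
      lq_le q\<^sub>1 I E (C * Z)"
    using lq_le_geometric[OF True assms(2)] by blast
  have "lq_le q\<^sub>1 {j0..} (E A c) (C * K)" if c: "\<forall>j x. 0 \<le> c j x" and R: "lq_le q\<^sub>0 {j0..} (R c) 1" for c
  proof (rule geo)
    have "E A c j \<le> K * 2 powr (- (real j - real 0) * \<eta>)" if j: "j \<in> {j0..}" for j
    proof -
      have "E A c j \<le> K * 2 powr (- real j * \<eta>) * R c j"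
        using j c by (intro level_embedding) auto
      also have "\<dots> \<le> K * 2 powr (- real j * \<eta>) * 1"
        using K_pos lq_le_imp_le[OF R assms(1) j] by (intro mult_left_mono) (auto simp: level_norm_nonneg)
      finally show ?thesis by simp
    qed
    thus "\<forall>j\<in>{j0..}. 0 \<le> E A c j \<and> (j < 0 \<longrightarrow> E A c j = 0) \<and>
        (0 \<le> j \<longrightarrow> E A c j \<le> K * 2 powr (- (real j - real 0) * \<eta>))"
      by (auto simp: level_norm_nonneg)
  qed (use K_pos in simp)
  thus ?thesis using C K_pos by (intro exI[of _ "C * K"]) auto
next
  case False
  have "lq_le q\<^sub>1 {j0..} (E A c) K" if c: "\<forall>j x. 0 \<le> c j x" and R: "lq_le q\<^sub>0 {j0..} (R c) 1" for c
  proof (rule lq_le_mono[OF lq_le_antimono[OF R]])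
    show "0 \<le> E A c j \<and> E A c j \<le> K * R c j" if "j \<in> {j0..}" for j
      using level_embedding[of j c A] that c False assms by (auto simp: level_norm_nonneg)
  qed (use assms K_pos False in \<open>auto simp: level_norm_nonneg\<close>)
  thus ?thesis using K_pos by blast
qed

text \<open>All coefficients below a level \<open>J\<close> with \<open>4\<^sup>J \<sim> n\<close> are kept.  The budgets
  \<open>4\<^sup>J 2\<^bsup>-(j-J)\<epsilon>\<^esup>\<close> above it have total of order \<open>4\<^sup>J\<close>, and \<open>\<epsilon>\<close> is so small that the surplus still
  makes the errors decrease geometrically.\<close>

lemma nterm_surplus:
  assumes "0 < q\<^sub>0" "0 < q\<^sub>1" "\<eta> > 0"
  shows "\<exists>C>0. \<forall>n::nat. n \<ge> 1 \<longrightarrow> (\<forall>c. (\<forall>j x. 0 \<le> c j x) \<longrightarrow> lq_le q\<^sub>0 {j0..} (R c) 1 \<longrightarrow>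
           (\<exists>\<Lambda>\<subseteq>Sigma {j0..} A. finite \<Lambda> \<and> real (card \<Lambda>) \<le> C * real n \<and>
              lq_le q\<^sub>1 {j0..} (E (\<lambda>j. A j - \<Lambda> `` {j}) c) (C * real n powr (- (\<gamma> / 2)))))"
proof -
  \<comment> \<open>The summand one keeps the denominator positive when \<theta> = 0; the choice
    gives \<open>\<epsilon> * \<theta> \<le> \<eta> / 2\<close>, so half of the surplus
    survives.\<close>
  define \<epsilon> where "\<epsilon> = \<eta> / (2 * \<theta> + 1)"
  have \<epsilon>: "\<epsilon> > 0" "\<epsilon> * \<theta> \<le> \<eta> / 2"
    using assms theta_nonneg by (auto simp: \<epsilon>_def field_simps)
  have gam: "\<gamma> \<ge> 0" using assms theta_nonneg by (simp add: \<eta>_def)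
  obtain C1 where C1: "C1 > 0" and geo: "\<And>E I J Z. Z \<ge> 0 \<Longrightarrow>
      (\<forall>j\<in>I. 0 \<le> E j \<and> (j < J \<longrightarrow> E j = 0) \<and> (J \<le> j \<longrightarrow> E j \<le> Z * 2 powr (- (real j - real J) * (\<eta> / 2)))) \<Longrightarrow>
      lq_le q\<^sub>1 I E (C1 * Z)"
    using lq_le_geometric[of "\<eta> / 2" q\<^sub>1] assms by auto
  \<comment> \<open>\<open>B\<close> accounts for the full levels below \<open>J\<close>, the
    geometric series for the budgets from \<open>J\<close> on, and \<open>4 ^ j0\<close> for the
    shift \<open>J = j0 + k\<close> with \<open>4 ^ k \<le> n\<close>.\<close>
  define C2 where "C2 = (B + 1 / (1 - 2 powr (- \<epsilon>))) * 4 ^ j0"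
  have C2: "C2 > 0" using B_pos \<epsilon> by (auto simp: C2_def add_pos_pos powr_less_one)
  \<comment> \<open>The power of four pays for replacing \<open>4 ^ J\<close> by its lower bound
    \<open>n / 4\<close>.\<close>
  define C3 where "C3 = C1 * (K * 4 powr (\<gamma> / 2))"
  have C3: "C3 > 0" using C1 K_pos by (simp add: C3_def)
  have main: "\<exists>\<Lambda>\<subseteq>Sigma {j0..} A. finite \<Lambda> \<and> real (card \<Lambda>) \<le> C2 * n \<and>
      lq_le q\<^sub>1 {j0..} (E (\<lambda>j. A j - \<Lambda> `` {j}) c) (C3 * n powr (- (\<gamma> / 2)))"
    if n: "n \<ge> 1" and c: "\<forall>j x. 0 \<le> c j x" and R: "lq_le q\<^sub>0 {j0..} (R c) 1" for n :: nat and c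
  proof -
    obtain k where k: "4 ^ k \<le> n" "n < 4 ^ Suc k" using ex_power4_bracket[OF n] by auto
    define J where "J = j0 + k"
    define x where "x j = 4 ^ J * 2 powr (- (real j - real J) * \<epsilon>)" for j
    have x: "x j > 0" for j by (simp add: x_def)
    define P where "P j T \<longleftrightarrow> T \<subseteq> A j \<and> (j < J \<longrightarrow> T = A j) \<and> (J \<le> j \<longrightarrow> real (card T) \<le> x j \<and>
        E (\<lambda>_. A j - T) c j \<le> K * 2 powr (- real j * \<eta>) * x j powr (- \<theta>) * R c j)"
      for j T
    have "\<exists>T. P j T" if "j0 \<le> j" for j
      unfolding P_def using level_threshold[of j c "x j"] c that x by (cases "j < J") auto
    then obtain T where "\<forall>j. j0 \<le> j \<longrightarrow> P j (T j)"
      by metis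
    hence T: "\<And>j. j0 \<le> j \<Longrightarrow> T j \<subseteq> A j"
      "\<And>j. j0 \<le> j \<Longrightarrow> j < J \<Longrightarrow> T j = A j"
      "\<And>j. j0 \<le> j \<Longrightarrow> J \<le> j \<Longrightarrow> real (card (T j)) \<le> x j"
      "\<And>j. j0 \<le> j \<Longrightarrow> J \<le> j \<Longrightarrow>
         E (\<lambda>_. A j - T j) c j \<le> K * 2 powr (- real j * \<eta>) * x j powr (- \<theta>) * R c j"
      unfolding P_def by blast+
    define \<Lambda> where "\<Lambda> = Sigma {j0..} T"
    have fin: "finite \<Lambda> \<and> real (card \<Lambda>) \<le> (B + 1 / (1 - 2 powr (- \<epsilon>))) * 4 ^ J"
      unfolding \<Lambda>_def
    proof (rule finite_Sigma_card_le)
      show "finite (T j)" if "j \<in> {j0..}" for j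
        using T(1)[of j] finite_A[of j] that by (auto intro: finite_subset)
      fix F :: "nat set" assume F: "finite F" "F \<subseteq> {j0..}"
      have "(\<Sum>j\<in>F. real (card (T j))) \<le> (\<Sum>j\<in>F. B * (if j < J then 4 ^ j else 0) +
              4 ^ J * (if j < J then 0 else 2 powr (- (real j - real J) * \<epsilon>)))"
        using F T(2,3) card_A by (intro sum_mono) (force simp: x_def)
      also have "\<dots> \<le> B * 4 ^ J + 4 ^ J * (1 / (1 - 2 powr (- \<epsilon>)))"
        unfolding sum.distrib sum_distrib_left [symmetric] using B_pos \<epsilon> F
        by (intro add_mono mult_left_mono sum_power4_le sum_geometric_tail_le) auto
      finally show "(\<Sum>j\<in>F. real (card (T j))) \<le> (B + 1 / (1 - 2 powr (- \<epsilon>))) * 4 ^ J"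
        by (simp add: algebra_simps)
    qed
    have "(B + 1 / (1 - 2 powr (- \<epsilon>))) * 4 ^ J = C2 * 4 ^ k" by (simp add: C2_def J_def power_add)
    also have "\<dots> \<le> C2 * n" using C2 k by (intro mult_left_mono) auto
    finally have card: "real (card \<Lambda>) \<le> C2 * n" using fin by linarith
    have \<Lambda>: "\<Lambda> `` {j} = T j" if "j0 \<le> j" for j using that by (auto simp: \<Lambda>_def)
    let ?E = "E (\<lambda>j. A j - \<Lambda> `` {j}) c"
    have err: "?E j \<le> K * 2 powr (- real J * \<gamma>) * 2 powr (- (real j - real J) * (\<eta> / 2))" if j: "j0 \<le> j" "J \<le> j" for j
    proof -
      have "?E j \<le> K * 2 powr (- real j * \<eta>) * x j powr (- \<theta>) * R c j"
        using T(4)[OF j] \<Lambda> j by (simp add: level_norm_def)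
      also have "\<dots> \<le> K * 2 powr (- real j * \<eta>) * x j powr (- \<theta>) * 1"
        using K_pos lq_le_imp_le[OF R assms(1), of j] j by (intro mult_left_mono) (auto simp: level_norm_nonneg)
      also have "x j = 2 powr (2 * real J - (real j - real J) * \<epsilon>)"
        unfolding x_def power4_eq_powr by (simp add: algebra_simps flip: powr_add)
      also have "K * 2 powr (- real j * \<eta>) * (2 powr (2 * real J - (real j - real J) * \<epsilon>)) powr (- \<theta>) * 1 =
          K * 2 powr (- real j * \<eta> - \<theta> * (2 * real J - (real j - real J) * \<epsilon>))"
        by (simp add: powr_powr algebra_simps flip: powr_add)
      \<comment> \<open>Since \<open>\<gamma> = \<eta> + 2 * \<theta>\<close>, the exponent splits
        into the error at level \<open>J\<close>, the full decay \<eta> beyond it, and the loss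
        \<open>\<epsilon> * \<theta>\<close> caused by the shrinking budgets.\<close>
      also have "\<dots> \<le> K * 2 powr (- real J * \<gamma> - (real j - real J) * (\<eta> / 2))"
      proof -
        have "(real j - real J) * (\<epsilon> * \<theta>) \<le> (real j - real J) * (\<eta> / 2)"
          using \<epsilon> j by (intro mult_left_mono) auto
        moreover have "- real j * \<eta> - \<theta> * (2 * real J - (real j - real J) * \<epsilon>) =
            - real J * \<gamma> - 2 * ((real j - real J) * (\<eta> / 2)) + (real j - real J) * (\<epsilon> * \<theta>)"
          by (simp add: \<eta>_def field_simps)
        ultimately have "- real j * \<eta> - \<theta> * (2 * real J - (real j - real J) * \<epsilon>) \<le>
            - real J * \<gamma> - (real j - real J) * (\<eta> / 2)"
          by linarith
        thus ?thesis using K_pos by (intro mult_left_mono powr_mono) auto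
      qed
      also have "2 powr (- real J * \<gamma> - (real j - real J) * (\<eta> / 2)) =
          2 powr (- real J * \<gamma>) * 2 powr (- (real j - real J) * (\<eta> / 2))"
        unfolding powr_add [symmetric] by (simp only: minus_mult_left [symmetric] diff_conv_add_uminus)
      finally show ?thesis by (simp add: mult.assoc)
    qed
    have lq: "lq_le q\<^sub>1 {j0..} ?E (C1 * (K * 2 powr (- real J * \<gamma>)))"
    proof (rule geo)
      show "\<forall>j\<in>{j0..}. 0 \<le> ?E j \<and> (j < J \<longrightarrow> ?E j = 0) \<and>
          (J \<le> j \<longrightarrow> ?E j \<le> K * 2 powr (- real J * \<gamma>) * 2 powr (- (real j - real J) * (\<eta> / 2)))"
        using err T(2) \<Lambda> by (auto simp: level_norm_nonneg) (simp add: level_norm_def)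
    qed (use K_pos in simp)
    have "2 powr (- real J * \<gamma>) = (4 ^ J) powr (- (\<gamma> / 2))"
      by (simp add: power4_eq_powr powr_powr)
    also have "\<dots> \<le> (n / 4) powr (- (\<gamma> / 2))"
    proof (rule powr_mono2')
      have "real n \<le> 4 * 4 ^ k" using k by (metis less_imp_le of_nat_le_iff of_nat_numeral of_nat_power power_Suc)
      moreover have "(4::real) ^ k \<le> 4 ^ J" by (simp add: J_def)
      ultimately show "real n / 4 \<le> 4 ^ J" by linarith
    qed (use n gam in auto)
    also have "\<dots> = 4 powr (\<gamma> / 2) * n powr (- (\<gamma> / 2))"
      by (simp add: powr_divide powr_minus_divide)
    finally have "C1 * (K * 2 powr (- real J * \<gamma>)) \<le> C3 * n powr (- (\<gamma> / 2))"
      using C1 K_pos by (simp add: C3_def mult.assoc)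
    hence "lq_le q\<^sub>1 {j0..} ?E (C3 * n powr (- (\<gamma> / 2)))"
      using assms by (intro lq_le_mono[OF lq, of _ 1]) (auto simp: level_norm_nonneg)
    moreover have "\<Lambda> \<subseteq> Sigma {j0..} A" using T(1) by (auto simp: \<Lambda>_def)
    ultimately show ?thesis using fin card by blast
  qed
  have "\<exists>\<Lambda>\<subseteq>Sigma {j0..} A. finite \<Lambda> \<and> real (card \<Lambda>) \<le> max C2 C3 * n \<and>
      lq_le q\<^sub>1 {j0..} (E (\<lambda>j. A j - \<Lambda> `` {j}) c) (max C2 C3 * n powr (- (\<gamma> / 2)))"
    if n: "n \<ge> 1" and c: "\<forall>j x. 0 \<le> c j x" and R: "lq_le q\<^sub>0 {j0..} (R c) 1" for n :: nat and c
  proof -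
    obtain \<Lambda> where \<Lambda>: "\<Lambda> \<subseteq> Sigma {j0..} A" "finite \<Lambda>" "real (card \<Lambda>) \<le> C2 * n"
      "lq_le q\<^sub>1 {j0..} (E (\<lambda>j. A j - \<Lambda> `` {j}) c) (C3 * n powr (- (\<gamma> / 2)))"
      using main[OF n c R] by auto
    have "real (card \<Lambda>) \<le> max C2 C3 * n"
      using \<Lambda>(3) by (rule order_trans) (intro mult_right_mono, auto)
    moreover have "lq_le q\<^sub>1 {j0..} (E (\<lambda>j. A j - \<Lambda> `` {j}) c) (max C2 C3 * n powr (- (\<gamma> / 2)))"
      using assms by (intro lq_le_mono[OF \<Lambda>(4), of _ 1]) (auto simp: level_norm_nonneg intro!: mult_right_mono)
    ultimately show ?thesis using \<Lambda> by blast
  qed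
  thus ?thesis using C2 by (intro exI[of _ "max C2 C3"]) auto
qed

text \<open>Without surplus all levels have the same weight, and the budget \<open>n\<close> is distributed over them in
  proportion to \<open>R\<^sub>j\<^bsup>q\<^sub>0\<^esup>\<close>.\<close>

lemma nterm_limiting:
  assumes "0 < q\<^sub>0" "q\<^sub>0 \<le> q\<^sub>1" "\<eta> = 0"
  defines "\<mu> \<equiv> min \<theta> (real_of_ereal (1 / q\<^sub>0) - real_of_ereal (1 / q\<^sub>1))"
  shows "\<exists>C>0. \<forall>n::nat. n \<ge> 1 \<longrightarrow> (\<forall>c. (\<forall>j x. 0 \<le> c j x) \<longrightarrow> lq_le q\<^sub>0 {j0..} (R c) 1 \<longrightarrow>
           (\<exists>\<Lambda>\<subseteq>Sigma {j0..} A. finite \<Lambda> \<and> real (card \<Lambda>) \<le> C * real n \<and>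
              lq_le q\<^sub>1 {j0..} (E (\<lambda>j. A j - \<Lambda> `` {j}) c) (C * real n powr (- \<mu>))))"
proof (cases q\<^sub>0)
  case PInf
  \<comment> \<open>Both differences of reciprocals degenerate to zero here, so no decay is claimed
    and the empty selection suffices.\<close>
  hence q1: "q\<^sub>1 = \<infinity>" using assms by simp
  hence mu: "\<mu> = 0" using PInf theta_nonneg by (simp add: \<mu>_def)
  obtain C where C: "C > 0" and emb: "\<And>c. (\<forall>j x. 0 \<le> c j x) \<Longrightarrow> lq_le q\<^sub>0 {j0..} (R c) 1 \<Longrightarrow> lq_le q\<^sub>1 {j0..} (E A c) C"
    using lq_embedding[of q\<^sub>0 q\<^sub>1] assms by fastforce
  show ?thesis using C emb mu by (intro exI[of _ C]) (auto intro!: exI[of _ "{}"])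
next
  case (real r)
  hence r: "r > 0" using assms by simp
  have inv0: "real_of_ereal (1 / q\<^sub>0) = 1 / r" using real r by (simp add: one_ereal_def)
  have inv1: "real_of_ereal (1 / q\<^sub>1) \<ge> 0" "real_of_ereal (1 / q\<^sub>1) \<le> 1 / r"
    using assms(2) real r by (cases q\<^sub>1; simp add: one_ereal_def frac_le)+
  have mu: "0 \<le> \<mu>" "\<mu> \<le> \<theta>" "\<mu> \<le> 1 / r - real_of_ereal (1 / q\<^sub>1)"
    using theta_nonneg inv0 inv1 by (auto simp: \<mu>_def)
  have main: "\<exists>\<Lambda>\<subseteq>Sigma {j0..} A. finite \<Lambda> \<and> real (card \<Lambda>) \<le> 1 * real n \<and>
      lq_le q\<^sub>1 {j0..} (E (\<lambda>j. A j - \<Lambda> `` {j}) c) (K * n powr (- \<mu>))"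
    if n: "n \<ge> 1" and c: "\<forall>j x. 0 \<le> c j x" and R: "lq_le q\<^sub>0 {j0..} (R c) 1" for n :: nat and c
  proof -
    have R1: "R c j \<le> 1" if "j0 \<le> j" for j
      using lq_le_imp_le[OF R assms(1)] that by (auto simp: level_norm_nonneg)
    define P where "P j T \<longleftrightarrow> T \<subseteq> A j \<and> real (card T) \<le> n * R c j powr r \<and>
        E (\<lambda>_. A j - T) c j \<le> K * n powr (- \<mu>) * R c j powr (1 - r * \<mu>)" for j T
    have "\<exists>T. P j T" if j: "j0 \<le> j" for j
    proof (cases "R c j = 0")
      case True
      thus ?thesis unfolding P_def using level_embedding[of j c "\<lambda>_. A j"] j c by (intro exI[of _ "{}"]) auto
    next
      case False
      hence Rp: "R c j > 0" using level_norm_nonneg[of \<beta>\<^sub>0 p\<^sub>0 A c j] by linarith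
      define x where "x = n * R c j powr r"
      have x: "x > 0" using n Rp by (simp add: x_def)
      obtain T where T: "T \<subseteq> A j" "real (card T) \<le> x"
        "E (\<lambda>_. A j - T) c j \<le> K * 2 powr (- real j * \<eta>) * x powr (- \<theta>) * R c j"
        using level_threshold[of j c x] j c x by auto
      have "E (\<lambda>_. A j - T) c j \<le> K * n powr (- \<mu>) * R c j powr (1 - r * \<mu>)"
      proof -
        \<comment> \<open>For \<open>x \<ge> 1\<close> the exponent \<theta> may be lowered to
          \<mu>. For \<open>x < 1\<close> the factor \<open>x powr (- \<theta>)\<close> would be too
          large, but the plain embedding already beats
          \<open>x powr (- \<mu>) \<ge> 1\<close>.\<close>
        have "E (\<lambda>_. A j - T) c j \<le> K * x powr (- \<mu>) * R c j"
        proof (cases "x \<ge> 1")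
          case True
          have "E (\<lambda>_. A j - T) c j \<le> K * x powr (- \<theta>) * R c j" using T(3) assms by simp
          also have "\<dots> \<le> K * x powr (- \<mu>) * R c j"
            using True mu K_pos by (intro mult_left_mono mult_right_mono powr_mono) (auto simp: level_norm_nonneg)
          finally show ?thesis .
        next
          case False
          have "E (\<lambda>_. A j - T) c j \<le> K * 1 * R c j" using level_embedding[of j c "\<lambda>_. A j - T"] assms j c by auto
          also have "\<dots> \<le> K * x powr (- \<mu>) * R c j"
          proof -
            have "1 powr (- \<mu>) \<le> x powr (- \<mu>)" using False x mu by (intro powr_mono2') auto
            thus ?thesis using K_pos by (intro mult_left_mono mult_right_mono) (auto simp: level_norm_nonneg)
          qed
          finally show ?thesis .
        qed
        also have "\<dots> = K * n powr (- \<mu>) * (R c j powr (- (r * \<mu>)) * R c j powr 1)"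
          using Rp by (simp add: x_def powr_mult powr_powr)
        also have "R c j powr (- (r * \<mu>)) * R c j powr 1 = R c j powr (1 - r * \<mu>)"
          by (subst powr_add [symmetric]) simp
        finally show ?thesis .
      qed
      thus ?thesis unfolding P_def using T x_def by blast
    qed
    then obtain T where "\<forall>j. j0 \<le> j \<longrightarrow> P j (T j)"
      by metis
    hence T: "\<And>j. j0 \<le> j \<Longrightarrow> T j \<subseteq> A j"
      "\<And>j. j0 \<le> j \<Longrightarrow> real (card (T j)) \<le> n * R c j powr r"
      "\<And>j. j0 \<le> j \<Longrightarrow>
         E (\<lambda>_. A j - T j) c j \<le> K * n powr (- \<mu>) * R c j powr (1 - r * \<mu>)"
      unfolding P_def by blast+
    have sumR: "(\<Sum>j\<in>F. R c j powr r) \<le> 1" if "finite F" "F \<subseteq> {j0..}" for F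
    proof -
      have "lp_sum r F (R c) \<le> 1" using R that real by (auto simp: lq_le_def)
      thus ?thesis using r lp_sum_le_iff[of r 1 F "R c"] by simp
    qed
    define \<Lambda> where "\<Lambda> = Sigma {j0..} T"
    have fin: "finite \<Lambda> \<and> real (card \<Lambda>) \<le> n"
      unfolding \<Lambda>_def
    proof (rule finite_Sigma_card_le)
      show "finite (T j)" if "j \<in> {j0..}" for j
        using T(1)[of j] finite_A[of j] that by (auto intro: finite_subset)
      fix F :: "nat set" assume F: "finite F" "F \<subseteq> {j0..}"
      have "(\<Sum>j\<in>F. real (card (T j))) \<le> (\<Sum>j\<in>F. n * R c j powr r)"
        using F T(2) by (intro sum_mono) auto
      also have "\<dots> \<le> real n * 1"
        unfolding sum_distrib_left [symmetric] using sumR[OF F] by (intro mult_left_mono) auto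
      finally show "(\<Sum>j\<in>F. real (card (T j))) \<le> n" by simp
    qed
    have \<Lambda>: "\<Lambda> `` {j} = T j" if "j0 \<le> j" for j using that by (auto simp: \<Lambda>_def)
    have "lq_le q\<^sub>1 {j0..} (\<lambda>j. R c j powr (1 - r * \<mu>)) 1"
    proof (cases q\<^sub>1)
      case r1: (real r1)
      hence r1p: "r1 > 0" using assms real r by simp
      \<comment> \<open>Equivalent to \<open>\<mu> \<le> 1 / r - 1 / r1\<close>. As the level norms
        are at most one, the larger exponent gives the smaller power, and the sum is controlled by
        that of \<open>R c j powr r\<close>.\<close>
      have ex: "r \<le> (1 - r * \<mu>) * r1"
      proof -
        have "\<mu> * (r * r1) \<le> (1 / r - 1 / r1) * (r * r1)"
          using mu(3) r1 r1p r by (intro mult_right_mono) (auto simp: one_ereal_def)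
        also have "\<dots> = r1 - r" using r r1p by (simp add: field_simps)
        finally show ?thesis by (simp add: algebra_simps)
      qed
      have "lp_sum r1 F (\<lambda>j. R c j powr (1 - r * \<mu>)) \<le> 1" if F: "finite F" "F \<subseteq> {j0..}" for F
      proof -
        have "(\<Sum>j\<in>F. (R c j powr (1 - r * \<mu>)) powr r1) \<le> (\<Sum>j\<in>F. R c j powr r)"
          unfolding powr_powr using F ex R1 by (intro sum_mono powr_mono') (auto simp: level_norm_nonneg)
        also have "\<dots> \<le> 1 powr r1" using sumR[OF F] by simp
        finally show ?thesis using r1p by (subst lp_sum_le_iff) auto
      qed
      thus ?thesis using r1 by (simp add: lq_le_def)
    next
      case PInf
      have "0 \<le> 1 - r * \<mu>" using mu PInf r by (simp add: field_simps)
      hence "R c j powr (1 - r * \<mu>) \<le> 1" if "j0 \<le> j" for j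
        using R1[OF that] by (intro powr_le1) (auto simp: level_norm_nonneg)
      thus ?thesis using PInf by (simp add: lq_le_def)
    qed (use assms real in auto)
    hence "lq_le q\<^sub>1 {j0..} (E (\<lambda>j. A j - \<Lambda> `` {j}) c) (K * n powr (- \<mu>))"
      by (rule lq_le_mono[where k = "K * n powr (- \<mu>)"])
        (use assms K_pos T(3) \<Lambda> in \<open>auto simp: level_norm_nonneg lp_sum_nonneg\<close>, auto simp: level_norm_def)
    moreover have "\<Lambda> \<subseteq> Sigma {j0..} A" using T(1) by (auto simp: \<Lambda>_def)
    ultimately show ?thesis using fin by auto
  qed
  have "\<exists>\<Lambda>\<subseteq>Sigma {j0..} A. finite \<Lambda> \<and> real (card \<Lambda>) \<le> max 1 K * real n \<and>
      lq_le q\<^sub>1 {j0..} (E (\<lambda>j. A j - \<Lambda> `` {j}) c) (max 1 K * n powr (- \<mu>))"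
    if n: "n \<ge> 1" and c: "\<forall>j x. 0 \<le> c j x" and R: "lq_le q\<^sub>0 {j0..} (R c) 1" for n :: nat and c
  proof -
    obtain \<Lambda> where \<Lambda>: "\<Lambda> \<subseteq> Sigma {j0..} A" "finite \<Lambda>" "real (card \<Lambda>) \<le> 1 * real n"
      "lq_le q\<^sub>1 {j0..} (E (\<lambda>j. A j - \<Lambda> `` {j}) c) (K * n powr (- \<mu>))"
      using main[OF n c R] by auto
    have "real (card \<Lambda>) \<le> max 1 K * n"
      using \<Lambda>(3) by (rule order_trans) (intro mult_right_mono, auto)
    moreover have "lq_le q\<^sub>1 {j0..} (E (\<lambda>j. A j - \<Lambda> `` {j}) c) (max 1 K * n powr (- \<mu>))"
      using assms by (intro lq_le_mono[OF \<Lambda>(4), of _ 1]) (auto simp: level_norm_nonneg intro!: mult_right_mono)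
    ultimately show ?thesis using \<Lambda> by blast
  qed
  thus ?thesis by (intro exI[of _ "max 1 K"]) auto
qed (use assms in auto)

end


section \<open>Quasi-norms on finite-dimensional spans\<close>

lemma norm_linear_combination_sq_le:
  fixes g :: "'k \<Rightarrow> complex"
  shows "(norm (\<Sum>k\<in>I. a k * g k))\<^sup>2 \<le> (\<Sum>k\<in>I. (norm (a k))\<^sup>2) * (\<Sum>k\<in>I. (norm (g k))\<^sup>2)"
proof -
  have "norm (\<Sum>k\<in>I. a k * g k) \<le> (\<Sum>k\<in>I. norm (a k) * norm (g k))"
    by (rule order_trans[OF norm_sum]) (simp add: norm_mult)
  hence "(norm (\<Sum>k\<in>I. a k * g k))\<^sup>2 \<le> (\<Sum>k\<in>I. norm (a k) * norm (g k))\<^sup>2"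
    by (intro power_mono) auto
  also have "\<dots> \<le> (\<Sum>k\<in>I. (norm (a k))\<^sup>2) * (\<Sum>k\<in>I. (norm (g k))\<^sup>2)"
    by (rule Cauchy_Schwarz_ineq_sum)
  finally show ?thesis .
qed

text \<open>For the lower bound, \<open>\<bar>u\<bar>\<^sup>2 \<le> N K\<close> pointwise, where \<open>N\<close> is the square sum of the coefficients and
  \<open>K\<close> that of the spanning functions.  The set where \<open>K\<close> exceeds a suitable \<open>m\<close> contributes at most
  half of the \<open>L\<^sub>2\<close> norm, and off it \<open>\<bar>u\<bar>\<^sup>2 \<le> \<bar>u\<bar>\<^sup>p (N m)\<^bsup>1 - p/2\<^esup>\<close>.  This avoids a compactness argument.\<close>

lemma finite_span_lp_equivalence:
  fixes g :: "'k \<Rightarrow> 'a \<Rightarrow> complex"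
  assumes "finite_measure M" "finite I"
    and meas: "\<And>k. k \<in> I \<Longrightarrow> g k \<in> borel_measurable M"
    and int: "\<And>k. k \<in> I \<Longrightarrow> integrable M (\<lambda>x. (norm (g k x))\<^sup>2)"
    and A: "A > 0" "\<And>a. A * (\<Sum>k\<in>I. (norm (a k))\<^sup>2) \<le> (\<integral>x. (norm (\<Sum>k\<in>I. a k * g k x))\<^sup>2 \<partial>M)"
    and p: "0 < p" "p \<le> 2"
  shows "\<exists>C>0. \<forall>a.
    (\<integral>x. norm (\<Sum>k\<in>I. a k * g k x) powr p \<partial>M) powr (1 / p) \<le> C * sqrt (\<Sum>k\<in>I. (norm (a k))\<^sup>2) \<and>
    sqrt (\<Sum>k\<in>I. (norm (a k))\<^sup>2) \<le> C * (\<integral>x. norm (\<Sum>k\<in>I. a k * g k x) powr p \<partial>M) powr (1 / p)"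
proof -
  interpret finite_measure M by fact
  define K where "K x = (\<Sum>k\<in>I. (norm (g k x))\<^sup>2)" for x
  have K0: "K x \<ge> 0" for x by (auto simp: K_def intro: sum_nonneg)
  have K_int: "integrable M K" unfolding K_def using int by (intro Bochner_Integration.integrable_sum)
  hence K_meas [measurable]: "K \<in> borel_measurable M" by simp
  \<comment> \<open>\<open>K\<close> does not involve the coefficients, so the truncation level
    found here serves all elements of the span.\<close>
  have "(\<lambda>m::nat. \<integral>x. indicator {x. K x > m} x * K x \<partial>M) \<longlonglongrightarrow> (\<integral>x. 0 \<partial>M)"
  proof (rule integral_dominated_convergence[where w = K])
    show "AE x in M. (\<lambda>m::nat. indicator {x. K x > m} x * K x) \<longlonglongrightarrow> 0"
    proof (intro AE_I2 tendsto_eventually)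
      fix x
      obtain m0 :: nat where "K x \<le> m0" using real_arch_simple by blast
      thus "\<forall>\<^sub>F m::nat in sequentially. indicator {x. K x > m} x * K x = 0"
        by (intro eventually_sequentiallyI[of m0]) (auto simp: indicator_def)
    qed
    show "AE x in M. norm (indicator {x. K x > m} x * K x) \<le> K x" for m :: nat
      using K0 by (intro AE_I2) (auto simp: indicator_def)
  qed (use K_int in auto)
  hence "\<forall>\<^sub>F m::nat in sequentially. (\<integral>x. indicator {x. K x > m} x * K x \<partial>M) < A / 2"
    using A by (intro order_tendstoD(2)) auto
  then obtain m0 :: nat where "\<And>m. m \<ge> m0 \<Longrightarrow> (\<integral>x. indicator {x. K x > real m} x * K x \<partial>M) < A / 2"
    by (auto simp: eventually_sequentially)
  hence tail: "(\<integral>x. indicator {x. K x > real (Suc m0)} x * K x \<partial>M) \<le> A / 2"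
    by (meson le_SucI less_imp_le order_refl)
  define m where "m = real (Suc m0)"
  have m: "m > 0" by (simp add: m_def)
  \<comment> \<open>From \<open>N powr (p / 2) * (1 + K x)\<close> as a pointwise bound, which uses
    \<open>p / 2 \<le> 1\<close>; the additional one only ensures positivity.\<close>
  define C1 where "C1 = ((\<integral>x. 1 + K x \<partial>M) + 1) powr (1 / p)"
  \<comment> \<open>Obtained by solving \<open>A / 2 * N \<le> P * (N * m) powr (1 - p / 2)\<close>
    for \<open>sqrt N\<close>.\<close>
  define C2 where "C2 = (2 / A * m powr (1 - p / 2)) powr (1 / p)"
  have K1: "(\<integral>x. 1 + K x \<partial>M) \<ge> 0" using K0 by (intro Bochner_Integration.integral_nonneg) auto
  hence C1: "C1 > 0" by (simp add: C1_def)
  have C2: "C2 > 0" using A m by (simp add: C2_def)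
  have main: "(\<integral>x. norm (\<Sum>k\<in>I. a k * g k x) powr p \<partial>M) powr (1 / p) \<le> C1 * sqrt (\<Sum>k\<in>I. (norm (a k))\<^sup>2) \<and>
    sqrt (\<Sum>k\<in>I. (norm (a k))\<^sup>2) \<le> C2 * (\<integral>x. norm (\<Sum>k\<in>I. a k * g k x) powr p \<partial>M) powr (1 / p)" for a
  proof -
    define N where "N = (\<Sum>k\<in>I. (norm (a k))\<^sup>2)"
    define u where "u x = (\<Sum>k\<in>I. a k * g k x)" for x
    have N0: "N \<ge> 0" by (auto simp: N_def intro: sum_nonneg)
    have u_meas [measurable]: "u \<in> borel_measurable M" unfolding u_def using meas by measurable
    have u_sq: "(norm (u x))\<^sup>2 \<le> N * K x" for x
      unfolding u_def N_def K_def by (rule norm_linear_combination_sq_le)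
    have norm_powr: "norm (u x) powr e = ((norm (u x))\<^sup>2) powr (e / 2)" for x e
      by (simp add: powr_powr flip: powr_numeral)
    have u_int: "integrable M (\<lambda>x. (norm (u x))\<^sup>2)"
      by (rule Bochner_Integration.integrable_bound[of _ "\<lambda>x. N * K x"])
        (use u_sq N0 K0 K_int in \<open>auto intro!: AE_I2\<close>)
    have up_le: "norm (u x) powr p \<le> N powr (p / 2) * (1 + K x)" for x
    proof -
      have "norm (u x) powr p \<le> (N * K x) powr (p / 2)"
        unfolding norm_powr[of x p] using u_sq p by (intro powr_mono2) auto
      also have "\<dots> = N powr (p / 2) * K x powr (p / 2)" using N0 K0 by (simp add: powr_mult)
      also have "\<dots> \<le> N powr (p / 2) * (1 + K x)"
      proof (intro mult_left_mono)
        show "K x powr (p / 2) \<le> 1 + K x"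
        proof (cases "K x \<le> 1")
          case True
          hence "K x powr (p / 2) \<le> 1" using K0 p by (intro powr_le1) auto
          thus ?thesis using K0[of x] by simp
        next
          case False
          hence "K x powr (p / 2) \<le> K x powr 1" using p by (intro powr_mono) auto
          thus ?thesis using K0[of x] by simp
        qed
      qed auto
      finally show ?thesis .
    qed
    have bound_int: "integrable M (\<lambda>x. N powr (p / 2) * (1 + K x))" using K_int by auto
    have up_int: "integrable M (\<lambda>x. norm (u x) powr p)"
      by (rule Bochner_Integration.integrable_bound[OF bound_int]) (use up_le K0 in \<open>auto intro!: AE_I2\<close>)
    have up0: "(\<integral>x. norm (u x) powr p \<partial>M) \<ge> 0" by (intro Bochner_Integration.integral_nonneg) auto
    have "(\<integral>x. norm (u x) powr p \<partial>M) \<le> (\<integral>x. N powr (p / 2) * (1 + K x) \<partial>M)"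
      using up_int bound_int up_le by (intro Bochner_Integration.integral_mono) auto
    also have "\<dots> = N powr (p / 2) * (\<integral>x. 1 + K x \<partial>M)" by simp
    also have "\<dots> \<le> N powr (p / 2) * ((\<integral>x. 1 + K x \<partial>M) + 1)" by (intro mult_left_mono) auto
    finally have "(\<integral>x. norm (u x) powr p \<partial>M) powr (1 / p) \<le>
        (N powr (p / 2) * ((\<integral>x. 1 + K x \<partial>M) + 1)) powr (1 / p)"
      using up0 p by (intro powr_mono2) auto
    also have "\<dots> = C1 * sqrt N"
      using N0 K1 p by (simp add: C1_def powr_mult powr_powr powr_half_sqrt mult.commute)
    finally have upper: "(\<integral>x. norm (u x) powr p \<partial>M) powr (1 / p) \<le> C1 * sqrt N" .
    have lower: "sqrt N \<le> C2 * (\<integral>x. norm (u x) powr p \<partial>M) powr (1 / p)"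
    proof (cases "N = 0")
      case True
      thus ?thesis using C2 by simp
    next
      case False
      hence Np: "N > 0" using N0 by simp
      define P where "P = (\<integral>x. norm (u x) powr p \<partial>M)"
      have ptw: "(norm (u x))\<^sup>2 \<le> norm (u x) powr p * (N * m) powr (1 - p / 2) + N * (indicator {x. K x > m} x * K x)" for x
      proof (cases "K x > m")
        case True
        thus ?thesis using u_sq[of x] by (simp add: add_increasing)
      next
        case False
        have "(norm (u x))\<^sup>2 = norm (u x) powr p * norm (u x) powr (2 - p)"
          by (cases "norm (u x) = 0") (simp_all add: powr_add [symmetric])
        also have "norm (u x) powr (2 - p) \<le> (N * m) powr ((2 - p) / 2)"
          unfolding norm_powr[of x "2 - p"]
        proof (rule powr_mono2)
          show "(norm (u x))\<^sup>2 \<le> N * m"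
            using u_sq[of x] mult_left_mono[of "K x" m N] False N0 by linarith
        qed (use p in auto)
        also have "(2 - p) / 2 = 1 - p / 2" by simp
        finally show ?thesis using False by (simp add: mult_left_mono)
      qed
      have ind_int: "integrable M (\<lambda>x. indicator {x. K x > m} x * K x)"
        by (rule Bochner_Integration.integrable_bound[OF K_int]) (use K0 in \<open>auto intro!: AE_I2 simp: indicator_def\<close>)
      have "A * N \<le> (\<integral>x. (norm (u x))\<^sup>2 \<partial>M)" unfolding u_def N_def by (rule A)
      also have "\<dots> \<le> (\<integral>x. norm (u x) powr p * (N * m) powr (1 - p / 2) + N * (indicator {x. K x > m} x * K x) \<partial>M)"
        using u_int up_int ind_int ptw by (intro Bochner_Integration.integral_mono) auto
      also have "\<dots> = P * (N * m) powr (1 - p / 2) + N * (\<integral>x. indicator {x. K x > m} x * K x \<partial>M)"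
        using up_int ind_int by (subst Bochner_Integration.integral_add) (auto simp: P_def)
      also have "\<dots> \<le> P * (N * m) powr (1 - p / 2) + N * (A / 2)"
        using tail N0 by (intro add_left_mono mult_left_mono) (auto simp: m_def)
      finally have "A / 2 * N \<le> P * (N * m) powr (1 - p / 2)" by (simp add: algebra_simps)
      also have "\<dots> = P * m powr (1 - p / 2) * (N / N powr (p / 2))"
        using Np m by (simp add: powr_mult powr_diff mult_ac)
      finally have "N powr (p / 2) \<le> 2 / A * m powr (1 - p / 2) * P"
        using Np A by (simp add: field_simps)
      hence "(N powr (p / 2)) powr (1 / p) \<le> (2 / A * m powr (1 - p / 2) * P) powr (1 / p)"
        using p by (intro powr_mono2) auto
      also have "\<dots> = C2 * P powr (1 / p)" 
        unfolding C2_def by (subst powr_mult) (use A m up0 in \<open>auto simp: P_def\<close>)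
      finally show ?thesis using p Np by (simp add: powr_powr powr_half_sqrt P_def)
    qed
    show ?thesis using upper lower unfolding N_def u_def by blast
  qed
  show ?thesis
  proof (intro exI[of _ "max C1 C2"] conjI allI)
    fix a
    show "(\<integral>x. norm (\<Sum>k\<in>I. a k * g k x) powr p \<partial>M) powr (1 / p) \<le> max C1 C2 * sqrt (\<Sum>k\<in>I. (norm (a k))\<^sup>2)"
      by (rule order_trans[OF conjunct1[OF main]]) (intro mult_right_mono, auto simp: sum_nonneg)
    show "sqrt (\<Sum>k\<in>I. (norm (a k))\<^sup>2) \<le> max C1 C2 * (\<integral>x. norm (\<Sum>k\<in>I. a k * g k x) powr p \<partial>M) powr (1 / p)"
      by (rule order_trans[OF conjunct2[OF main]]) (intro mult_right_mono, auto)
  qed (use C1 in auto)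
qed


section \<open>Square integrable functions on the surface\<close>

context polyhedral_surface
begin

abbreviation "square \<equiv> restrict_space lborel (box (0::real^2) 1)"

section \<open>Area measure, Jacobian and transfer to the square\<close>

lemma finite_measure_square: "finite_measure square"
  by (rule finite_measureI) (simp add: space_restrict_space emeasure_restrict_space emeasure_lborel_box_eq)

text \<open>The Jacobian is the area of the parallelogram spanned by the partial derivatives
  \<open>a\<close> and \<open>b\<close>. It is at most the product of their lengths, and it equals
  the length of \<open>a\<close> times the height over \<open>a\<close>; nondegeneracy bounds both
  from below.\<close>

lemma area_jacobian_bounds:
  assumes i: "i < npatch S"
  shows "\<exists>c C. 0 < c \<and> (\<forall>x\<in>box 0 1. c \<le> area_jacobian S i x \<and> area_jacobian S i x \<le> C)"
proof -
  obtain c C where c: "0 < c" "0 < C" and bnd: "\<And>x h. x \<in> box 0 1 \<Longrightarrow> c * norm h \<le> norm (kappa_deriv S i x h)"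
      "\<And>x h. x \<in> box 0 1 \<Longrightarrow> norm (kappa_deriv S i x h) \<le> C * norm h"
    using kappa_nondegenerate[OF i] by blast
  have "c\<^sup>2 \<le> area_jacobian S i x \<and> area_jacobian S i x \<le> C\<^sup>2" if x: "x \<in> box 0 1" for x
  proof -
    interpret D: linear "kappa_deriv S i x"
      using kappa_differentiable[OF i x] by (rule linear_frechet_derivative)
    define a where "a = kappa_deriv S i x (axis 1 1)"
    define b where "b = kappa_deriv S i x (axis 2 1)"
    have a: "c \<le> norm a" "norm a \<le> C" and b: "norm b \<le> C"
      using bnd[OF x, of "axis 1 1"] bnd[OF x, of "axis 2 1"] by (auto simp: a_def b_def)
    have J: "(area_jacobian S i x)\<^sup>2 = (norm a)\<^sup>2 * (norm b)\<^sup>2 - (a \<bullet> b)\<^sup>2"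
      unfolding area_jacobian_def a_def b_def by (rule norm_cross)
    have "(area_jacobian S i x)\<^sup>2 \<le> (norm a)\<^sup>2 * (norm b)\<^sup>2" using J by simp
    also have "\<dots> \<le> C\<^sup>2 * C\<^sup>2" using a b c by (intro mult_mono power_mono) auto
    also have "C\<^sup>2 * C\<^sup>2 = (C\<^sup>2)\<^sup>2" by (simp add: power2_eq_square)
    finally have upper: "area_jacobian S i x \<le> C\<^sup>2"
      by (rule power2_le_imp_le) simp
    \<comment> \<open>The coefficient of the orthogonal projection of \<open>b\<close> onto
      \<open>a\<close>. The height vector \<open>b - t *\<^sub>R a\<close> is the image of a vector
      whose second component is one, so its norm is at least \<open>c\<close>.\<close>
    define t where "t = (a \<bullet> b) / (a \<bullet> a)"
    have "a \<noteq> 0" using a c by auto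
    hence aa: "a \<bullet> a > 0" by simp
    have "c * 1 \<le> c * norm (axis 2 1 - t *\<^sub>R axis 1 1 :: real^2)"
    proof -
      have "\<bar>(axis 2 1 - t *\<^sub>R axis 1 1 :: real^2) $ 2\<bar> \<le> norm (axis 2 1 - t *\<^sub>R axis 1 1 :: real^2)"
        by (rule component_le_norm_cart)
      thus ?thesis using c by (simp add: axis_def)
    qed
    also have "\<dots> \<le> norm (b - t *\<^sub>R a)"
      using bnd(1)[OF x, of "axis 2 1 - t *\<^sub>R axis 1 1"] by (simp add: a_def b_def D.diff D.scale)
    finally have "c\<^sup>2 \<le> (norm (b - t *\<^sub>R a))\<^sup>2" using c by (intro power_mono) auto
    also have "\<dots> = (norm b)\<^sup>2 - (a \<bullet> b)\<^sup>2 / (a \<bullet> a)"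
      using aa unfolding power2_norm_eq_inner t_def
      by (simp add: inner_diff_left inner_diff_right inner_commute power2_eq_square field_simps)
    finally have "(norm a)\<^sup>2 * c\<^sup>2 \<le> (norm a)\<^sup>2 * ((norm b)\<^sup>2 - (a \<bullet> b)\<^sup>2 / (a \<bullet> a))"
      by (intro mult_left_mono) auto
    also have "\<dots> = (area_jacobian S i x)\<^sup>2"
      using aa unfolding J by (simp add: right_diff_distrib power2_norm_eq_inner)
    finally have "(norm a)\<^sup>2 * c\<^sup>2 \<le> (area_jacobian S i x)\<^sup>2" .
    moreover have "c\<^sup>2 * c\<^sup>2 \<le> (norm a)\<^sup>2 * c\<^sup>2" using a c by (intro mult_right_mono power_mono) auto
    ultimately have "(c\<^sup>2)\<^sup>2 \<le> (area_jacobian S i x)\<^sup>2" by (simp add: power2_eq_square)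
    hence "c\<^sup>2 \<le> area_jacobian S i x"
      by (rule power2_le_imp_le) (simp add: area_jacobian_def)
    thus ?thesis using upper by simp
  qed
  thus ?thesis using c by (intro exI[of _ "c\<^sup>2"] exI[of _ "C\<^sup>2"]) auto
qed

lemma sets_area [simp, measurable_cong]: "sets (area S) = sets borel"
  and space_area [simp]: "space (area S) = UNIV"
  by (simp_all add: area_def)

lemma kappa_measurable [measurable]: "i < npatch S \<Longrightarrow> kappa S i \<in> measurable square borel"
proof -
  assume i: "i < npatch S"
  have "continuous_on (box 0 1) (kappa S i)"
    using kappa_differentiable[OF i]
    by (intro continuous_at_imp_continuous_on) (auto intro: differentiable_imp_continuous_within)
  hence "kappa S i \<in> measurable (restrict_space borel (box 0 1)) borel"
    by (rule borel_measurable_continuous_on_restrict)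
  thus ?thesis by (simp cong: measurable_cong_sets add: sets_restrict_space)
qed

lemma area_jacobian_measurable: "i < npatch S \<Longrightarrow> area_jacobian S i \<in> borel_measurable square"
proof -
  assume i: "i < npatch S"
  have "continuous_on (box 0 1) (area_jacobian S i)"
    unfolding area_jacobian_def using kappa_C1[OF i] by (intro continuous_intros continuous_on_cross)
  hence "area_jacobian S i \<in> borel_measurable (restrict_space borel (box 0 1))"
    by (rule borel_measurable_continuous_on_restrict)
  thus ?thesis by (simp cong: measurable_cong_sets add: sets_restrict_space)
qed

lemma nn_integral_area:
  assumes [measurable]: "g \<in> borel_measurable borel"
  shows "(\<integral>\<^sup>+x. g x \<partial>area S) = (\<Sum>i<npatch S. \<integral>\<^sup>+x. ennreal (area_jacobian S i x) * g (kappa S i x) \<partial>square)"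
proof -
  interpret finite_measure square by (rule finite_measure_square)
  let ?M = "count_space {..<npatch S} \<Otimes>\<^sub>M square"
  have [measurable]: "(\<lambda>(i, x). kappa S i x) \<in> measurable ?M borel"
    using kappa_measurable by (intro measurable_pair_measure_countable1) auto
  have [measurable]: "(\<lambda>(i, x). ennreal (area_jacobian S i x)) \<in> borel_measurable ?M"
    using area_jacobian_measurable by (intro measurable_pair_measure_countable1) auto
  have "(\<integral>\<^sup>+x. g x \<partial>area S) = (\<integral>\<^sup>+z. (\<lambda>(i, x). ennreal (area_jacobian S i x)) z * g ((\<lambda>(i, x). kappa S i x) z) \<partial>?M)"
    unfolding area_def by (subst nn_integral_distr, measurable) (rule nn_integral_density, measurable)
  also have "\<dots> = (\<integral>\<^sup>+i. \<integral>\<^sup>+x. (\<lambda>(i, x). ennreal (area_jacobian S i x)) (i, x) * g ((\<lambda>(i, x). kappa S i x) (i, x)) \<partial>square \<partial>count_space {..<npatch S})"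
    by (rule nn_integral_fst [symmetric]) measurable
  finally show ?thesis by (simp add: nn_integral_count_space_finite)
qed

lemma finite_measure_area: "finite_measure (area S)"
proof (rule finite_measureI)
  have "(\<integral>\<^sup>+x. ennreal (area_jacobian S i x) * 1 \<partial>square) < \<infinity>" if i: "i < npatch S" for i
  proof -
    obtain C where C: "\<And>x. x \<in> box 0 1 \<Longrightarrow> area_jacobian S i x \<le> C"
      using area_jacobian_bounds[OF i] by blast
    have "(\<integral>\<^sup>+x. ennreal (area_jacobian S i x) * 1 \<partial>square) \<le> (\<integral>\<^sup>+x. ennreal C \<partial>square)"
      using C by (intro nn_integral_mono) (auto simp: space_restrict_space intro: ennreal_leI)
    also have "\<dots> < \<infinity>" using finite_measure.emeasure_finite[OF finite_measure_square]
      by (simp add: ennreal_mult_less_top less_top)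
    finally show ?thesis .
  qed
  hence "(\<integral>\<^sup>+x. 1 \<partial>area S) < \<infinity>" by (subst nn_integral_area) (auto simp: less_top)
  thus "emeasure (area S) (space (area S)) \<noteq> \<infinity>" by simp
qed

text \<open>The pairing integrates over the square without the Jacobian, whereas \<open>L2\<close>
  is defined by area; the positive lower bound of the Jacobian bridges the two.\<close>

lemma L2_pullback:
  assumes u: "u \<in> L2 S" and i: "i < npatch S"
  shows "integrable square (\<lambda>x. (norm (u (kappa S i x)))\<^sup>2)"
proof (rule integrableI_bounded)
  have [measurable]: "u \<in> borel_measurable borel" using u by (simp add: L2_def)
  note [measurable] = kappa_measurable[OF i]
  show "(\<lambda>x. (norm (u (kappa S i x)))\<^sup>2) \<in> borel_measurable square" by measurable
  obtain c where c: "0 < c" "\<And>x. x \<in> box 0 1 \<Longrightarrow> c \<le> area_jacobian S i x"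
    using area_jacobian_bounds[OF i] by blast
  let ?f = "\<lambda>y. ennreal ((norm (u y))\<^sup>2)"
  have "ennreal c * (\<integral>\<^sup>+x. ?f (kappa S i x) \<partial>square) = (\<integral>\<^sup>+x. ennreal c * ?f (kappa S i x) \<partial>square)"
    by (rule nn_integral_cmult [symmetric]) measurable
  also have "\<dots> \<le> (\<integral>\<^sup>+x. ennreal (area_jacobian S i x) * ?f (kappa S i x) \<partial>square)"
    using c by (intro nn_integral_mono mult_right_mono) (auto simp: space_restrict_space intro: ennreal_leI)
  also have "\<dots> \<le> (\<Sum>i<npatch S. \<integral>\<^sup>+x. ennreal (area_jacobian S i x) * ?f (kappa S i x) \<partial>square)"
    using i by (intro member_le_sum) auto
  also have "\<dots> = (\<integral>\<^sup>+x. ?f x \<partial>area S)" by (rule nn_integral_area [symmetric]) measurable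
  also have "\<dots> < \<infinity>"
    using u by (auto simp: L2_def integrable_iff_bounded)
  finally have "(\<integral>\<^sup>+x. ?f (kappa S i x) \<partial>square) < \<infinity>"
    using c by (auto simp: ennreal_mult_less_top)
  thus "(\<integral>\<^sup>+x. ennreal (norm ((norm (u (kappa S i x)))\<^sup>2)) \<partial>square) < \<infinity>" by simp
qed

text \<open>Required for additivity of the pairing: the integral of a nonintegrable function is zero
  by convention.\<close>

lemma pairing_integrable:
  assumes u: "u \<in> L2 S" and v: "v \<in> L2 S" and i: "i < npatch S"
  shows "set_integrable lborel (box 0 1) (\<lambda>x. u (kappa S i x) * cnj (v (kappa S i x)))"
proof -
  have [measurable]: "u \<in> borel_measurable borel" "v \<in> borel_measurable borel"
    using u v by (auto simp: L2_def)
  have "cnj \<in> borel_measurable borel"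
    by (intro borel_measurable_continuous_onI continuous_intros)
  hence cnj_v: "(\<lambda>x. cnj (v (kappa S i x))) \<in> borel_measurable square"
    by (intro measurable_compose[OF measurable_compose[OF kappa_measurable[OF i]]]) simp_all
  have u: "(\<lambda>x. u (kappa S i x)) \<in> borel_measurable square"
    by (intro measurable_compose[OF kappa_measurable[OF i]]) simp
  have "integrable square (\<lambda>x. u (kappa S i x) * cnj (v (kappa S i x)))"
  proof (rule Bochner_Integration.integrable_bound)
    show "integrable square (\<lambda>x. (norm (u (kappa S i x)))\<^sup>2 + (norm (v (kappa S i x)))\<^sup>2)"
      using L2_pullback[OF \<open>u \<in> L2 S\<close> i] L2_pullback[OF v i] by auto
    have "norm (a * cnj b) \<le> (norm a)\<^sup>2 + (norm b)\<^sup>2" for a b :: complex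
    proof -
      have "0 \<le> norm a * norm b" by simp
      hence "norm a * norm b \<le> (norm a)\<^sup>2 + (norm b)\<^sup>2"
        using sum_squares_bound[of "norm a" "norm b"] by linarith
      thus ?thesis by (simp add: norm_mult)
    qed
    thus "AE x in square. norm (u (kappa S i x) * cnj (v (kappa S i x)))
        \<le> norm ((norm (u (kappa S i x)))\<^sup>2 + (norm (v (kappa S i x)))\<^sup>2)"
      by (intro AE_I2) (auto simp: abs_of_nonneg)
  qed (intro borel_measurable_times u cnj_v)
  thus ?thesis by (simp add: integrable_restrict_space set_integrable_def)
qed

section \<open>Linear structure of \<open>L2\<close> and linearity of the pairing\<close>

lemma L2_add: "u \<in> L2 S \<Longrightarrow> v \<in> L2 S \<Longrightarrow> (\<lambda>x. u x + v x) \<in> L2 S"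
proof -
  assume u: "u \<in> L2 S" and v: "v \<in> L2 S"
  have [measurable]: "u \<in> borel_measurable borel" "v \<in> borel_measurable borel"
    using u v by (auto simp: L2_def)
  have "integrable (area S) (\<lambda>x. (norm (u x + v x))\<^sup>2)"
  proof (rule Bochner_Integration.integrable_bound)
    show "integrable (area S) (\<lambda>x. 2 * (norm (u x))\<^sup>2 + 2 * (norm (v x))\<^sup>2)"
      using u v by (auto simp: L2_def)
    have "(norm (a + b))\<^sup>2 \<le> 2 * (norm a)\<^sup>2 + 2 * (norm b)\<^sup>2" for a b :: complex
    proof -
      have "(norm (a + b))\<^sup>2 \<le> (norm a + norm b)\<^sup>2" by (intro power_mono norm_triangle_ineq) auto
      also have "\<dots> \<le> 2 * (norm a)\<^sup>2 + 2 * (norm b)\<^sup>2"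
        using sum_squares_bound[of "norm a" "norm b"] by (simp add: power2_sum)
      finally show ?thesis .
    qed
    thus "AE x in area S. norm ((norm (u x + v x))\<^sup>2) \<le> norm (2 * (norm (u x))\<^sup>2 + 2 * (norm (v x))\<^sup>2)"
      by (intro AE_I2) (auto simp: abs_of_nonneg)
  qed measurable
  thus ?thesis by (simp add: L2_def)
qed

lemma L2_scale: "u \<in> L2 S \<Longrightarrow> (\<lambda>x. c * u x) \<in> L2 S"
  by (auto simp: L2_def norm_mult power_mult_distrib)

lemma L2_sum: "(\<And>m. m \<in> T \<Longrightarrow> b m \<in> L2 S) \<Longrightarrow> (\<lambda>x. \<Sum>m\<in>T. c m * b m x) \<in> L2 S"
proof (induction T rule: infinite_finite_induct)
  case (insert m T)
  thus ?case using L2_add[OF L2_scale[of "b m" "c m"], of "\<lambda>x. \<Sum>m\<in>T. c m * b m x"] by auto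
qed (auto simp: L2_def)

lemma pairing_add:
  assumes "u \<in> L2 S" "w \<in> L2 S" "v \<in> L2 S"
  shows "pairing S (\<lambda>x. u x + w x) v = pairing S u v + pairing S w v"
  using pairing_integrable[OF assms(1,3)] pairing_integrable[OF assms(2,3)]
  by (simp add: pairing_def distrib_right set_integral_add(2) flip: sum.distrib)

lemma pairing_scale: "pairing S (\<lambda>x. c * u x) v = c * pairing S u v"
  by (simp add: pairing_def mult.assoc sum_distrib_left)

lemma pairing_sum:
  assumes "\<And>m. m \<in> T \<Longrightarrow> b m \<in> L2 S" "v \<in> L2 S"
  shows "pairing S (\<lambda>x. \<Sum>m\<in>T. c m * b m x) v = (\<Sum>m\<in>T. c m * pairing S (b m) v)"
  using assms(1)
proof (induction T rule: infinite_finite_induct)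
  case (insert m T)
  thus ?case using pairing_add[OF L2_scale[of "b m" "c m"] L2_sum[of T b c] assms(2)]
    by (simp add: pairing_scale)
qed (auto simp: pairing_def)

lemma pairing_residual:
  assumes "u \<in> L2 S" "\<And>m. m \<in> T \<Longrightarrow> b m \<in> L2 S" "v \<in> L2 S"
  shows "pairing S (\<lambda>x. u x - (\<Sum>m\<in>T. c m * b m x)) v = pairing S u v - (\<Sum>m\<in>T. c m * pairing S (b m) v)"
  using pairing_add[OF assms(1) L2_scale[OF L2_sum[of T b c], of "- 1"] assms(3)] assms(2)
    pairing_scale[of "- 1" "\<lambda>x. \<Sum>m\<in>T. c m * b m x" v] pairing_sum[of T b v c] assms(3)
  by simp

end


section \<open>Wavelet coefficients\<close>

abbreviation wcoeff :: "surface \<Rightarrow> wavelets \<Rightarrow> (real^3 \<Rightarrow> complex) \<Rightarrow> nat \<Rightarrow> real^3 \<Rightarrow> real" where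
  "wcoeff S W u j \<xi> \<equiv> norm (pairing S u (dwav W j \<xi>))"

text \<open>For nonnegative terms, bounded finite partial sums mean summability together with the
  same bound for the infinite sum. A finite bound rules out the branch with value
  \<open>\<infinity>\<close>.\<close>

lemma coeff_norm_le_iff:
  assumes "0 < p" "0 < q" "0 \<le> B"
  shows "coeff_norm S W \<beta> p q u \<le> ennreal B \<longleftrightarrow>
    lq_le q {jstar W..} (level_norm \<beta> p (nabla W) (wcoeff S W u)) B"
proof (cases q)
  case (real r)
  hence r: "r > 0" using assms by simp
  let ?E = "level_norm \<beta> p (nabla W) (wcoeff S W u)"
  define a where "a j = 2 powr (real j * \<beta> * r) * level_sum S W p u j powr (r / p)" for j
  have a: "a j = ?E j powr r" for j
    using r by (simp add: a_def level_norm_def lp_sum_def level_sum_def powr_mult powr_powr)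
  have a0: "a j \<ge> 0" for j by (simp add: a)
  have norm: "coeff_norm S W \<beta> p q u =
      (if a summable_on {jstar W..} then ennreal ((\<Sum>\<^sub>\<infinity>j\<in>{jstar W..}. a j) powr (1 / r)) else \<infinity>)"
    using real by (simp add: coeff_norm_def a_def [abs_def] Let_def)
  have lq: "lq_le q {jstar W..} ?E B \<longleftrightarrow> (\<forall>F. finite F \<and> F \<subseteq> {jstar W..} \<longrightarrow> sum a F \<le> B powr r)"
    using real r assms by (simp add: lq_le_def lp_sum_le_iff a [abs_def])
  show ?thesis
  proof
    assume le: "coeff_norm S W \<beta> p q u \<le> ennreal B"
    have summ: "a summable_on {jstar W..}"
      using le norm by (auto split: if_splits simp: top_unique)
    hence "(\<Sum>\<^sub>\<infinity>j\<in>{jstar W..}. a j) powr (1 / r) \<le> B" using le norm assms by simp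
    hence "((\<Sum>\<^sub>\<infinity>j\<in>{jstar W..}. a j) powr (1 / r)) powr r \<le> B powr r"
      using r by (intro powr_mono2) auto
    hence inf_le: "(\<Sum>\<^sub>\<infinity>j\<in>{jstar W..}. a j) \<le> B powr r"
      using r a0 by (simp add: powr_powr infsum_nonneg)
    have sum_le: "sum a F \<le> (\<Sum>\<^sub>\<infinity>j\<in>{jstar W..}. a j)" if "finite F" "F \<subseteq> {jstar W..}" for F
      using that summ a0 by (intro finite_sum_le_infsum) auto
    show "lq_le q {jstar W..} ?E B" unfolding lq using order_trans[OF sum_le inf_le] by simp
  next
    assume "lq_le q {jstar W..} ?E B"
    hence le: "\<And>F. finite F \<Longrightarrow> F \<subseteq> {jstar W..} \<Longrightarrow> sum a F \<le> B powr r" unfolding lq by blast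
    have summ: "a summable_on {jstar W..}"
      by (intro nonneg_bdd_above_summable_on bdd_aboveI2[where M = "B powr r"]) (use a0 le in auto)
    have "(\<Sum>\<^sub>\<infinity>j\<in>{jstar W..}. a j) \<le> B powr r" using summ le by (rule infsum_le_finite_sums)
    hence "(\<Sum>\<^sub>\<infinity>j\<in>{jstar W..}. a j) powr (1 / r) \<le> (B powr r) powr (1 / r)"
      using r a0 by (intro powr_mono2) (auto intro: infsum_nonneg)
    thus "coeff_norm S W \<beta> p q u \<le> ennreal B"
      using summ norm r assms by (auto simp: powr_powr intro!: ennreal_leI)
  qed
next
  case PInf
  thus ?thesis using assms
    by (simp add: coeff_norm_def lq_le_def level_norm_def lp_sum_def level_sum_def SUP_le_iff)
qed (use assms in auto)

lemma le_coeff_norm: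
  assumes "0 < p" "0 < q"
    "\<And>D. 0 \<le> D \<Longrightarrow> lq_le q {jstar W..} (level_norm \<beta> p (nabla W) (wcoeff S W u)) D \<Longrightarrow> B \<le> D"
  shows "ennreal B \<le> coeff_norm S W \<beta> p q u"
proof (cases "coeff_norm S W \<beta> p q u")
  case (real D)
  hence "lq_le q {jstar W..} (level_norm \<beta> p (nabla W) (wcoeff S W u)) D"
    using coeff_norm_le_iff[OF assms(1,2), of D S W \<beta> u] by simp
  thus ?thesis using assms(3) real by (auto intro: ennreal_leI)
qed auto

lemma lesssim_of_nat_powerD:
  assumes "0 < C" "of_nat k \<le> ennreal C * 2 ^ m"
  shows "real k \<le> C * 2 ^ m"
proof -
  have "ennreal (real k) \<le> ennreal (C * 2 ^ m)"
    using assms by (simp add: ennreal_of_nat_eq_real_of_nat ennreal_mult ennreal_power [symmetric])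
  thus ?thesis using assms by (subst (asm) ennreal_le_iff) auto
qed

lemma lesssim_power_of_natD:
  assumes "0 < C" "2 ^ m \<le> ennreal C * of_nat k"
  shows "2 ^ m \<le> C * real k"
proof -
  have "ennreal (2 ^ m) \<le> ennreal (C * real k)"
    using assms by (simp add: ennreal_of_nat_eq_real_of_nat ennreal_mult ennreal_power [symmetric])
  thus ?thesis using assms by (subst (asm) ennreal_le_iff) auto
qed

context wavelet_basis
begin

text \<open>A set with empty frontier is empty or the whole space, and a nonempty compact body is
  neither. Patch \<open>0\<close> is then available for counting indices from below.\<close>

lemma npatch_pos: "npatch S > 0"
proof (rule ccontr)
  assume "\<not> npatch S > 0"
  hence "frontier (body S) = {}" using boundary_eq by simp
  hence "body S = UNIV" using body_nonempty by (simp add: frontier_eq_empty)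
  thus False using compact_body compact_imp_bounded not_bounded_UNIV by metis
qed

text \<open>A single patch suffices for the lower bound. The upper bound comes from the union bound,
  as grid points on common edges belong to several closed patches.\<close>

lemma card_nabla_bounds:
  "\<exists>c B. 0 < c \<and> 0 < B \<and> (\<forall>j\<ge>jstar W. c * 4 ^ j \<le> real (card (nabla W j)) \<and> real (card (nabla W j)) \<le> B * 4 ^ j)"
proof -
  obtain C where C: "C > 0" and up: "\<And>j i. j \<ge> jstar W \<Longrightarrow> i < npatch S \<Longrightarrow>
      of_nat (card (nabla W j \<inter> closure (patch S i))) \<le> ennreal C * 2 ^ (2 * j)"
    using nabla_card by (fastforce simp: sim_on_def lesssim_on_def)
  obtain C' where C': "C' > 0" and low: "\<And>j i. j \<ge> jstar W \<Longrightarrow> i < npatch S \<Longrightarrow>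
      2 ^ (2 * j) \<le> ennreal C' * of_nat (card (nabla W j \<inter> closure (patch S i)))"
    using nabla_card by (fastforce simp: sim_on_def lesssim_on_def)
  have "(1 / C') * 4 ^ j \<le> real (card (nabla W j)) \<and> real (card (nabla W j)) \<le> real (npatch S) * C * 4 ^ j"
    if j: "j \<ge> jstar W" for j
  proof
    have fin: "finite (nabla W j)" "nabla W j \<subseteq> frontier (body S)" using nabla_grid[OF j] by auto
    have "4 ^ j \<le> C' * real (card (nabla W j \<inter> closure (patch S 0)))"
      using lesssim_power_of_natD[OF C' low[OF j npatch_pos]] by (simp add: power_mult)
    also have "\<dots> \<le> C' * real (card (nabla W j))"
      using C' fin by (intro mult_left_mono) (auto intro: card_mono)
    finally show "(1 / C') * 4 ^ j \<le> real (card (nabla W j))" using C' by (simp add: field_simps)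
    have "nabla W j = (\<Union>i<npatch S. nabla W j \<inter> closure (patch S i))"
      using fin boundary_eq by auto
    hence "card (nabla W j) \<le> (\<Sum>i<npatch S. card (nabla W j \<inter> closure (patch S i)))"
      by (metis card_UN_le finite_lessThan)
    hence "real (card (nabla W j)) \<le> (\<Sum>i<npatch S. real (card (nabla W j \<inter> closure (patch S i))))"
      by (simp flip: of_nat_sum)
    also have "\<dots> \<le> (\<Sum>i<npatch S. C * 4 ^ j)"
      using lesssim_of_nat_powerD[OF C up[OF j]] by (intro sum_mono) (simp add: power_mult)
    finally show "real (card (nabla W j)) \<le> real (npatch S) * C * 4 ^ j" by simp
  qed
  thus ?thesis using C C' npatch_pos by (intro exI[of _ "1 / C'"] exI[of _ "real (npatch S) * C"]) auto
qed

lemma primal_L2: "k \<in> basis_index W \<Longrightarrow> primal W k \<in> L2 S"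
  using riesz_primal by (simp add: riesz_basis_def)

lemma dual_L2: "k \<in> basis_index W \<Longrightarrow> dual W k \<in> L2 S"
  using riesz_dual by (simp add: riesz_basis_def)

lemma dual_simps [simp]: "dual W (Inl k) = dgen W k" "dual W (Inr (j, \<xi>)) = dwav W j \<xi>"
  by (simp_all add: dual_def)

lemma Inl_basis_index [simp]: "Inl k \<in> basis_index W \<longleftrightarrow> k < ngen W"
  and Inr_basis_index [simp]: "Inr l \<in> basis_index W \<longleftrightarrow> l \<in> wav_index W"
  by (auto simp: basis_index_def)

lemma basis_index_nonempty: "basis_index W \<noteq> {}"
proof -
  obtain c where "c > 0" "c * 4 ^ jstar W \<le> real (card (nabla W (jstar W)))"
    using card_nabla_bounds by blast
  moreover from this have "0 < c * 4 ^ jstar W" by simp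
  ultimately have "0 < real (card (nabla W (jstar W)))" by linarith
  then obtain \<xi> where "\<xi> \<in> nabla W (jstar W)" by fastforce
  thus ?thesis by (force simp: basis_index_def wav_index_def)
qed

section \<open>Dictionary combinations and their coefficients\<close>

lemma pairing_combination:
  assumes "finite I" "I \<subseteq> basis_index W" "l \<in> basis_index W"
  shows "pairing S (\<lambda>x. \<Sum>k\<in>I. a k * primal W k x) (dual W l) = (if l \<in> I then a l else 0)"
proof -
  have "pairing S (\<lambda>x. \<Sum>k\<in>I. a k * primal W k x) (dual W l) = (\<Sum>k\<in>I. a k * pairing S (primal W k) (dual W l))"
    using assms by (intro pairing_sum primal_L2 dual_L2) auto
  also have "\<dots> = (\<Sum>k\<in>I. if k = l then a k else 0)"
    using assms by (intro sum.cong refl) (auto simp: biorthogonal subset_iff)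
  finally show ?thesis using assms by simp
qed

lemma pairing_combination_residual:
  assumes "u \<in> L2 S" "finite I" "I \<subseteq> basis_index W" "l \<in> basis_index W"
  shows "pairing S (\<lambda>x. u x - (\<Sum>k\<in>I. a k * primal W k x)) (dual W l) =
    pairing S u (dual W l) - (if l \<in> I then a l else 0)"
proof -
  have "pairing S (\<lambda>x. u x - (\<Sum>k\<in>I. a k * primal W k x)) (dual W l) =
      pairing S u (dual W l) - (\<Sum>k\<in>I. a k * pairing S (primal W k) (dual W l))"
    using assms by (intro pairing_residual primal_L2 dual_L2) auto
  also have "(\<Sum>k\<in>I. a k * pairing S (primal W k) (dual W l)) = (\<Sum>k\<in>I. if k = l then a k else 0)"
    using assms by (intro sum.cong refl) (auto simp: biorthogonal subset_iff)
  finally show ?thesis using assms by simp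
qed

text \<open>\<open>best_approx\<close> admits exactly \<open>n\<close> summands. A smaller index set
  is padded with an arbitrary basis element \<open>k0\<close> and coefficient zero.\<close>

lemma best_approx_le:
  assumes I: "finite I" "I \<subseteq> basis_index W" "card I \<le> n"
  shows "best_approx n u (dictionary W) G \<le> G (\<lambda>x. u x - (\<Sum>k\<in>I. a k * primal W k x))"
proof -
  obtain h where h: "bij_betw h {0..<card I} I" using ex_bij_betw_nat_finite I by blast
  obtain k0 where k0: "k0 \<in> basis_index W" using basis_index_nonempty by auto
  define b where "b m = primal W (if m < card I then h m else k0)" for m
  define c where "c m = (if m < card I then a (h m) else 0)" for m
  have "(if m < card I then h m else k0) \<in> basis_index W" for m
    using bij_betwE[OF h] k0 I(2) by auto
  hence "b m \<in> dictionary W" for m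
    by (auto simp: b_def dictionary_def simp del: if_image_distrib)
  hence "best_approx n u (dictionary W) G \<le> G (\<lambda>x. u x - (\<Sum>m<n. c m * b m x))"
    unfolding best_approx_def by (intro INF_lower2[of "(b, c)"]) auto
  moreover have "(\<Sum>m<n. c m * b m x) = (\<Sum>k\<in>I. a k * primal W k x)" for x
  proof -
    have "(\<Sum>m<n. c m * b m x) = (\<Sum>m\<in>{0..<card I}. a (h m) * primal W (h m) x)"
      using I by (intro sum.mono_neutral_cong_right) (auto simp: b_def c_def)
    also have "\<dots> = (\<Sum>k\<in>I. a k * primal W k x)" by (rule sum.reindex_bij_betw[OF h])
    finally show ?thesis .
  qed
  ultimately show ?thesis by simp
qed

text \<open>By biorthogonality an \<open>n\<close>-term combination leaves every dual coefficient
  outside its own indices unchanged. This is all that is retained about the residual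
  \<open>v\<close>, so neither the coefficients nor repetitions in the combination matter.\<close>

lemma le_best_approx:
  assumes u: "u \<in> L2 S"
    and B: "\<And>v K. finite K \<Longrightarrow> card K \<le> n \<Longrightarrow>
      (\<And>l. l \<in> basis_index W - K \<Longrightarrow> pairing S v (dual W l) = pairing S u (dual W l)) \<Longrightarrow> B \<le> G v"
  shows "B \<le> best_approx n u (dictionary W) G"
  unfolding best_approx_def
proof (intro INF_greatest, clarsimp)
  fix b :: "nat \<Rightarrow> real^3 \<Rightarrow> complex" and c :: "nat \<Rightarrow> complex"
  assume "\<forall>m<n. b m \<in> dictionary W"
  hence "\<forall>m. \<exists>k. m < n \<longrightarrow> k \<in> basis_index W \<and> b m = primal W k"
    by (auto simp: dictionary_def)
  then obtain k where k: "\<And>m. m < n \<Longrightarrow> k m \<in> basis_index W \<and> b m = primal W (k m)" by metis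
  show "B \<le> G (\<lambda>x. u x - (\<Sum>m<n. c m * b m x))"
  proof (rule B)
    show "card (k ` {..<n}) \<le> n" using card_image_le[of "{..<n}" k] by simp
    fix l assume l: "l \<in> basis_index W - k ` {..<n}"
    have "pairing S (\<lambda>x. u x - (\<Sum>m<n. c m * b m x)) (dual W l) =
        pairing S u (dual W l) - (\<Sum>m<n. c m * pairing S (b m) (dual W l))"
      using u k l primal_L2 dual_L2 by (intro pairing_residual) auto
    also have "(\<Sum>m<n. c m * pairing S (b m) (dual W l)) = 0"
      using k l by (intro sum.neutral) (auto simp: biorthogonal)
    finally show "pairing S (\<lambda>x. u x - (\<Sum>m<n. c m * b m x)) (dual W l) = pairing S u (dual W l)" by simp
  qed auto
qed

lemma gen_proj_eq_0:
  assumes "\<And>k. k < ngen W \<Longrightarrow> pairing S u (dgen W k) = 0"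
  shows "lp_norm S p (gen_proj S W u) = 0"
proof -
  have "gen_proj S W u = (\<lambda>x. 0)" using assms by (auto simp: gen_proj_def fun_eq_iff)
  thus ?thesis by (simp add: lp_norm_def)
qed

text \<open>Source and target measure the generator part in different exponents; both are compared
  with the Euclidean norm of the coefficients. The lower Riesz bound, restricted to the generators,
  supplies the constant \<open>A\<close>.\<close>

lemma gen_proj_lp_bound:
  assumes "0 < p" "p \<le> 2" "0 < p'" "p' \<le> 2"
  shows "\<exists>C>0. \<forall>u. lp_norm S p' (gen_proj S W u) \<le> C * lp_norm S p (gen_proj S W u)"
proof -
  obtain A where A: "A > 0" and riesz: "\<And>T c. finite T \<Longrightarrow> T \<subseteq> basis_index W \<Longrightarrow>
      A * (\<Sum>i\<in>T. (norm (c i))\<^sup>2) \<le> (lp_norm S 2 (\<lambda>x. \<Sum>i\<in>T. c i * primal W i x))\<^sup>2"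
    using riesz_primal unfolding riesz_basis_def by meson
  have gen: "gen W k \<in> L2 S" if "k < ngen W" for k
    using primal_L2[of "Inl k"] that by (simp add: primal_def)
  have low: "A * (\<Sum>k<ngen W. (norm (a k))\<^sup>2) \<le> (\<integral>x. (norm (\<Sum>k<ngen W. a k * gen W k x))\<^sup>2 \<partial>area S)" for a
  proof -
    have "A * (\<Sum>k<ngen W. (norm (a k))\<^sup>2) \<le> (lp_norm S 2 (\<lambda>x. \<Sum>k<ngen W. a k * gen W k x))\<^sup>2"
      using riesz[of "Inl ` {..<ngen W}" "a \<circ> projl"] by (simp add: sum.reindex primal_def image_subset_iff)
    also have "\<dots> = (\<integral>x. (norm (\<Sum>k<ngen W. a k * gen W k x))\<^sup>2 \<partial>area S)"
      by (simp add: lp_norm_def powr_half_sqrt Bochner_Integration.integral_nonneg)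
    finally show ?thesis .
  qed
  have eq: "\<exists>C>0. \<forall>a.
    lp_norm S e (\<lambda>x. \<Sum>k<ngen W. a k * gen W k x) \<le> C * sqrt (\<Sum>k<ngen W. (norm (a k))\<^sup>2) \<and>
    sqrt (\<Sum>k<ngen W. (norm (a k))\<^sup>2) \<le> C * lp_norm S e (\<lambda>x. \<Sum>k<ngen W. a k * gen W k x)"
    if e: "0 < e" "e \<le> 2" for e
    unfolding lp_norm_def
  proof (rule finite_span_lp_equivalence[OF finite_measure_area _ _ _ A low e])
    show "gen W k \<in> borel_measurable (area S)" if "k \<in> {..<ngen W}" for k
      using gen[of k] that by (simp add: L2_def cong: measurable_cong_sets)
    show "integrable (area S) (\<lambda>x. (norm (gen W k x))\<^sup>2)" if "k \<in> {..<ngen W}" for k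
      using gen[of k] that by (simp add: L2_def)
  qed auto
  obtain C where C: "C > 0" and C_le: "\<And>a. sqrt (\<Sum>k<ngen W. (norm (a k))\<^sup>2) \<le>
      C * lp_norm S p (\<lambda>x. \<Sum>k<ngen W. a k * gen W k x)"
    using eq[OF assms(1,2)] by blast
  obtain C' where C': "C' > 0" and C'_le: "\<And>a. lp_norm S p' (\<lambda>x. \<Sum>k<ngen W. a k * gen W k x) \<le>
      C' * sqrt (\<Sum>k<ngen W. (norm (a k))\<^sup>2)"
    using eq[OF assms(3,4)] by blast
  have "lp_norm S p' (gen_proj S W u) \<le> C' * C * lp_norm S p (gen_proj S W u)" for u
  proof -
    define a where "a k = pairing S u (dgen W k)" for k
    have g: "gen_proj S W u = (\<lambda>x. \<Sum>k<ngen W. a k * gen W k x)" by (simp add: gen_proj_def a_def fun_eq_iff)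
    have "lp_norm S p' (gen_proj S W u) \<le> C' * sqrt (\<Sum>k<ngen W. (norm (a k))\<^sup>2)"
      unfolding g by (rule C'_le)
    also have "\<dots> \<le> C' * (C * lp_norm S p (gen_proj S W u))"
      unfolding g using C' by (intro mult_left_mono C_le) auto
    finally show ?thesis by (simp add: mult.assoc)
  qed
  thus ?thesis using C C' by (intro exI[of _ "C' * C"]) auto
qed

end


section \<open>Best \<open>n\<close>-term approximation between Besov-type spaces\<close>

text \<open>Since \<open>1 / 0 = 0\<close>, the lower bound on \<open>1 / p\<close> excludes all
  \<open>p \<le> 0\<close>.\<close>

lemma admissibleD:
  assumes "admissible \<alpha> p q"
  shows "0 < p" "p \<le> 2" "0 < q"
proof -
  have "1 / 2 \<le> 1 / p" using assms by (simp add: admissible_def)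
  moreover from this have "0 < p" by (metis less_le_trans zero_less_divide_1_iff half_gt_zero zero_less_one)
  ultimately show "0 < p" "p \<le> 2" by (auto simp: field_simps)
  show "0 < q" using assms by (simp add: admissible_def)
qed

text \<open>The power is monotone in a direction that depends on the sign of \<open>e\<close>, so
  one of the two end points always gives the bound.\<close>

lemma min_powr_le:
  fixes a b y e :: real
  assumes "0 < a" "a \<le> y" "y \<le> b"
  shows "min (a powr e) (b powr e) \<le> y powr e"
proof (cases "e \<ge> 0")
  case True
  hence "a powr e \<le> y powr e" using assms by (intro powr_mono2) auto
  thus ?thesis by simp
next
  case False
  hence "b powr e \<le> y powr e" using assms by (intro powr_mono2') auto
  thus ?thesis by simp
qed

lemma lp_sum_supported:
  assumes "finite A" "T \<subseteq> A" "\<And>x. x \<in> A \<Longrightarrow> c x = (if x \<in> T then d x else 0)"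
  shows "lp_sum p A c = lp_sum p T d"
  unfolding lp_sum_def using assms
  by (intro arg_cong2[where f = "(powr)"] sum.mono_neutral_cong_right) auto

lemma lesssim_on_lower:
  assumes "\<exists>c>0. \<forall>n\<ge>1. ennreal (c * real n powr e) \<le> f n"
  shows "lesssim_on {1..} (\<lambda>n. ennreal (real n powr e)) f"
proof -
  obtain c where c: "c > 0" "\<And>n. n \<ge> 1 \<Longrightarrow> ennreal (c * real n powr e) \<le> f n" using assms by auto
  have "ennreal (real n powr e) \<le> ennreal (1 / c) * f n" if "n \<ge> 1" for n
  proof -
    have "ennreal (real n powr e) = ennreal (1 / c) * ennreal (c * real n powr e)"
      using c by (simp add: ennreal_mult' [symmetric])
    also have "\<dots> \<le> ennreal (1 / c) * f n" using c that by (intro mult_left_mono) auto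
    finally show ?thesis .
  qed
  thus ?thesis using c unfolding lesssim_on_def by (intro exI[of _ "1 / c"]) auto
qed

context wavelet_basis
begin

text \<open>The coefficient result spends \<open>C * m\<close> terms for a parameter
  \<open>m\<close>, and the generators cost \<open>ngen W\<close> more. For large \<open>n\<close>
  one takes \<open>m\<close> comparable to \<open>n\<close> with total cost at most
  \<open>n\<close>; the remaining \<open>n\<close> are bounded, so the zero approximant and a larger
  constant suffice.\<close>

lemma sigma_upper:
  assumes adm0: "admissible \<alpha>\<^sub>0 p\<^sub>0 q\<^sub>0" and adm1: "admissible \<alpha>\<^sub>1 p\<^sub>1 q\<^sub>1" and \<mu>: "\<mu> \<ge> 0"
  defines "R \<equiv> level_norm (\<alpha>\<^sub>0 + 2 * (1 / 2 - 1 / p\<^sub>0)) p\<^sub>0"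
    and "E \<equiv> level_norm (\<alpha>\<^sub>1 + 2 * (1 / 2 - 1 / p\<^sub>1)) p\<^sub>1"
  assumes nterm: "\<exists>C>0. \<forall>n::nat. n \<ge> 1 \<longrightarrow> (\<forall>c. (\<forall>j x. 0 \<le> c j x) \<longrightarrow>
        lq_le q\<^sub>0 {jstar W..} (R (nabla W) c) 1 \<longrightarrow>
        (\<exists>\<Lambda>\<subseteq>Sigma {jstar W..} (nabla W). finite \<Lambda> \<and> real (card \<Lambda>) \<le> C * real n \<and>
           lq_le q\<^sub>1 {jstar W..} (E (\<lambda>j. nabla W j - \<Lambda> `` {j}) c) (C * real n powr (- \<mu>))))"
      (is "\<exists>C>0. ?nterm C")
    and emb: "\<exists>C>0. \<forall>c. (\<forall>j x. 0 \<le> c j x) \<longrightarrow>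
        lq_le q\<^sub>0 {jstar W..} (R (nabla W) c) 1 \<longrightarrow> lq_le q\<^sub>1 {jstar W..} (E (nabla W) c) C"
      (is "\<exists>C>0. ?emb C")
  shows "lesssim_on {1..} (besov_sigma S W (\<alpha>\<^sub>0, p\<^sub>0, q\<^sub>0) (\<alpha>\<^sub>1, p\<^sub>1, q\<^sub>1)) (\<lambda>n. ennreal (real n powr (- \<mu>)))"
proof -
  note pq = admissibleD[OF adm0] admissibleD[OF adm1]
  let ?G = "besov_norm S W \<alpha>\<^sub>1 p\<^sub>1 q\<^sub>1"
  obtain C where C: "C > 0" and "?nterm C" using nterm by (elim exE conjE)
  note nterm = this(2)[rule_format, folded wav_index_def]
  obtain Ce where Ce: "Ce > 0" and "?emb Ce" using emb by (elim exE conjE)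
  note emb = this(2)[rule_format]
  obtain Cg where Cg: "Cg > 0" and gen: "\<And>u. lp_norm S p\<^sub>1 (gen_proj S W u) \<le> Cg * lp_norm S p\<^sub>0 (gen_proj S W u)"
    using gen_proj_lp_bound[OF pq(1,2,4,5)] by blast
  \<comment> \<open>From here on the generators take at most half of the \<open>n\<close> terms, and
    the rest pays for some \<open>m \<ge> 1\<close>.\<close>
  define N0 where "N0 = 2 * real (ngen W) + 2 * C"
  define X where "X = max (C * (4 * C) powr \<mu>) ((Cg + Ce) * N0 powr \<mu>)"
  have X: "X > 0" using C by (simp add: X_def less_max_iff_disj)
  have main: "best_approx n u (dictionary W) ?G \<le> ennreal (X * real n powr (- \<mu>))"
    if n: "n \<ge> 1" and u: "u \<in> L2 S" and norm: "besov_norm S W \<alpha>\<^sub>0 p\<^sub>0 q\<^sub>0 u \<le> 1" for n u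
  proof -
    have "coeff_norm S W (\<alpha>\<^sub>0 + 2 * (1 / 2 - 1 / p\<^sub>0)) p\<^sub>0 q\<^sub>0 u \<le> besov_norm S W \<alpha>\<^sub>0 p\<^sub>0 q\<^sub>0 u"
      unfolding besov_norm_def by (rule add_increasing) simp_all
    also have "\<dots> \<le> ennreal 1" using norm by simp
    finally have "coeff_norm S W (\<alpha>\<^sub>0 + 2 * (1 / 2 - 1 / p\<^sub>0)) p\<^sub>0 q\<^sub>0 u \<le> ennreal 1" .
    hence lq: "lq_le q\<^sub>0 {jstar W..} (R (nabla W) (wcoeff S W u)) 1"
      unfolding R_def using pq by (subst (asm) coeff_norm_le_iff) auto
    have "ennreal (lp_norm S p\<^sub>0 (gen_proj S W u)) \<le> besov_norm S W \<alpha>\<^sub>0 p\<^sub>0 q\<^sub>0 u"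
      unfolding besov_norm_def by (rule add_increasing2) simp_all
    also have "\<dots> \<le> 1" by (rule norm)
    finally have gen1: "lp_norm S p\<^sub>0 (gen_proj S W u) \<le> 1" by simp
    show ?thesis
    proof (cases "real n \<ge> N0")
      case True
      define m where "m = nat \<lfloor>(real n - real (ngen W)) / C\<rfloor>"
      have q1: "(real n - real (ngen W)) / C \<ge> 1" using True C by (simp add: N0_def field_simps)
      have m1: "m \<ge> 1" using q1 by (simp add: m_def le_nat_iff)
      have "real m \<le> (real n - real (ngen W)) / C" using q1 by (simp add: m_def)
      hence Cm: "real (ngen W) + C * real m \<le> real n" using C by (simp add: field_simps)
      \<comment> \<open>The integer part of a number that is at least one is at least half of
        it.\<close>
      have "(real n - real (ngen W)) / C \<le> 2 * real m"
        using q1 m1 unfolding m_def by linarith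
      hence "real n - real (ngen W) \<le> 2 * C * real m" using C by (simp add: field_simps)
      moreover have "2 * real (ngen W) \<le> real n" using True C by (simp add: N0_def)
      ultimately have "real n \<le> 4 * C * real m" by linarith
      hence "(4 * C * real m) powr (- \<mu>) \<le> real n powr (- \<mu>)" using n \<mu> by (intro powr_mono2') auto
      hence "(4 * C) powr \<mu> * ((4 * C) powr (- \<mu>) * real m powr (- \<mu>)) \<le> (4 * C) powr \<mu> * real n powr (- \<mu>)"
        using C by (intro mult_left_mono) (auto simp: powr_mult)
      hence rate: "real m powr (- \<mu>) \<le> (4 * C) powr \<mu> * real n powr (- \<mu>)"
        using C by (simp add: powr_minus field_simps)
      obtain \<Lambda> where \<Lambda>: "\<Lambda> \<subseteq> wav_index W" "finite \<Lambda>" "real (card \<Lambda>) \<le> C * real m"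
        and err: "lq_le q\<^sub>1 {jstar W..} (E (\<lambda>j. nabla W j - \<Lambda> `` {j}) (wcoeff S W u)) (C * real m powr (- \<mu>))"
        using nterm[OF m1 _ lq] by auto
      define I where "I = {..<ngen W} <+> \<Lambda>"
      have I: "finite I" "I \<subseteq> basis_index W" "card I \<le> n"
      proof -
        show "finite I" using \<Lambda> by (simp add: I_def)
        show "I \<subseteq> basis_index W" using \<Lambda> by (auto simp: I_def)
        have "real (card I) = real (ngen W) + real (card \<Lambda>)" using \<Lambda> by (simp add: I_def card_Plus)
        also have "\<dots> \<le> real n" using Cm \<Lambda> by linarith
        finally show "card I \<le> n" by simp
      qed
      \<comment> \<open>The approximant copies the coefficients of \<open>u\<close> on
        \<open>I\<close>. The residual thus has none there, in particular no generator part, and the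
        old ones elsewhere.\<close>
      define v where "v x = u x - (\<Sum>k\<in>I. pairing S u (dual W k) * primal W k x)" for x
      have v: "pairing S v (dual W l) = (if l \<in> I then 0 else pairing S u (dual W l))" if "l \<in> basis_index W" for l
        unfolding v_def using pairing_combination_residual[OF u I(1,2) that] by auto
      have gen0: "lp_norm S p\<^sub>1 (gen_proj S W v) = 0"
      proof (rule gen_proj_eq_0)
        fix k assume "k < ngen W"
        thus "pairing S v (dgen W k) = 0" using v[of "Inl k"] by (auto simp: I_def)
      qed
      have level: "E (nabla W) (wcoeff S W v) j = E (\<lambda>j. nabla W j - \<Lambda> `` {j}) (wcoeff S W u) j"
        if j: "jstar W \<le> j" for j
      proof -
        have "wcoeff S W v j \<xi> = (if \<xi> \<in> nabla W j - \<Lambda> `` {j} then wcoeff S W u j \<xi> else 0)" if "\<xi> \<in> nabla W j" for \<xi>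
          using v[of "Inr (j, \<xi>)"] that j by (auto simp: I_def wav_index_def)
        thus ?thesis unfolding E_def level_norm_def
          using nabla_grid[OF j] by (subst lp_sum_supported) auto
      qed
      have "lq_le q\<^sub>1 {jstar W..} (E (nabla W) (wcoeff S W v)) (C * real m powr (- \<mu>))"
        using pq level by (intro lq_le_mono[OF err, of _ 1]) (auto simp: E_def level_norm_nonneg)
      hence "coeff_norm S W (\<alpha>\<^sub>1 + 2 * (1 / 2 - 1 / p\<^sub>1)) p\<^sub>1 q\<^sub>1 v \<le> ennreal (C * real m powr (- \<mu>))"
        unfolding E_def using pq C by (subst coeff_norm_le_iff) auto
      hence err_v: "?G v \<le> ennreal (C * real m powr (- \<mu>))" by (simp add: besov_norm_def gen0)
      have "best_approx n u (dictionary W) ?G \<le> ?G v"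
        unfolding v_def [abs_def] by (rule best_approx_le[OF I])
      also have "\<dots> \<le> ennreal (C * real m powr (- \<mu>))" by (rule err_v)
      also have "\<dots> \<le> ennreal (C * (4 * C) powr \<mu> * real n powr (- \<mu>))"
        unfolding mult.assoc using C by (intro ennreal_leI mult_left_mono rate) auto
      also have "\<dots> \<le> ennreal (X * real n powr (- \<mu>))"
        by (intro ennreal_leI mult_right_mono) (auto simp: X_def)
      finally show ?thesis .
    next
      case False
      have "coeff_norm S W (\<alpha>\<^sub>1 + 2 * (1 / 2 - 1 / p\<^sub>1)) p\<^sub>1 q\<^sub>1 u \<le> ennreal Ce"
        using emb[OF _ lq] pq Ce unfolding E_def by (subst coeff_norm_le_iff) auto
      moreover have "lp_norm S p\<^sub>1 (gen_proj S W u) \<le> Cg"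
        using order_trans[OF gen mult_left_mono[OF gen1]] Cg by simp
      ultimately have G_u: "?G u \<le> ennreal Cg + ennreal Ce"
        unfolding besov_norm_def by (intro add_mono ennreal_leI) auto
      have "best_approx n u (dictionary W) ?G \<le> ?G u"
        using best_approx_le[of "{}" n u ?G] by simp
      also have "\<dots> \<le> ennreal Cg + ennreal Ce" by (rule G_u)
      also have "\<dots> = ennreal (Cg + Ce)" using Cg Ce by simp
      also have "\<dots> \<le> ennreal (X * real n powr (- \<mu>))"
      proof (rule ennreal_leI)
        have "N0 powr (- \<mu>) \<le> real n powr (- \<mu>)" using False n \<mu> by (intro powr_mono2') auto
        hence "(Cg + Ce) * N0 powr \<mu> * N0 powr (- \<mu>) \<le> X * real n powr (- \<mu>)"
          using X by (intro mult_mono) (auto simp: X_def)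
        moreover have "N0 powr \<mu> * N0 powr (- \<mu>) = 1"
          using C by (simp add: N0_def add_nonneg_pos flip: powr_add)
        ultimately show "Cg + Ce \<le> X * real n powr (- \<mu>)" by (simp add: mult.assoc)
      qed
      finally show ?thesis .
    qed
  qed
  show ?thesis unfolding lesssim_on_def besov_sigma_def best_approx_class_def besov_space_def
    using X main by (intro exI[of _ X]) (auto simp: ennreal_mult' [symmetric] intro!: SUP_least)
qed

text \<open>The test function has coefficient \<open>s j\<close> at all indices of \<Lambda> on
  level \<open>j\<close>. As the values are constant on levels, source norm and remaining error
  involve only cardinalities of sections; \<open>K\<close> contains the wavelet indices an
  approximant may touch.\<close>

lemma le_sigma:
  assumes adm0: "admissible \<alpha>\<^sub>0 p\<^sub>0 q\<^sub>0" and adm1: "admissible \<alpha>\<^sub>1 p\<^sub>1 q\<^sub>1"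
    and \<Lambda>: "finite \<Lambda>" "\<Lambda> \<subseteq> wav_index W" and s: "\<And>j. 0 \<le> s j"
    and source: "lq_le q\<^sub>0 {jstar W..} (\<lambda>j. 2 powr (real j * (\<alpha>\<^sub>0 + 2 * (1 / 2 - 1 / p\<^sub>0))) *
          (real (card (\<Lambda> `` {j})) powr (1 / p\<^sub>0) * s j)) 1"
    and target: "\<And>K D. finite K \<Longrightarrow> card K \<le> n \<Longrightarrow>
          lq_le q\<^sub>1 {jstar W..} (\<lambda>j. 2 powr (real j * (\<alpha>\<^sub>1 + 2 * (1 / 2 - 1 / p\<^sub>1))) *
            (real (card ((\<Lambda> - K) `` {j})) powr (1 / p\<^sub>1) * s j)) D \<Longrightarrow> B \<le> D"
  shows "ennreal B \<le> besov_sigma S W (\<alpha>\<^sub>0, p\<^sub>0, q\<^sub>0) (\<alpha>\<^sub>1, p\<^sub>1, q\<^sub>1) n"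
proof -
  note pq = admissibleD[OF adm0] admissibleD[OF adm1]
  define a :: "nat + nat \<times> (real^3) \<Rightarrow> complex" where "a = case_sum (\<lambda>_. 0) (\<lambda>(j, \<xi>). complex_of_real (s j))"
  define f where "f x = (\<Sum>k\<in>Inr ` \<Lambda>. a k * primal W k x)" for x
  have f: "pairing S f (dual W l) = (if l \<in> Inr ` \<Lambda> then a l else 0)" if "l \<in> basis_index W" for l
    unfolding f_def using \<Lambda> that by (intro pairing_combination) auto
  have f_L2: "f \<in> L2 S" unfolding f_def using \<Lambda> by (intro L2_sum primal_L2) auto
  have sub: "\<Lambda> `` {j} \<subseteq> nabla W j" "finite (\<Lambda> `` {j})" for j
    using \<Lambda> by (auto simp: wav_index_def intro: finite_Image)
  have level: "level_norm \<beta> p\<^sub>0 (nabla W) (wcoeff S W f) j = 2 powr (real j * \<beta>) * (real (card (\<Lambda> `` {j})) powr (1 / p\<^sub>0) * s j)"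
    if j: "jstar W \<le> j" for j \<beta>
  proof -
    have "wcoeff S W f j \<xi> = (if \<xi> \<in> \<Lambda> `` {j} then s j else 0)" if "\<xi> \<in> nabla W j" for \<xi>
      using f[of "Inr (j, \<xi>)"] that j s by (auto simp: wav_index_def a_def)
    hence "lp_sum p\<^sub>0 (nabla W j) (wcoeff S W f j) = lp_sum p\<^sub>0 (\<Lambda> `` {j}) (\<lambda>_. s j)"
      using nabla_grid[OF j] sub by (intro lp_sum_supported) auto
    thus ?thesis using pq s by (simp add: level_norm_def lp_sum_const)
  qed
  have "lq_le q\<^sub>0 {jstar W..} (level_norm (\<alpha>\<^sub>0 + 2 * (1 / 2 - 1 / p\<^sub>0)) p\<^sub>0 (nabla W) (wcoeff S W f)) 1"
    using pq level s by (intro lq_le_mono[OF source, of _ 1]) (auto simp: level_norm_nonneg)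
  hence "coeff_norm S W (\<alpha>\<^sub>0 + 2 * (1 / 2 - 1 / p\<^sub>0)) p\<^sub>0 q\<^sub>0 f \<le> ennreal 1"
    using pq by (subst coeff_norm_le_iff) auto
  moreover have "lp_norm S p\<^sub>0 (gen_proj S W f) = 0"
  proof (rule gen_proj_eq_0)
    fix k assume "k < ngen W"
    thus "pairing S f (dgen W k) = 0" using f[of "Inl k"] by auto
  qed
  ultimately have norm: "besov_norm S W \<alpha>\<^sub>0 p\<^sub>0 q\<^sub>0 f \<le> 1" by (simp add: besov_norm_def)
  hence mem: "f \<in> besov_space S W \<alpha>\<^sub>0 p\<^sub>0 q\<^sub>0"
    using f_L2 by (auto simp: besov_space_def intro: le_less_trans)
  have "ennreal B \<le> best_approx n f (dictionary W) (besov_norm S W \<alpha>\<^sub>1 p\<^sub>1 q\<^sub>1)"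
  proof (rule le_best_approx[OF f_L2])
    fix v and K :: "(nat + nat \<times> (real^3)) set"
    assume K: "finite K" "card K \<le> n"
      and v: "\<And>l. l \<in> basis_index W - K \<Longrightarrow> pairing S v (dual W l) = pairing S f (dual W l)"
    \<comment> \<open>The generators in \<open>K\<close> are dropped: the test function has only
      wavelet coefficients to be removed.\<close>
    define K' where "K' = Inr -` K"
    have K': "finite K'" using K by (simp add: K'_def finite_vimageI)
    have "card K' = card (Inr ` K' :: (nat + nat \<times> (real^3)) set)" by (simp add: card_image)
    also have "\<dots> \<le> card K" using K by (intro card_mono) (auto simp: K'_def)
    finally have card: "card K' \<le> n" using K by simp
    have "ennreal B \<le> coeff_norm S W (\<alpha>\<^sub>1 + 2 * (1 / 2 - 1 / p\<^sub>1)) p\<^sub>1 q\<^sub>1 v"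
    proof (rule le_coeff_norm)
      fix D
      assume D: "lq_le q\<^sub>1 {jstar W..} (level_norm (\<alpha>\<^sub>1 + 2 * (1 / 2 - 1 / p\<^sub>1)) p\<^sub>1 (nabla W) (wcoeff S W v)) D"
      have level_v: "2 powr (real j * (\<alpha>\<^sub>1 + 2 * (1 / 2 - 1 / p\<^sub>1))) * (real (card ((\<Lambda> - K') `` {j})) powr (1 / p\<^sub>1) * s j)
          \<le> level_norm (\<alpha>\<^sub>1 + 2 * (1 / 2 - 1 / p\<^sub>1)) p\<^sub>1 (nabla W) (wcoeff S W v) j" if j: "jstar W \<le> j" for j
      proof -
        have "s j \<le> wcoeff S W v j \<xi>" if "\<xi> \<in> (\<Lambda> - K') `` {j}" for \<xi>
        proof -
          have "Inr (j, \<xi>) \<in> basis_index W - K" "Inr (j, \<xi>) \<in> Inr ` \<Lambda>"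
            using that \<Lambda> by (auto simp: K'_def)
          thus ?thesis using v[of "Inr (j, \<xi>)"] f[of "Inr (j, \<xi>)"] by (auto simp: a_def)
        qed
        hence "lp_sum p\<^sub>1 ((\<Lambda> - K') `` {j}) (\<lambda>_. s j) \<le> lp_sum p\<^sub>1 (nabla W j) (wcoeff S W v j)"
          using pq nabla_grid[OF j] sub s by (intro lp_sum_mono) auto
        thus ?thesis using pq s unfolding level_norm_def by (intro mult_left_mono) (auto simp: lp_sum_const)
      qed
      show "B \<le> D"
        using pq level_v s by (intro target[OF K' card] lq_le_mono[OF D, of _ 1]) (auto simp: level_norm_nonneg)
    qed (use pq in auto)
    thus "ennreal B \<le> besov_norm S W \<alpha>\<^sub>1 p\<^sub>1 q\<^sub>1 v"
      unfolding besov_norm_def by (rule add_increasing[rotated]) simp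
  qed
  thus ?thesis unfolding besov_sigma_def best_approx_class_def
    using mem norm by (auto intro: SUP_upper2)
qed

text \<open>The test functions have \<open>2n\<close> equal coefficients on one level with about \<open>n\<close> wavelets.\<close>

lemma sigma_lower_single_level:
  assumes adm0: "admissible (\<alpha> + \<gamma>) p\<^sub>0 q\<^sub>0" and adm1: "admissible \<alpha> p\<^sub>1 q\<^sub>1"
  shows "\<exists>c>0. \<forall>n\<ge>1. ennreal (c * real n powr (- (\<gamma> / 2))) \<le> besov_sigma S W (\<alpha> + \<gamma>, p\<^sub>0, q\<^sub>0) (\<alpha>, p\<^sub>1, q\<^sub>1) n"
proof -
  note pq = admissibleD[OF adm0] admissibleD[OF adm1]
  define \<beta>\<^sub>0 where "\<beta>\<^sub>0 = \<alpha> + \<gamma> + 2 * (1 / 2 - 1 / p\<^sub>0)"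
  define \<beta>\<^sub>1 where "\<beta>\<^sub>1 = \<alpha> + 2 * (1 / 2 - 1 / p\<^sub>1)"
  define \<tau> where "\<tau> = 1 / p\<^sub>0 - 1 / p\<^sub>1"
  obtain c where c: "c > 0" and card: "\<And>j. jstar W \<le> j \<Longrightarrow> c * 4 ^ j \<le> real (card (nabla W j))"
    using card_nabla_bounds by blast
  \<comment> \<open>With \<open>c * 4 ^ m \<ge> 8\<close> the level \<open>k + m\<close> has at
    least \<open>8 * 4 ^ k\<close> wavelets, which exceeds \<open>2 * n\<close>.\<close>
  obtain m0 :: nat where m0: "8 / c < 4 ^ m0" using real_arch_pow[of 4 "8 / c"] by auto
  define m where "m = max m0 (jstar W)"
  have "(4::real) ^ m0 \<le> 4 ^ m" by (intro power_increasing) (auto simp: m_def)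
  hence "c * 4 ^ m0 \<le> c * 4 ^ m" using c by (intro mult_left_mono) auto
  moreover have "8 < c * 4 ^ m0" using m0 c by (simp add: field_simps)
  ultimately have m: "8 \<le> c * 4 ^ m" by linarith
  \<comment> \<open>For \<open>y = 4 ^ j / n\<close> the surviving error is
    \<open>2 powr (- 1 / p\<^sub>0) * y powr (\<tau> - \<gamma> / 2)\<close> times the claimed rate,
    up to coefficients beyond the first \<open>n\<close> survivors; \<open>y\<close> stays between
    \<open>4 ^ m / 4\<close> and \<open>4 ^ m\<close>.\<close>
  define X where "X = 2 powr (- 1 / p\<^sub>0) * min ((4 ^ m / 4) powr (\<tau> - \<gamma> / 2)) ((4 ^ m) powr (\<tau> - \<gamma> / 2))"
  have "ennreal (X * real n powr (- (\<gamma> / 2))) \<le> besov_sigma S W (\<alpha> + \<gamma>, p\<^sub>0, q\<^sub>0) (\<alpha>, p\<^sub>1, q\<^sub>1) n" if n: "n \<ge> 1" for n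
  proof -
    obtain k where k: "4 ^ k \<le> n" "n < 4 ^ Suc k" using ex_power4_bracket[OF n] by auto
    have k': "4 ^ k \<le> real n" "real n < 4 * 4 ^ k"
      using of_nat_mono[OF k(1), where 'a = real] of_nat_less_iff[of n "4 ^ Suc k", where 'a = real] k(2) by auto
    define j where "j = k + m"
    have j: "jstar W \<le> j" by (simp add: j_def m_def)
    have "2 * real n \<le> 8 * 4 ^ k" using k' by simp
    also have "\<dots> \<le> c * 4 ^ m * 4 ^ k" using m by (intro mult_right_mono) auto
    also have "\<dots> = c * 4 ^ j" by (simp add: j_def power_add)
    finally have "2 * n \<le> card (nabla W j)" using card[OF j] by linarith
    then obtain T where T: "T \<subseteq> nabla W j" "card T = 2 * n"
      using obtain_subset_with_card_n by metis
    have fin: "finite T" using T n by (intro card_ge_0_finite) auto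
    define \<Lambda> where "\<Lambda> = {j} \<times> T"
    \<comment> \<open>Normalizes \<open>2 * n\<close> equal coefficients on level \<open>j\<close>
      to source norm one.\<close>
    define t where "t = 2 powr (- real j * \<beta>\<^sub>0) * (2 * real n) powr (- 1 / p\<^sub>0)"
    define y where "y = 4 ^ j / real n"
    have y: "4 ^ m / 4 \<le> y" "y \<le> 4 ^ m"
    proof -
      have "4 ^ m * real n \<le> 4 ^ m * (4 * 4 ^ k)" using k' by (intro mult_left_mono) auto
      thus "4 ^ m / 4 \<le> y" using n by (simp add: y_def j_def power_add field_simps)
      have "4 ^ m * 4 ^ k \<le> 4 ^ m * real n" using k' by (intro mult_left_mono) auto
      thus "y \<le> 4 ^ m" using n by (simp add: y_def j_def power_add field_simps)
    qed
    have \<Lambda>j: "\<Lambda> `` {i} = (if i = j then T else {})" for i by (auto simp: \<Lambda>_def)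
    have one: "2 powr (real j * \<beta>\<^sub>0) * ((2 * real n) powr (1 / p\<^sub>0) * t) = 1"
    proof -
      have "2 powr (real j * \<beta>\<^sub>0) * ((2 * real n) powr (1 / p\<^sub>0) * t) =
          (2 powr (real j * \<beta>\<^sub>0) * 2 powr (- real j * \<beta>\<^sub>0)) * ((2 * real n) powr (1 / p\<^sub>0) * (2 * real n) powr (- 1 / p\<^sub>0))"
        by (simp add: t_def mult_ac)
      also have "\<dots> = 1" using n by (simp flip: powr_add)
      finally show ?thesis .
    qed
    have "ennreal (2 powr (real j * \<beta>\<^sub>1) * (real n powr (1 / p\<^sub>1) * t)) \<le> besov_sigma S W (\<alpha> + \<gamma>, p\<^sub>0, q\<^sub>0) (\<alpha>, p\<^sub>1, q\<^sub>1) n"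
    proof (rule le_sigma[OF adm0 adm1, of \<Lambda> "\<lambda>_. t"])
      show "\<Lambda> \<subseteq> wav_index W" using T j by (auto simp: \<Lambda>_def wav_index_def)
      show "lq_le q\<^sub>0 {jstar W..} (\<lambda>j. 2 powr (real j * (\<alpha> + \<gamma> + 2 * (1 / 2 - 1 / p\<^sub>0))) *
          (real (card (\<Lambda> `` {j})) powr (1 / p\<^sub>0) * t)) 1"
        unfolding \<beta>\<^sub>0_def [symmetric]
        using pq one T by (intro lq_le_constI[where J = "{j}" and t = 1]) (auto simp: \<Lambda>j)
      fix K :: "(nat \<times> (real^3)) set" and D
      assume K: "finite K" "card K \<le> n" and D: "lq_le q\<^sub>1 {jstar W..} (\<lambda>j. 2 powr (real j * (\<alpha> + 2 * (1 / 2 - 1 / p\<^sub>1))) *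
            (real (card ((\<Lambda> - K) `` {j})) powr (1 / p\<^sub>1) * t)) D"
      have "card ((\<Lambda> - K) `` {j}) = card (\<Lambda> - K)"
      proof -
        have "\<Lambda> - K = Pair j ` ((\<Lambda> - K) `` {j})" by (auto simp: \<Lambda>_def)
        thus ?thesis by (metis card_image inj_on_def prod.inject)
      qed
      moreover have "card \<Lambda> = 2 * n" using T by (simp add: \<Lambda>_def card_cartesian_product_singleton)
      moreover have "card \<Lambda> - card K \<le> card (\<Lambda> - K)" by (rule diff_card_le_card_Diff[OF K(1)])
      ultimately have "real n \<le> real (card ((\<Lambda> - K) `` {j}))" using K by simp
      hence "2 powr (real j * \<beta>\<^sub>1) * (real n powr (1 / p\<^sub>1) * t) \<le>
          2 powr (real j * \<beta>\<^sub>1) * (real (card ((\<Lambda> - K) `` {j})) powr (1 / p\<^sub>1) * t)"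
        using pq by (intro mult_left_mono mult_right_mono powr_mono2) (auto simp: t_def)
      also have "\<dots> \<le> D"
        using lq_le_imp_le[OF D, of j, folded \<beta>\<^sub>1_def] pq j by (simp add: t_def)
      finally show "2 powr (real j * \<beta>\<^sub>1) * (real n powr (1 / p\<^sub>1) * t) \<le> D" .
    qed (use fin in \<open>auto simp: \<Lambda>_def t_def\<close>)
    moreover have "X * real n powr (- (\<gamma> / 2)) \<le> 2 powr (real j * \<beta>\<^sub>1) * (real n powr (1 / p\<^sub>1) * t)"
    proof -
      have "X * real n powr (- (\<gamma> / 2)) \<le> 2 powr (- 1 / p\<^sub>0) * y powr (\<tau> - \<gamma> / 2) * real n powr (- (\<gamma> / 2))"
        unfolding X_def using y by (intro mult_right_mono mult_left_mono min_powr_le) auto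
      also have "\<dots> = 2 powr (- 1 / p\<^sub>0) * (2 powr (2 * real j * (\<tau> - \<gamma> / 2)) * (real n powr (- (\<tau> - \<gamma> / 2)) * real n powr (- (\<gamma> / 2))))"
        using n by (simp add: y_def power4_eq_powr powr_divide powr_powr powr_minus field_simps)
      also have "real n powr (- (\<tau> - \<gamma> / 2)) * real n powr (- (\<gamma> / 2)) = real n powr (1 / p\<^sub>1) * real n powr (- 1 / p\<^sub>0)"
        by (simp add: \<tau>_def flip: powr_add)
      also have "2 * real j * (\<tau> - \<gamma> / 2) = real j * \<beta>\<^sub>1 + - real j * \<beta>\<^sub>0"
        by (simp add: \<tau>_def \<beta>\<^sub>0_def \<beta>\<^sub>1_def algebra_simps)
      also have "2 powr (- 1 / p\<^sub>0) * (2 powr (real j * \<beta>\<^sub>1 + - real j * \<beta>\<^sub>0) * (real n powr (1 / p\<^sub>1) * real n powr (- 1 / p\<^sub>0)))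
          = 2 powr (real j * \<beta>\<^sub>1) * (real n powr (1 / p\<^sub>1) * t)"
        unfolding powr_add t_def by (simp add: powr_mult mult_ac)
      finally show ?thesis .
    qed
    ultimately show ?thesis by (meson ennreal_leI order_trans)
  qed
  moreover have "X > 0" by (simp add: X_def)
  ultimately show ?thesis by blast
qed

text \<open>The test functions have one coefficient on each of \<open>2n\<close> levels.\<close>

lemma sigma_lower_many_levels:
  assumes adm0: "admissible (\<alpha> + \<gamma>) p\<^sub>0 q\<^sub>0" and adm1: "admissible \<alpha> p\<^sub>1 q\<^sub>1"
    and \<gamma>: "\<gamma> = 2 * (1 / p\<^sub>0 - 1 / p\<^sub>1)"
  defines "\<rho> \<equiv> real_of_ereal (1 / q\<^sub>0) - real_of_ereal (1 / q\<^sub>1)"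
  shows "\<exists>c>0. \<forall>n\<ge>1. ennreal (c * real n powr (- \<rho>)) \<le> besov_sigma S W (\<alpha> + \<gamma>, p\<^sub>0, q\<^sub>0) (\<alpha>, p\<^sub>1, q\<^sub>1) n"
proof -
  note pq = admissibleD[OF adm0] admissibleD[OF adm1]
  define \<beta> where "\<beta> = \<alpha> + 2 * (1 / 2 - 1 / p\<^sub>1)"
  \<comment> \<open>The assumption on \<gamma> makes the source weight equal to the target weight,
    so all levels count alike.\<close>
  have \<beta>: "\<alpha> + \<gamma> + 2 * (1 / 2 - 1 / p\<^sub>0) = \<beta>" using \<gamma> by (simp add: \<beta>_def algebra_simps)
  define Q\<^sub>0 where "Q\<^sub>0 = real_of_ereal (1 / q\<^sub>0)"
  define Q\<^sub>1 where "Q\<^sub>1 = real_of_ereal (1 / q\<^sub>1)"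
  have Q1: "Q\<^sub>1 \<ge> 0" using pq(6) by (cases q\<^sub>1) (auto simp: Q\<^sub>1_def one_ereal_def)
  obtain c where c: "c > 0" and card: "\<And>j. jstar W \<le> j \<Longrightarrow> c * 4 ^ j \<le> real (card (nabla W j))"
    using card_nabla_bounds by blast
  have "\<exists>\<xi>. \<xi> \<in> nabla W j" if "jstar W \<le> j" for j
  proof -
    have "0 < c * 4 ^ j" using c by simp
    hence "0 < real (card (nabla W j))" using card[OF that] by linarith
    hence "nabla W j \<noteq> {}" by force
    thus ?thesis by blast
  qed
  then obtain \<xi> where \<xi>: "\<And>j. jstar W \<le> j \<Longrightarrow> \<xi> j \<in> nabla W j" by metis
  have "ennreal (2 powr (- Q\<^sub>0) * real n powr (- \<rho>)) \<le> besov_sigma S W (\<alpha> + \<gamma>, p\<^sub>0, q\<^sub>0) (\<alpha>, p\<^sub>1, q\<^sub>1) n" if n: "n \<ge> 1" for n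
  proof -
    define J where "J = {jstar W..<jstar W + 2 * n}"
    define \<Lambda> where "\<Lambda> = (\<lambda>j. (j, \<xi> j)) ` J"
    define t where "t = (2 * real n) powr (- Q\<^sub>0)"
    define s where "s j = 2 powr (- real j * \<beta>) * t" for j
    have \<Lambda>j: "\<Lambda> `` {i} = (if i \<in> J then {\<xi> i} else {})" for i by (auto simp: \<Lambda>_def)
    have cardJ: "card J = 2 * n" by (simp add: J_def)
    have weight: "2 powr (real j * \<beta>) * s j = t" for j
    proof -
      have "2 powr (real j * \<beta>) * s j = (2 powr (real j * \<beta>) * 2 powr (- real j * \<beta>)) * t" by (simp add: s_def)
      thus ?thesis by (simp flip: powr_add)
    qed
    have "ennreal (real n powr Q\<^sub>1 * t) \<le> besov_sigma S W (\<alpha> + \<gamma>, p\<^sub>0, q\<^sub>0) (\<alpha>, p\<^sub>1, q\<^sub>1) n"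
    proof (rule le_sigma[OF adm0 adm1, of \<Lambda> s])
      show "\<Lambda> \<subseteq> wav_index W" using \<xi> by (auto simp: \<Lambda>_def wav_index_def J_def)
      have "(2 * real n) powr Q\<^sub>0 * t = 1" using n by (simp add: t_def flip: powr_add)
      thus "lq_le q\<^sub>0 {jstar W..} (\<lambda>j. 2 powr (real j * (\<alpha> + \<gamma> + 2 * (1 / 2 - 1 / p\<^sub>0))) *
          (real (card (\<Lambda> `` {j})) powr (1 / p\<^sub>0) * s j)) 1"
        unfolding \<beta> using pq n cardJ weight
        by (intro lq_le_constI[where J = J and t = t]) (auto simp: \<Lambda>j t_def Q\<^sub>0_def J_def)
      fix K :: "(nat \<times> (real^3)) set" and D
      assume K: "finite K" "card K \<le> n" and D: "lq_le q\<^sub>1 {jstar W..} (\<lambda>j. 2 powr (real j * (\<alpha> + 2 * (1 / 2 - 1 / p\<^sub>1))) *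
            (real (card ((\<Lambda> - K) `` {j})) powr (1 / p\<^sub>1) * s j)) D"
      \<comment> \<open>Each level carries a single coefficient, so \<open>K\<close> affects at most
        \<open>n\<close> of the \<open>2 * n\<close> levels.\<close>
      define J' where "J' = J - fst ` K"
      have J': "J' \<subseteq> {jstar W..}" "finite J'" by (auto simp: J'_def J_def)
      have "card J - card (fst ` K) \<le> card J'"
        unfolding J'_def using K by (intro diff_card_le_card_Diff) auto
      moreover have "card (fst ` K) \<le> n" using K card_image_le[of K fst] by simp
      ultimately have card': "n \<le> card J'" using cardJ by linarith
      hence ne: "J' \<noteq> {}" using n by auto
      have "(\<Lambda> - K) `` {j} = {\<xi> j}" if "j \<in> J'" for j
        using that by (force simp: J'_def \<Lambda>_def)
      hence val: "t \<le> 2 powr (real j * \<beta>) * (real (card ((\<Lambda> - K) `` {j})) powr (1 / p\<^sub>1) * s j)" if "j \<in> J'" for j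
        using that weight[of j] by simp
      have "real n powr Q\<^sub>1 * t \<le> real (card J') powr Q\<^sub>1 * t"
        using card' Q1 by (intro mult_right_mono powr_mono2) (auto simp: t_def)
      also have "\<dots> \<le> D"
        unfolding Q\<^sub>1_def using D pq J' ne val by (intro lq_le_constD[OF D[folded \<beta>_def]]) (auto simp: t_def)
      finally show "real n powr Q\<^sub>1 * t \<le> D" .
    qed (auto simp: \<Lambda>_def J_def s_def t_def)
    also have "real n powr Q\<^sub>1 * t = 2 powr (- Q\<^sub>0) * (real n powr Q\<^sub>1 * real n powr (- Q\<^sub>0))"
      by (simp add: t_def powr_mult)
    also have "real n powr Q\<^sub>1 * real n powr (- Q\<^sub>0) = real n powr (- \<rho>)"
      by (simp add: \<rho>_def Q\<^sub>0_def Q\<^sub>1_def flip: powr_add)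
    finally show ?thesis .
  qed
  thus ?thesis by (intro exI[of _ "2 powr (- Q\<^sub>0)"]) auto
qed

end

theorem proposition4p7:
  fixes S :: surface and W :: wavelets and dt :: nat and s_max :: real
    and \<alpha> \<gamma> p\<^sub>0 p\<^sub>1 :: real and q\<^sub>0 q\<^sub>1 :: ereal
  assumes "polyhedral_surface S"
    and "wavelet_basis S W dt s_max"
    and "admissible (\<alpha> + \<gamma>) p\<^sub>0 q\<^sub>0"
    and "admissible \<alpha> p\<^sub>1 q\<^sub>1"
  shows "(\<gamma> > 2 * max 0 (1 / p\<^sub>0 - 1 / p\<^sub>1) \<longrightarrow>
           sim_on {1..} (besov_sigma S W (\<alpha> + \<gamma>, p\<^sub>0, q\<^sub>0) (\<alpha>, p\<^sub>1, q\<^sub>1))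
             (\<lambda>n. ennreal (real n powr (- (\<gamma> / 2))))) \<and>
         (\<gamma> = 2 * max 0 (1 / p\<^sub>0 - 1 / p\<^sub>1) \<and> q\<^sub>0 \<le> q\<^sub>1 \<longrightarrow>
           sim_on {1..} (besov_sigma S W (\<alpha> + \<gamma>, p\<^sub>0, q\<^sub>0) (\<alpha>, p\<^sub>1, q\<^sub>1))
             (\<lambda>n. ennreal (real n powr
                (- min (\<gamma> / 2) (real_of_ereal (1 / q\<^sub>0) - real_of_ereal (1 / q\<^sub>1))))))"
proof -
  interpret wavelet_basis S W dt s_max by fact
  note pq = admissibleD[OF assms(3)] admissibleD[OF assms(4)]
  obtain B where B: "B > 0" "\<And>j. jstar W \<le> j \<Longrightarrow> real (card (nabla W j)) \<le> B * 4 ^ j"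
    using card_nabla_bounds by blast
  interpret G: level_gap "jstar W" "nabla W" B p\<^sub>0 p\<^sub>1
    "\<alpha> + \<gamma> + 2 * (1 / 2 - 1 / p\<^sub>0)" "\<alpha> + 2 * (1 / 2 - 1 / p\<^sub>1)" \<gamma>
    by unfold_locales (use B pq nabla_grid in \<open>auto simp: algebra_simps\<close>)
  note upper = sigma_upper[OF assms(3,4)]
  note lower = lesssim_on_lower[OF sigma_lower_single_level[OF assms(3,4)]]
  have ?thesis if \<gamma>: "\<gamma> > 2 * max 0 (1 / p\<^sub>0 - 1 / p\<^sub>1)"
  proof -
    have \<eta>: "G.\<eta> > 0" using \<gamma> by (simp add: G.\<eta>_def G.\<theta>_def)
    have "\<gamma> \<ge> 0" using \<gamma> by (simp add: max_def split: if_splits)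
    hence "lesssim_on {1..} (besov_sigma S W (\<alpha> + \<gamma>, p\<^sub>0, q\<^sub>0) (\<alpha>, p\<^sub>1, q\<^sub>1)) (\<lambda>n. ennreal (real n powr (- (\<gamma> / 2))))"
      using pq \<eta> by (intro upper G.nterm_surplus G.lq_embedding) auto
    thus ?thesis using \<gamma> lower by (simp add: sim_on_def)
  qed
  moreover have ?thesis if \<gamma>: "\<gamma> = 2 * max 0 (1 / p\<^sub>0 - 1 / p\<^sub>1)" and q: "q\<^sub>0 \<le> q\<^sub>1"
  proof -
    define \<rho> where "\<rho> = real_of_ereal (1 / q\<^sub>0) - real_of_ereal (1 / q\<^sub>1)"
    have \<theta>: "G.\<theta> = \<gamma> / 2" using \<gamma> by (simp add: G.\<theta>_def)
    have \<eta>: "G.\<eta> = 0" unfolding G.\<eta>_def \<theta> by simp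
    have \<gamma>0: "\<gamma> \<ge> 0" using \<gamma> by simp
    have \<rho>: "\<rho> \<ge> 0"
      using q pq by (cases q\<^sub>0; cases q\<^sub>1) (auto simp: \<rho>_def one_ereal_def frac_le)
    have "lesssim_on {1..} (besov_sigma S W (\<alpha> + \<gamma>, p\<^sub>0, q\<^sub>0) (\<alpha>, p\<^sub>1, q\<^sub>1)) (\<lambda>n. ennreal (real n powr (- min (\<gamma> / 2) \<rho>)))"
    proof (rule upper)
      show "min (\<gamma> / 2) \<rho> \<ge> 0" using \<gamma>0 \<rho> by simp
    qed (use G.nterm_limiting[OF pq(3) q \<eta>] G.lq_embedding[of q\<^sub>0 q\<^sub>1] pq q \<eta> in \<open>auto simp: \<theta> \<rho>_def\<close>)
    moreover have "lesssim_on {1..} (\<lambda>n. ennreal (real n powr (- min (\<gamma> / 2) \<rho>))) (besov_sigma S W (\<alpha> + \<gamma>, p\<^sub>0, q\<^sub>0) (\<alpha>, p\<^sub>1, q\<^sub>1))"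
    proof (cases "\<gamma> / 2 \<le> \<rho>")
      case True
      thus ?thesis using lower by (simp add: min_absorb1)
    next
      case False
      \<comment> \<open>Here \<open>\<gamma> / 2 > \<rho> \<ge> 0\<close>, so the maximum is
        positive and is attained by the difference of reciprocals; this is the equality of weights
        required for many levels.\<close>
      hence "\<gamma> = 2 * (1 / p\<^sub>0 - 1 / p\<^sub>1)" using \<gamma> \<rho> by (simp add: max_def split: if_splits)
      thus ?thesis using False lesssim_on_lower[OF sigma_lower_many_levels[OF assms(3,4)]]
        by (simp add: min_absorb2 \<rho>_def)
    qed
    ultimately show ?thesis using \<gamma> by (simp add: sim_on_def \<rho>_def)
  qed
  ultimately show ?thesis by blast
qed


end
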